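(* Let $k\in\{0,1,2,\dots\}$, let $\rho\in\mathbb{C}$ with $|\rho|<1$, let $\gamma\in\mathbb{C}$, and let $a,b,c,d>0$ except for possibly a pair of complex conjugates with positive real parts among $a,b,c$ and $a,b,d$. Then $$ \int_0^\infty (1-\rho)^{-\gamma}\ {}_3F_2\!\left(\begin{matrix}\gamma,\ a+ix,\ a-ix\\ a+b,\ a+c\end{matrix};\frac{\rho}{\rho-1}\right)\left|\frac{\Gamma(a+ix)\Gamma(b+ix)\Gamma(d+ix)}{\Gamma(2ix)}\right|^2S_k(x^2;a,b,d)\,dx $$ $$ =\frac{(\gamma)_k\,\Gamma(a+b)\Gamma(k+a+d)\Gamma(k+b+d)}{(a+c)_k}\ {}_2F_1\!\left(\begin{matrix}-d,\ \gamma+k\\ k+a+c\end{matrix};\rho\right)\rho^k. $$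
   Context: $\Gamma$ is the gamma function. The Pochhammer symbol is $(z)_n=\prod_{i=1}^n(z+i-1)$ for $z\in\mathbb{C}$, $n\in\{0,1,2,\dots\}$ (so $(z)_0=1$). For $a_1,\dots,a_p\in\mathbb{C}$ and $b_1,\dots,b_q\in\mathbb{C}\setminus\{0,-1,-2,\dots\}$ the generalized hypergeometric function is ${}_pF_q(a_1,\dots,a_p;b_1,\dots,b_q;z)=\sum_{n\ge0}\frac{(a_1)_n\cdots(a_p)_n}{(b_1)_n\cdots(b_q)_n}\frac{z^n}{n!}$; for $p=q+1$ it is defined in $|z|<1$ and continued analytically to $\mathbb{C}\setminus[1,\infty)$. The continuous dual Hahn polynomials are $$S_n(x^2;a,b,c)=(a+b)_n(a+c)_n\ {}_3F_2\!\left(\begin{matrix}-n,\ a+ix,\ a-ix\\ a+b,\ a+c\end{matrix};1\right),$$ where the three parameters are positive except for possibly a pair of complex conjugates with positive real parts.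
   Formalization: The printed right-hand side is false (e.g. k=0, ρ=0; or the ρ-coefficient at k=0): a factor 2π is added, and the numerator parameter −d of the 2F1 is corrected to c−d; all hypotheses are as printed, and integrability is also proved. *)

theory Defs
  imports "HOL-Complex_Analysis.Complex_Analysis"
begin

definition hyp_series :: "complex list \<Rightarrow> complex list \<Rightarrow> complex \<Rightarrow> complex" where
  "hyp_series as bs z =
     (\<Sum>n. prod_list (map (\<lambda>a. pochhammer a n) as) / prod_list (map (\<lambda>b. pochhammer b n) bs)
            * (z ^ n / fact n))"

definition hyp_domain :: "complex set" where
  "hyp_domain = - (complex_of_real ` {1..})"

text \<open>
  For p = q + 1, outside the open unit disc and off the cut [1,\<infinity>), the value is that of the
  analytic continuation of the series; it is unique because the slit plane is connected
  (see \<open>hypF_eqI\<close>).  Everywhere else the value is that of the series.  This includes the point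
  z = 1 on the cut, which occurs below only for terminating series.
\<close>

definition hypF :: "complex list \<Rightarrow> complex list \<Rightarrow> complex \<Rightarrow> complex" where
  "hypF as bs z =
     (if length as = Suc (length bs) \<and> 1 \<le> norm z \<and> z \<in> hyp_domain
      then (THE w. \<exists>f. f holomorphic_on hyp_domain \<and>
                       (\<forall>u\<in>ball 0 1. f u = hyp_series as bs u) \<and> w = f z)
      else hyp_series as bs z)"

lemma open_hyp_domain: "open hyp_domain"
proof -
  have "complex_of_real ` {1..} = {z. Im z = 0} \<inter> {z. 1 \<le> Re z}"
    by (auto simp: complex_eq_iff image_iff intro!: bexI[of _ "Re _"])
  moreover have "closed ({z. Im z = 0} \<inter> {z. 1 \<le> Re z})"
    by (intro closed_Int closed_Collect_eq closed_Collect_le continuous_intros)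
  ultimately show ?thesis
    unfolding hyp_domain_def by (metis open_Compl)
qed

lemma connected_hyp_domain: "connected hyp_domain"
proof (rule starlike_imp_connected)
  have "closed_segment 0 z \<subseteq> hyp_domain" if z: "z \<in> hyp_domain" for z
  proof
    fix w assume "w \<in> closed_segment 0 z"
    then obtain t where t: "0 \<le> t" "t \<le> 1" "w = of_real t * z"
      by (auto simp: closed_segment_def scaleR_conv_of_real)
    show "w \<in> hyp_domain"
    proof (rule ccontr)
      assume "w \<notin> hyp_domain"
      then obtain r :: real where r: "1 \<le> r" "of_real t * z = of_real r"
        using t by (auto simp: hyp_domain_def)
      then have "t > 0"
        using t by (cases "t = 0") auto
      then have "z = of_real (r / t)"
        using r by (simp add: field_simps)
      moreover have "1 \<le> r / t"
        using r t \<open>t > 0\<close> by (simp add: field_simps)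
      ultimately show False
        using z unfolding hyp_domain_def by blast
    qed
  qed
  moreover have "0 \<in> hyp_domain"
    by (auto simp: hyp_domain_def)
  ultimately show "starlike hyp_domain"
    unfolding starlike_def by blast
qed

lemma ball_subset_hyp_domain: "ball 0 1 \<subseteq> hyp_domain"
  by (auto simp: hyp_domain_def)

lemma hypF_eqI:
  assumes f: "f holomorphic_on hyp_domain" "\<And>u. u \<in> ball 0 1 \<Longrightarrow> f u = hyp_series as bs u"
    and len: "length as = Suc (length bs)" and z: "z \<in> hyp_domain"
  shows "hypF as bs z = f z"
proof (cases "1 \<le> norm z")
  case True
  have "(THE w. \<exists>f. f holomorphic_on hyp_domain \<and>
                    (\<forall>u\<in>ball 0 1. f u = hyp_series as bs u) \<and> w = f z) = f z"
  proof (rule the_equality)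
    show "\<exists>g. g holomorphic_on hyp_domain \<and>
              (\<forall>u\<in>ball 0 1. g u = hyp_series as bs u) \<and> f z = g z"
      using f by blast
  next
    fix w assume "\<exists>g. g holomorphic_on hyp_domain \<and>
                      (\<forall>u\<in>ball 0 1. g u = hyp_series as bs u) \<and> w = g z"
    then obtain g where g: "g holomorphic_on hyp_domain"
        "\<And>u. u \<in> ball 0 1 \<Longrightarrow> g u = hyp_series as bs u" "w = g z"
      by blast
    have "g z = f z"
      by (rule analytic_continuation_open[of "ball 0 1" hyp_domain])
        (use f g z open_hyp_domain connected_hyp_domain ball_subset_hyp_domain in auto)
    then show "w = f z"
      using g by simp
  qed
  then show ?thesis
    using True len z by (simp add: hypF_def)
next
  case False
  then show ?thesis
    using f(2)[of z] by (simp add: hypF_def)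
qed

text \<open>
  \<open>cdual_hahn n x a b c\<close> is the polynomial \<open>S\<^sub>n\<close> evaluated at \<open>x\<^sup>2\<close>; note that the argument is
  \<open>x\<close>, not \<open>x\<^sup>2\<close>.
\<close>

definition cdual_hahn :: "nat \<Rightarrow> real \<Rightarrow> complex \<Rightarrow> complex \<Rightarrow> complex \<Rightarrow> complex" where
  "cdual_hahn n x a b c =
     pochhammer (a + b) n * pochhammer (a + c) n *
     hypF [- of_nat n, a + \<i> * of_real x, a - \<i> * of_real x] [a + b, a + c] 1"

definition pos_param :: "complex \<Rightarrow> bool" where
  "pos_param z \<longleftrightarrow> z \<in> \<real> \<and> 0 < Re z"

definition conj_params :: "complex \<Rightarrow> complex \<Rightarrow> bool" where
  "conj_params z w \<longleftrightarrow> w = cnj z \<and> 0 < Re z"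

definition dual_hahn_params :: "complex \<Rightarrow> complex \<Rightarrow> complex \<Rightarrow> bool" where
  "dual_hahn_params a b c \<longleftrightarrow>
     (pos_param a \<and> pos_param b \<and> pos_param c) \<or>
     (conj_params a b \<and> pos_param c) \<or>
     (conj_params a c \<and> pos_param b) \<or>
     (conj_params b c \<and> pos_param a)"

text \<open>
  The weight |\<Gamma>(a+ix) \<Gamma>(b+ix) \<Gamma>(d+ix) / \<Gamma>(2ix)|^2 on (0,\<infinity>) is used below without the
  normalising factor 1/(2\<pi>): its total mass is 2 \<pi> \<Gamma>(a+b) \<Gamma>(a+d) \<Gamma>(b+d).  This is why the
  closed form of the integral carries a factor 2 \<pi>.  The parameter c - d of the 2F1 in it is the
  shift between the parameter triples (a,b,c) and (a,b,d): for c = d only the term of degree k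
  of the generating function survives, and the 2F1 must reduce to 1.  The source prints neither
  the factor 2 \<pi> nor the c in c - d.
\<close>

end

theory Submission
  imports Defs "HOL-Probability.Sinc_Integral"
begin

text \<open>
  The function multiplying the polynomial in the integrand is the sum over \<open>n\<close> of
  \<open>(\<gamma>)\<^sub>n \<rho>\<^sup>n / (n! (a+b)\<^sub>n (a+c)\<^sub>n)\<close> times the polynomial \<open>S\<^sub>n\<close> with parameters \<open>a, b, c\<close>.
  Integrating term by term against \<open>S\<^sub>k\<close> with parameters \<open>a, b, d\<close> leaves finite sums that
  Chu--Vandermonde evaluates, because \<open>(a+ix)\<^sub>j (a-ix)\<^sub>j\<close> times the weight is the weight with \<open>a\<close>
  replaced by \<open>a+j\<close>.  The interchange is justified by the \<open>L\<^sup>2\<close> norm of \<open>S\<^sub>n\<close> and the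
  Cauchy--Schwarz inequality, and the continuation of the 3F2 to the slit plane by two Euler integrals.

  The total mass \<open>I(a,b,d)\<close> of the weight satisfies \<open>I(a+1,b,d) = (a+b)(a+d) I(a,b,d)\<close> by a contour
  shift.  As \<open>I(a,b,d) / \<Gamma>(a)\<^sup>2\<close> increases with \<open>a\<close>, the quotient of \<open>I(a,b,d)\<close> by
  \<open>\<Gamma>(a+b) \<Gamma>(a+d) \<Gamma>(b+d)\<close> is both periodic and increasing, hence constant, and its value is found
  from the limit \<open>a \<rightarrow> 0\<close> at \<open>b = d = 1/2\<close>.  Complex parameters follow by analytic continuation.
\<close>

text \<open>Rearranging the 3F2 series cannot prove the generating function: for Re \<rho> >= 1/2
  the point \<open>\<rho> / (\<rho> - 1)\<close> lies outside the open unit disc. So the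
  coefficients are computed at 0, and holomorphy on the whole disc, which z/(z-1) maps off the cut,
  carries the identity to all |\<rho>| < 1. The Cauchy-Schwarz step meets a mismatch: the norm of
  S_n is known for the weight with c, while the integrand carries the weight with d. Their quotient
  grows at most polynomially in x, which the exponential decay of the weight absorbs. That the
  normalised mass increases does not follow at once from the monotonicity of I / Gamma(a)^2, since
  the Gamma quotient between the two also varies with a. Evaluation at a + n removes it:
  Gamma(a+n+b) Gamma(a+n+d) / Gamma(a+n)^2 is asymptotic to n^(b+d) for every a, and periodicity
  brings the comparison back to a. Masses are computed over the whole line, where the even weight
  has the constant 4 pi; the half-line has 2 pi.\<close>

section \<open>Integrals depending holomorphically on a parameter\<close>

text \<open>Domination is asked only locally in z. Cauchy's inequality turns the bound on f into one
  on its z-derivative, so the difference quotients are dominated by a multiple of \<open>g\<close>.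
  The measure is arbitrary because the result serves both the line and the unit interval.\<close>

lemma holomorphic_on_lebesgue_integral:
  fixes f :: "complex \<Rightarrow> 'a \<Rightarrow> complex"
  assumes S: "open S"
    and hol: "\<And>x. x \<in> space M \<Longrightarrow> (\<lambda>z. f z x) holomorphic_on S"
    and meas: "\<And>z. z \<in> S \<Longrightarrow> f z \<in> borel_measurable M"
    and dom: "\<And>z. z \<in> S \<Longrightarrow> \<exists>r>0. \<exists>g. integrable M g \<and>
                 (\<forall>w\<in>ball z r \<inter> S. \<forall>x\<in>space M. norm (f w x) \<le> g x)"
  shows "(\<lambda>z. LINT x|M. f z x) holomorphic_on S"
proof -
  have "\<exists>D. ((\<lambda>z. LINT x|M. f z x) has_field_derivative D) (at z0)" if z0: "z0 \<in> S" for z0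
  proof -
    obtain r1 g where r1: "r1 > 0" "integrable M g"
        "\<And>w x. w \<in> ball z0 r1 \<inter> S \<Longrightarrow> x \<in> space M \<Longrightarrow> norm (f w x) \<le> g x"
      using dom[OF z0] by blast
    obtain r2 where r2: "r2 > 0" "ball z0 r2 \<subseteq> S"
      using S z0 open_contains_ball by blast
    define r where "r = min r1 r2"
    have r: "r > 0" "ball z0 r \<subseteq> S"
      and g: "\<And>w x. w \<in> ball z0 r \<Longrightarrow> x \<in> space M \<Longrightarrow> norm (f w x) \<le> g x"
      using r1 r2 by (auto simp: r_def)
    have lip: "norm (f w x - f z0 x) \<le> g x / (r / 3) * norm (w - z0)"
      if w: "w \<in> ball z0 (r / 2)" and x: "x \<in> space M" for w x
    proof (rule field_differentiable_bound[of "ball z0 (r/2)" "\<lambda>z. f z x" "\<lambda>z. deriv (\<lambda>z. f z x) z"])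
      fix v assume v: "v \<in> ball z0 (r / 2)"
      \<comment> \<open>1/2 + 1/3 < 1, so every disc used for Cauchy's inequality stays inside
        \<open>ball z0 r\<close>.\<close>
      have sub: "cball v (r / 3) \<subseteq> ball z0 r"
      proof
        fix u assume "u \<in> cball v (r / 3)"
        with v have "dist z0 u \<le> dist z0 v + dist v u" "dist z0 v < r / 2" "dist v u \<le> r / 3"
          by (auto intro: dist_triangle)
        with r(1) show "u \<in> ball z0 r" by simp
      qed
      have hS: "(\<lambda>z. f z x) holomorphic_on cball v (r / 3)"
        using holomorphic_on_subset[OF hol[OF x]] sub r(2) by blast
      show "((\<lambda>z. f z x) has_field_derivative deriv (\<lambda>z. f z x) v) (at v within ball z0 (r / 2))"
      proof -
        have "(\<lambda>z. f z x) holomorphic_on ball z0 r"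
          using holomorphic_on_subset[OF hol[OF x]] r(2) by blast
        then show ?thesis
          by (rule holomorphic_derivI[THEN has_field_derivative_at_within, of _ "ball z0 r"]) (use v r in auto)
      qed
      have "norm ((deriv ^^ 1) (\<lambda>z. f z x) v) \<le> fact 1 * g x / (r / 3) ^ 1"
      proof (rule Cauchy_inequality)
        show "(\<lambda>z. f z x) holomorphic_on ball v (r / 3)"
          using hS holomorphic_on_subset ball_subset_cball by blast
        show "continuous_on (cball v (r / 3)) (\<lambda>z. f z x)"
          using hS holomorphic_on_imp_continuous_on by blast
        fix u assume "norm (v - u) = r / 3"
        then show "norm (f u x) \<le> g x"
          using g[of u x] sub x by (auto simp: dist_norm)
      qed (use r in auto)
      then show "norm (deriv (\<lambda>z. f z x) v) \<le> g x / (r / 3)" by simp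
    qed (use w r in auto)
    define D where "D = (LINT x|M. deriv (\<lambda>z. f z x) z0)"
    have meas': "f w \<in> borel_measurable M" if "w \<in> ball z0 r" for w
      using that r meas by blast
    have int: "integrable M (f w)" if "w \<in> ball z0 r" for w
    proof (rule Bochner_Integration.integrable_bound[OF r1(2)])
      show "f w \<in> borel_measurable M" using meas' that by blast
      show "AE x in M. norm (f w x) \<le> norm (g x)"
        using g[OF that] by (intro AE_I2) (force intro: order_trans)
    qed
    have "((\<lambda>z. LINT x|M. f z x) has_field_derivative D) (at z0)"
      unfolding has_field_derivative_iff tendsto_at_iff_sequentially
    proof (intro allI impI)
      fix X :: "nat \<Rightarrow> complex"
      assume X: "\<forall>i. X i \<in> UNIV - {z0}" "X \<longlonglongrightarrow> z0"
      have "eventually (\<lambda>n. X n \<in> ball z0 (r / 2)) sequentially"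
        using X(2) r by (intro topological_tendstoD) auto
      then obtain N where N: "\<And>n. n \<ge> N \<Longrightarrow> X n \<in> ball z0 (r / 2)"
        by (auto simp: eventually_sequentially)
      define Y where "Y = (\<lambda>n. X (n + N))"
      have Y: "Y n \<in> ball z0 (r / 2)" "Y n \<in> ball z0 r" "Y n \<noteq> z0" for n
        using N[of "n + N"] X(1) r by (auto simp: Y_def)
      have Yl: "Y \<longlonglongrightarrow> z0" unfolding Y_def using X(2) by (rule LIMSEQ_ignore_initial_segment)
      have z0r: "z0 \<in> ball z0 r" using r by auto
      have lim: "(\<lambda>n. (f (Y n) x - f z0 x) / (Y n - z0)) \<longlonglongrightarrow> deriv (\<lambda>z. f z x) z0"
        if x: "x \<in> space M" for x
      proof -
        have "((\<lambda>z. f z x) has_field_derivative deriv (\<lambda>z. f z x) z0) (at z0)"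
          using hol[OF x] S z0 by (rule holomorphic_derivI)
        then show ?thesis
          unfolding has_field_derivative_iff tendsto_at_iff_sequentially o_def
          using Y Yl by auto
      qed
      have "(\<lambda>n. LINT x|M. (f (Y n) x - f z0 x) / (Y n - z0)) \<longlonglongrightarrow> D"
        unfolding D_def
      proof (rule integral_dominated_convergence[where w="\<lambda>x. g x / (r / 3)"])
        have m: "(\<lambda>x. (f (Y n) x - f z0 x) / (Y n - z0)) \<in> borel_measurable M" for n
          using meas'[OF Y(2)] meas'[OF z0r] by measurable
        then show "\<And>n. (\<lambda>x. (f (Y n) x - f z0 x) / (Y n - z0)) \<in> borel_measurable M" .
        show "(\<lambda>x. deriv (\<lambda>z. f z x) z0) \<in> borel_measurable M"
          using m lim by (rule borel_measurable_LIMSEQ_metric)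
        show "integrable M (\<lambda>x. g x / (r / 3))" using r1(2) by simp
        show "AE x in M. (\<lambda>n. (f (Y n) x - f z0 x) / (Y n - z0)) \<longlonglongrightarrow> deriv (\<lambda>z. f z x) z0"
          using lim by (intro AE_I2)
        fix n
        show "AE x in M. norm ((f (Y n) x - f z0 x) / (Y n - z0)) \<le> g x / (r / 3)"
          using lip[OF Y(1)[of n]] Y(3)[of n] by (intro AE_I2) (simp add: norm_divide field_simps)
      qed
      moreover have "(LINT x|M. (f (Y n) x - f z0 x) / (Y n - z0)) =
          ((LINT x|M. f (Y n) x) - (LINT x|M. f z0 x)) / (Y n - z0)" for n
        using int[OF Y(2)[of n]] int[OF z0r] by simp
      ultimately have "(\<lambda>n. ((LINT x|M. f (Y n) x) - (LINT x|M. f z0 x)) / (Y n - z0)) \<longlonglongrightarrow> D"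
        by (simp only:)
      then show "((\<lambda>y. ((LINT x|M. f y x) - (LINT x|M. f z0 x)) / (y - z0)) \<circ> X) \<longlonglongrightarrow> D"
        unfolding o_def Y_def by (rule LIMSEQ_offset)
    qed
    then show ?thesis by blast
  qed
  then show ?thesis
    using S by (auto simp: holomorphic_on_open)
qed

text \<open>The positive reals accumulate at 1 inside the half-plane. This carries the mass and the
  Beta integral from real to complex parameters, one parameter at a time.\<close>

lemma eq_on_right_halfplane:
  assumes "f holomorphic_on {z. Re z > 0}" "g holomorphic_on {z. Re z > 0}"
    and "\<And>r. r > 0 \<Longrightarrow> f (of_real r) = g (of_real r)" and z: "Re z > 0"
  shows "f z = g z"
proof -
  have "f z - g z = 0"
  proof (rule analytic_continuation[of "\<lambda>z. f z - g z" "{a. Re a > 0}" "of_real ` {0<..}" 1])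
    show "(\<lambda>z. f z - g z) holomorphic_on {a. Re a > 0}"
      using assms by (intro holomorphic_intros)
    show "open {a. 0 < Re a}" by (rule open_halfspace_Re_gt)
    show "connected {a. 0 < Re a}" by (intro convex_connected convex_halfspace_Re_gt)
    show "(1::complex) islimpt of_real ` {0<..}"
      unfolding islimpt_approachable
    proof (intro allI impI)
      fix e :: real assume "e > 0"
      then show "\<exists>x'\<in>complex_of_real ` {0<..}. x' \<noteq> 1 \<and> dist x' 1 < e"
        by (intro bexI[of _ "of_real (1 + e / 2)"] imageI) (auto simp: dist_norm norm_divide)
    qed
  qed (use assms in auto)
  then show ?thesis by simp
qed

section \<open>Bounds for the Gamma function on vertical lines\<close>

text \<open>In Euler's limit n! n^r cancels and |n^(ix)| = 1, leaving the product of (r + k) / |r +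
  k + ix|, each factor of which increases with r. The vertical decay of Gamma, the monotonicity of
  the mass and the comparison of two weights all rest on this.\<close>

lemma Gamma_norm_ratio_mono:
  fixes s t x :: real
  assumes "0 < s" "s \<le> t"
  shows "norm (Gamma (of_real s + \<i> * of_real x)) / Gamma s
       \<le> norm (Gamma (of_real t + \<i> * of_real x)) / Gamma t"
proof -
  define R where "R = (\<lambda>r n. norm (Gamma_series (of_real r + \<i> * of_real x) n) / Gamma_series r n)"
  have R: "R r n = (\<Prod>k\<le>n. (r + real k) / norm (of_real (r + real k) + \<i> * of_real x))" if "r > 0" for r and n :: nat
  proof -
    have "R r n = pochhammer r (Suc n) / norm (pochhammer (of_real r + \<i> * of_real x) (Suc n))"
      by (simp add: R_def Gamma_series_def norm_mult norm_divide)
    also have "pochhammer r (Suc n) = (\<Prod>k\<le>n. (r + real k))"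
      by (simp add: pochhammer_prod lessThan_Suc_atMost atLeast0LessThan)
    also have "norm (pochhammer (of_real r + \<i> * of_real x) (Suc n)) =
        (\<Prod>k\<le>n. norm (of_real (r + real k) + \<i> * of_real x))"
      by (simp add: pochhammer_prod lessThan_Suc_atMost prod_norm add_ac atLeast0LessThan)
    finally show ?thesis by (simp add: prod_dividef)
  qed
  have lim: "R r \<longlonglongrightarrow> norm (Gamma (of_real r + \<i> * of_real x)) / Gamma r" if "r > 0" for r
    unfolding R_def using that
    by (intro tendsto_intros) (auto simp: Gamma_eq_zero_iff dest: nonpos_Ints_nonpos)
  have "R s n \<le> R t n" for n
  proof -
    have "(s + k) / norm (of_real (s + k) + \<i> * of_real x) \<le> (t + k) / norm (of_real (t + k) + \<i> * of_real x)"
      for k :: nat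
    proof -
      have st: "0 < s + k" "s + k \<le> t + k" using assms by auto
      have "(s + k) * sqrt ((t + k)\<^sup>2 + x\<^sup>2) \<le> (t + k) * sqrt ((s + k)\<^sup>2 + x\<^sup>2)"
      proof (rule power2_le_imp_le)
        have "(s + k)\<^sup>2 * x\<^sup>2 \<le> (t + k)\<^sup>2 * x\<^sup>2"
          using st by (intro mult_right_mono power_mono) auto
        then show "((s + k) * sqrt ((t + k)\<^sup>2 + x\<^sup>2))\<^sup>2 \<le> ((t + k) * sqrt ((s + k)\<^sup>2 + x\<^sup>2))\<^sup>2"
          by (simp add: power_mult_distrib distrib_left mult.commute)
      qed (use st in auto)
      moreover have "sqrt ((s + k)\<^sup>2 + x\<^sup>2) > 0" "sqrt ((t + k)\<^sup>2 + x\<^sup>2) > 0"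
        using st by (auto intro!: add_pos_nonneg)
      ultimately show ?thesis
        unfolding cmod_def by (simp add: divide_simps)
    qed
    then show ?thesis
      using assms by (auto simp: R intro!: prod_mono divide_nonneg_nonneg)
  qed
  then show ?thesis
    using lim[of s] lim[of t] assms by (intro LIMSEQ_le[of "R s" _ "R t"]) auto
qed

text \<open>On the line Re z = 1/2 the conjugate of z is 1 - z, so the reflection formula gives the
  modulus exactly.\<close>

lemma Gamma_norm_half: "norm (Gamma (1/2 + \<i> * of_real x)) = sqrt (pi / cosh (pi * x))"
proof -
  have "cnj (1/2 + \<i> * of_real x) = 1 - (1/2 + \<i> * of_real x)" by (simp add: complex_eq_iff)
  then have "of_real ((norm (Gamma (1/2 + \<i> * of_real x)))\<^sup>2)
      = Gamma (1/2 + \<i> * of_real x) * Gamma (1 - (1/2 + \<i> * of_real x))"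
    by (metis cnj_Gamma complex_norm_square)
  also have "\<dots> = of_real pi / sin (of_real pi * (1/2 + \<i> * of_real x))"
    by (rule Gamma_reflection_complex)
  also have "sin (of_real pi * (1/2 + \<i> * of_real x)) = of_real (cosh (pi * x))"
  proof -
    have "sin (of_real pi * (1/2 + \<i> * of_real x)) = cos (\<i> * of_real (pi * x))"
      by (simp add: ring_distribs sin_add mult_ac flip: sin_of_real cos_of_real)
    also have "\<dots> = of_real (cosh (pi * x))"
      by (simp add: cos_i_times cosh_field_def exp_minus flip: exp_of_real)
    finally show ?thesis .
  qed
  finally have "(norm (Gamma (1/2 + \<i> * of_real x)))\<^sup>2 = pi / cosh (pi * x)"
    by (metis of_real_divide of_real_eq_iff)
  then show ?thesis by (metis norm_ge_zero real_sqrt_unique)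
qed


lemma pos_Re_notin_nonpos_Ints: "0 < Re z \<Longrightarrow> z \<notin> \<int>\<^sub>\<le>\<^sub>0"
  by (auto elim!: nonpos_Ints_cases)

lemma one_plus_le_exp:
  fixes e y :: real
  assumes "e > 0" "y \<ge> 0"
  shows "1 + y \<le> (1 + 1 / e) * exp (e * y)"
proof -
  have "0 \<le> e * y" using assms by simp
  then have "e * y \<le> exp (e * y)" "1 \<le> exp (e * y)"
    using exp_ge_add_one_self[of "e * y"] by linarith+
  then have "y \<le> (1 / e) * exp (e * y)"
    using assms by (simp add: field_simps)
  with \<open>1 \<le> exp (e * y)\<close> have "1 + y \<le> exp (e * y) + (1 / e) * exp (e * y)"
    by (intro add_mono)
  then show ?thesis by (simp only: distrib_right mult_1)
qed

text \<open>A unit step to the right costs a linear factor, paid for by giving up half of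
  \<open>e\<close> in the exponential rate; hence \<open>e\<close> must be arbitrary in the
  induction.\<close>

lemma Gamma_norm_half_integer_bound:
  assumes "0 < e"
  shows "\<exists>C>0. \<forall>x. norm (Gamma (of_nat m + 1/2 + \<i> * of_real x)) \<le> C * exp (- (pi / 2 - e) * \<bar>x\<bar>)"
  using assms
proof (induction m arbitrary: e)
  case 0
  have "norm (Gamma (1/2 + \<i> * of_real x)) \<le> sqrt (2 * pi) * exp (- (pi / 2 - e) * \<bar>x\<bar>)" for x
  proof -
    have "exp (pi * \<bar>x\<bar>) \<le> 2 * cosh (pi * x)"
      by (cases "x \<ge> 0") (auto simp: cosh_field_def)
    moreover have "cosh (pi * x) > 0" by simp
    ultimately have "pi / cosh (pi * x) \<le> (2 * pi) * exp (- (pi * \<bar>x\<bar>))"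
      by (simp add: exp_minus field_simps)
    then have "norm (Gamma (1/2 + \<i> * of_real x)) \<le> sqrt ((2 * pi) * exp (- (pi * \<bar>x\<bar>)))"
      unfolding Gamma_norm_half by (rule real_sqrt_le_mono)
    also have "exp (- (pi * \<bar>x\<bar>)) = (exp (- (pi / 2) * \<bar>x\<bar>))\<^sup>2"
      by (simp flip: exp_double)
    also have "sqrt (2 * pi * \<dots>) = sqrt (2 * pi) * exp (- (pi / 2) * \<bar>x\<bar>)"
      by (simp add: real_sqrt_mult)
    also have "\<dots> \<le> sqrt (2 * pi) * exp (- (pi / 2 - e) * \<bar>x\<bar>)"
      using 0 by (intro mult_left_mono) (auto simp: algebra_simps)
    finally show ?thesis .
  qed
  then show ?case
    by (intro exI[of _ "sqrt (2 * pi)"]) auto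
next
  case (Suc m)
  from Suc.IH[of "e / 2"] Suc.prems obtain C where C: "C > 0"
    "\<And>x. norm (Gamma (of_nat m + 1/2 + \<i> * of_real x)) \<le> C * exp (- (pi / 2 - e / 2) * \<bar>x\<bar>)"
    by auto
  define K where "K = (real m + 1) * (1 + 1 / (e / 2))"
  have K: "K > 0" using Suc.prems unfolding K_def by (intro mult_pos_pos) (auto simp: add_pos_nonneg add_nonneg_pos)
  have "norm (Gamma (of_nat (Suc m) + 1/2 + \<i> * of_real x)) \<le> (K * C) * exp (- (pi / 2 - e) * \<bar>x\<bar>)" for x
  proof -
    let ?z = "of_nat m + 1/2 + \<i> * of_real x :: complex"
    have "?z \<notin> \<int>\<^sub>\<le>\<^sub>0" by (rule pos_Re_notin_nonpos_Ints) (simp add: field_simps add_nonneg_pos)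
    then have "Gamma (of_nat (Suc m) + 1/2 + \<i> * of_real x) = ?z * Gamma ?z"
      using Gamma_plus1[of ?z] by (simp add: add_ac)
    then have "norm (Gamma (of_nat (Suc m) + 1/2 + \<i> * of_real x)) = norm ?z * norm (Gamma ?z)"
      by (simp add: norm_mult)
    also have "\<dots> \<le> (K * exp (e / 2 * \<bar>x\<bar>)) * (C * exp (- (pi / 2 - e / 2) * \<bar>x\<bar>))"
    proof (rule mult_mono)
      have "norm ?z \<le> norm (of_nat m + 1/2 :: complex) + norm (\<i> * of_real x)"
        by (rule norm_triangle_ineq)
      also have "norm (of_nat m + 1/2 :: complex) \<le> real m + 1"
        by (rule order.trans[OF norm_triangle_ineq]) simp
      also have "norm (\<i> * of_real x) \<le> (real m + 1) * \<bar>x\<bar>"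
        using mult_right_mono[of 1 "real m + 1" "\<bar>x\<bar>"] by (simp add: norm_mult)
      finally have "norm ?z \<le> (real m + 1) * (1 + \<bar>x\<bar>)" by (simp add: algebra_simps)
      also have "\<dots> \<le> (real m + 1) * ((1 + 1 / (e / 2)) * exp (e / 2 * \<bar>x\<bar>))"
        using one_plus_le_exp[of "e / 2" "\<bar>x\<bar>"] Suc.prems by (intro mult_left_mono) auto
      finally show "norm ?z \<le> K * exp (e / 2 * \<bar>x\<bar>)" by (simp add: K_def mult.assoc)
    qed (use C K in auto)
    also have "\<dots> = (K * C) * exp (e / 2 * \<bar>x\<bar> + (- (pi / 2 - e / 2) * \<bar>x\<bar>))"
      by (simp only: exp_add mult_ac)
    also have "e / 2 * \<bar>x\<bar> + (- (pi / 2 - e / 2) * \<bar>x\<bar>) = - (pi / 2 - e) * \<bar>x\<bar>"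
      by (simp add: field_simps)
    finally show ?thesis .
  qed
  then show ?case using K C by (intro exI[of _ "K * C"]) auto
qed

text \<open>\<open>Gamma_norm_ratio_mono\<close> compares every line of the strip with one
  half-integer line at or beyond \<open>s2\<close>, and the real Gamma function is bounded on the
  compact interval.\<close>

lemma Gamma_strip_bound:
  fixes s1 s2 :: real
  assumes "0 < s1" "0 < e"
  shows "\<exists>C>0. \<forall>s x. s1 \<le> s \<longrightarrow> s \<le> s2 \<longrightarrow>
           norm (Gamma (of_real s + \<i> * of_real x)) \<le> C * exp (- (pi / 2 - e) * \<bar>x\<bar>)"
proof -
  obtain m :: nat where m: "s2 \<le> real m + 1/2"
    by (metis add.commute add_increasing divide_nonneg_nonneg one_le_numeral order.trans real_arch_simple zero_le_one zero_le_numeral)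
  obtain C where C: "C > 0" "\<And>x. norm (Gamma (of_nat m + 1/2 + \<i> * of_real x)) \<le> C * exp (- (pi / 2 - e) * \<bar>x\<bar>)"
    using Gamma_norm_half_integer_bound[OF assms(2)] by blast
  have "continuous_on {s1..s2} (Gamma :: real \<Rightarrow> real)"
    using assms by (intro continuous_intros) (auto dest: nonpos_Ints_nonpos)
  then have "bounded ((Gamma :: real \<Rightarrow> real) ` {s1..s2})"
    by (intro compact_imp_bounded compact_continuous_image compact_Icc)
  then obtain B where "B > 0" "\<forall>s\<in>{s1..s2}. \<bar>Gamma s\<bar> \<le> B"
    by (auto simp: bounded_pos)
  then have B: "\<And>s. s1 \<le> s \<Longrightarrow> s \<le> s2 \<Longrightarrow> \<bar>Gamma s\<bar> \<le> B" "B > 0"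
    by auto
  define G where "G = Gamma (real m + 1/2)"
  have G: "G > 0" by (simp add: G_def add_nonneg_pos)
  have "norm (Gamma (of_real s + \<i> * of_real x)) \<le> (B / G * C) * exp (- (pi / 2 - e) * \<bar>x\<bar>)"
    if s: "s1 \<le> s" "s \<le> s2" for s x
  proof -
    have Gs: "Gamma s > 0" using s assms by simp
    have "norm (Gamma (of_real s + \<i> * of_real x)) / Gamma s
        \<le> norm (Gamma (of_real (real m + 1/2) + \<i> * of_real x)) / G"
      unfolding G_def using s m assms by (intro Gamma_norm_ratio_mono) auto
    also have "\<dots> \<le> (C * exp (- (pi / 2 - e) * \<bar>x\<bar>)) / G"
      using C(2)[of x] G by (intro divide_right_mono) auto
    finally have "norm (Gamma (of_real s + \<i> * of_real x)) \<le> Gamma s * ((C * exp (- (pi / 2 - e) * \<bar>x\<bar>)) / G)"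
      using Gs by (simp add: field_simps)
    also have "\<dots> \<le> B * ((C * exp (- (pi / 2 - e) * \<bar>x\<bar>)) / G)"
      using B(1)[OF s] C(1) G by (intro mult_right_mono) auto
    finally show ?thesis by (simp add: mult_ac)
  qed
  moreover have "B / G * C > 0" using B C G by auto
  ultimately show ?thesis by blast
qed

section \<open>Bounds for the weight\<close>

lemma integrable_polynomial_times_exp:
  fixes c :: real
  assumes "c > 0"
  shows "integrable lborel (\<lambda>x. (1 + \<bar>x\<bar>) ^ n * exp (- c * \<bar>x\<bar>))"
proof -
  \<comment> \<open>The power n + 2 leaves a spare factor (1 + |x|)^2 for the comparison with 1 / (1
    + x^2); \<open>e\<close> spreads the rate \<open>c\<close> evenly over the n + 2
    factors.\<close>
  define e where "e = c / real (n + 2)"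
  have e: "e > 0" using assms by (simp add: e_def)
  define K where "K = (1 + 1 / e) ^ (n + 2)"
  have K: "K \<ge> 0" using e by (simp add: K_def)
  have int: "integrable lborel (\<lambda>x::real. K * inverse (1 + x\<^sup>2))"
    using integrable_inverse_1_plus_square by (simp add: set_integrable_def)
  show ?thesis
  proof (rule Bochner_Integration.integrable_bound[OF int])
    show "(\<lambda>x. (1 + \<bar>x\<bar>) ^ n * exp (- c * \<bar>x\<bar>)) \<in> borel_measurable lborel" by measurable
    show "AE x in lborel. norm ((1 + \<bar>x\<bar>) ^ n * exp (- c * \<bar>x\<bar>)) \<le> norm (K * inverse (1 + x\<^sup>2))"
    proof (rule AE_I2)
      fix x :: real
      have "(1 + \<bar>x\<bar>) ^ (n + 2) \<le> ((1 + 1 / e) * exp (e * \<bar>x\<bar>)) ^ (n + 2)"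
        using e by (intro power_mono one_plus_le_exp) auto
      also have "\<dots> = K * exp (e * \<bar>x\<bar>) ^ (n + 2)" by (simp only: power_mult_distrib K_def)
      also have "exp (e * \<bar>x\<bar>) ^ (n + 2) = exp (c * \<bar>x\<bar>)"
        unfolding exp_of_nat_mult[symmetric] by (simp add: e_def)
      finally have 1: "(1 + \<bar>x\<bar>) ^ n * (1 + \<bar>x\<bar>)\<^sup>2 \<le> K * exp (c * \<bar>x\<bar>)"
        by (simp only: power_add)
      have "1 + x\<^sup>2 \<le> (1 + \<bar>x\<bar>)\<^sup>2" by (simp add: power2_sum)
      then have "(1 + \<bar>x\<bar>) ^ n * (1 + x\<^sup>2) \<le> (1 + \<bar>x\<bar>) ^ n * (1 + \<bar>x\<bar>)\<^sup>2"
        by (intro mult_left_mono) auto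
      with 1 have "(1 + \<bar>x\<bar>) ^ n * (1 + x\<^sup>2) \<le> K * exp (c * \<bar>x\<bar>)" by linarith
      moreover have "1 + x\<^sup>2 > 0" by (simp add: add_pos_nonneg)
      ultimately have "(1 + \<bar>x\<bar>) ^ n * exp (- c * \<bar>x\<bar>) \<le> K * inverse (1 + x\<^sup>2)"
        by (simp add: exp_minus field_simps)
      then show "norm ((1 + \<bar>x\<bar>) ^ n * exp (- c * \<bar>x\<bar>)) \<le> norm (K * inverse (1 + x\<^sup>2))"
        using K by (simp add: abs_mult)
    qed
  qed
qed

text \<open>The rate 5 pi/12 = pi/2 - pi/12 is chosen so that six Gamma factors decay like exp(-5 pi
  |x| / 2), which beats the growth exp(2 pi |x|) of the sinh factor with room for a polynomial. The
  imaginary part of \<open>p\<close> only translates x and costs a constant.\<close>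

lemma Gamma_box_bound:
  fixes s1 s2 T :: real
  assumes "0 < s1"
  shows "\<exists>C>0. \<forall>p x. s1 \<le> Re p \<longrightarrow> Re p \<le> s2 \<longrightarrow> \<bar>Im p\<bar> \<le> T \<longrightarrow>
           norm (Gamma (p + \<i> * of_real x)) \<le> C * exp (- (5 * pi / 12) * \<bar>x\<bar>)"
proof -
  obtain C where C: "C > 0" "\<And>s x. s1 \<le> s \<Longrightarrow> s \<le> s2 \<Longrightarrow>
      norm (Gamma (of_real s + \<i> * of_real x)) \<le> C * exp (- (pi / 2 - pi / 12) * \<bar>x\<bar>)"
    using Gamma_strip_bound[OF assms, of "pi / 12" s2] by auto
  have "norm (Gamma (p + \<i> * of_real x)) \<le> (C * exp (5 * pi / 12 * T)) * exp (- (5 * pi / 12) * \<bar>x\<bar>)"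
    if p: "s1 \<le> Re p" "Re p \<le> s2" "\<bar>Im p\<bar> \<le> T" for p x
  proof -
    have "p + \<i> * of_real x = of_real (Re p) + \<i> * of_real (Im p + x)"
      by (simp add: complex_eq_iff)
    then have "norm (Gamma (p + \<i> * of_real x)) \<le> C * exp (- (pi / 2 - pi / 12) * \<bar>Im p + x\<bar>)"
      using C(2)[OF p(1,2), of "Im p + x"] by simp
    also have "\<dots> \<le> C * exp (5 * pi / 12 * T + - (5 * pi / 12) * \<bar>x\<bar>)"
    proof -
      have "\<bar>x\<bar> \<le> \<bar>Im p + x\<bar> + T" using p(3) by linarith
      then have "(5 * pi / 12) * \<bar>x\<bar> \<le> (5 * pi / 12) * (\<bar>Im p + x\<bar> + T)"
        by (intro mult_left_mono) auto
      then show ?thesis using C(1) by (simp add: field_simps)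
    qed
    finally show ?thesis by (simp only: exp_add mult_ac)
  qed
  moreover have "C * exp (5 * pi / 12 * T) > 0" using C by simp
  ultimately show ?thesis by blast
qed

text \<open>A product instead of a squared modulus: it is holomorphic in both arguments away from
  poles, and equals |Gamma(p + ix)|^2 for real p at s = ix.\<close>

definition Gamma_pair :: "complex \<Rightarrow> complex \<Rightarrow> complex" where
  "Gamma_pair p s = Gamma (p + s) * Gamma (p - s)"

text \<open>The last factor is 1 / |Gamma(2ix)|^2 for nonzero x, written so that it is continuous at
  0. Moduli are avoided to keep holomorphy in \<open>a\<close>, \<open>b\<close>, \<open>d\<close>;
  \<open>cdh_weight_eq_norm\<close> gives the agreement with the weight of the theorem.\<close>

definition cdh_weight :: "complex \<Rightarrow> complex \<Rightarrow> complex \<Rightarrow> real \<Rightarrow> complex" where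
  "cdh_weight a b d x = Gamma_pair a (\<i> * of_real x) * Gamma_pair b (\<i> * of_real x) *
     Gamma_pair d (\<i> * of_real x) * of_real (2 * x * sinh (2 * pi * x) / pi)"

text \<open>The displacement \<open>z\<close> is present because the contour shift evaluates pairs
  off the imaginary axis.\<close>

lemma Gamma_pair_bound:
  fixes s1 s2 T :: real
  assumes "0 < s1"
  shows "\<exists>C>0. \<forall>p z x. s1 \<le> Re p - \<bar>Re z\<bar> \<longrightarrow> Re p + \<bar>Re z\<bar> \<le> s2 \<longrightarrow> \<bar>Im p\<bar> + \<bar>Im z\<bar> \<le> T \<longrightarrow>
           norm (Gamma_pair p (z + \<i> * of_real x)) \<le> C * exp (- (5 * pi / 6) * \<bar>x\<bar>)"
proof -
  obtain C where C: "C > 0" "\<And>p x. s1 \<le> Re p \<Longrightarrow> Re p \<le> s2 \<Longrightarrow> \<bar>Im p\<bar> \<le> T \<Longrightarrow>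
           norm (Gamma (p + \<i> * of_real x)) \<le> C * exp (- (5 * pi / 12) * \<bar>x\<bar>)"
    using Gamma_box_bound[OF assms, of s2 T] by blast
  have "norm (Gamma_pair p (z + \<i> * of_real x)) \<le> (C * C) * exp (- (5 * pi / 6) * \<bar>x\<bar>)"
    if p: "s1 \<le> Re p - \<bar>Re z\<bar>" "Re p + \<bar>Re z\<bar> \<le> s2" "\<bar>Im p\<bar> + \<bar>Im z\<bar> \<le> T" for p z x
  proof -
    have "norm (Gamma_pair p (z + \<i> * of_real x)) =
        norm (Gamma ((p + z) + \<i> * of_real x)) * norm (Gamma ((p - z) + \<i> * of_real (- x)))"
      by (simp add: Gamma_pair_def norm_mult algebra_simps)
    also have "\<dots> \<le> (C * exp (- (5 * pi / 12) * \<bar>x\<bar>)) * (C * exp (- (5 * pi / 12) * \<bar>- x\<bar>))"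
      using p C(1) by (intro mult_mono C(2)) auto
    also have "\<dots> = (C * C) * exp (- (5 * pi / 12) * \<bar>x\<bar> + - (5 * pi / 12) * \<bar>x\<bar>)"
      by (simp only: exp_add mult_ac abs_minus_cancel)
    also have "- (5 * pi / 12) * \<bar>x\<bar> + - (5 * pi / 12) * \<bar>x\<bar> = - (5 * pi / 6) * \<bar>x\<bar>"
      by (simp add: field_simps)
    finally show ?thesis .
  qed
  moreover have "C * C > 0" using C by simp
  ultimately show ?thesis by blast
qed

lemma cdh_weight_bound:
  fixes s1 s2 T :: real
  assumes "0 < s1"
  shows "\<exists>C>0. \<forall>a b d x. s1 \<le> Re a \<longrightarrow> Re a \<le> s2 \<longrightarrow> \<bar>Im a\<bar> \<le> T \<longrightarrow>
            s1 \<le> Re b \<longrightarrow> Re b \<le> s2 \<longrightarrow> \<bar>Im b\<bar> \<le> T \<longrightarrow> s1 \<le> Re d \<longrightarrow> Re d \<le> s2 \<longrightarrow> \<bar>Im d\<bar> \<le> T \<longrightarrow>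
           norm (cdh_weight a b d x) \<le> C * exp (- (pi / 4) * \<bar>x\<bar>)"
proof -
  obtain C where C: "C > 0" "\<And>p x. s1 \<le> Re p \<Longrightarrow> Re p \<le> s2 \<Longrightarrow> \<bar>Im p\<bar> \<le> T \<Longrightarrow>
           norm (Gamma_pair p (\<i> * of_real x)) \<le> C * exp (- (5 * pi / 6) * \<bar>x\<bar>)"
  proof -
    obtain C where "C > 0" "\<forall>p z x. s1 \<le> Re p - \<bar>Re z\<bar> \<longrightarrow> Re p + \<bar>Re z\<bar> \<le> s2 \<longrightarrow> \<bar>Im p\<bar> + \<bar>Im z\<bar> \<le> T \<longrightarrow>
           norm (Gamma_pair p (z + \<i> * of_real x)) \<le> C * exp (- (5 * pi / 6) * \<bar>x\<bar>)"
      using Gamma_pair_bound[OF assms, of s2 T] by blast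
    then show ?thesis using that[of C] by (metis abs_zero add.left_neutral add.right_neutral diff_zero zero_complex.sel)
  qed
  \<comment> \<open>From \<open>one_plus_le_exp\<close> with rate pi/4. The total rate is then 2 pi
    + pi/4 - 3 (5 pi/6) = - pi/4.\<close>
  define K where "K = 2 * (1 + 1 / (pi / 4))"
  have K: "K > 0" unfolding K_def by (simp add: add_pos_pos)
  have "norm (cdh_weight a b d x) \<le> (C * C * C * K) * exp (- (pi / 4) * \<bar>x\<bar>)"
    if "s1 \<le> Re a" "Re a \<le> s2" "\<bar>Im a\<bar> \<le> T" "s1 \<le> Re b" "Re b \<le> s2" "\<bar>Im b\<bar> \<le> T"
      "s1 \<le> Re d" "Re d \<le> s2" "\<bar>Im d\<bar> \<le> T" for a b d x
  proof -
    have "\<bar>2 * x * sinh (2 * pi * x) / pi\<bar> \<le> K * exp (pi / 4 * \<bar>x\<bar>) * exp (2 * pi * \<bar>x\<bar>)"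
    proof -
      have s: "\<bar>sinh (2 * pi * x)\<bar> \<le> exp (2 * pi * \<bar>x\<bar>)"
      proof -
        have "exp (2 * pi * x) \<le> exp (2 * pi * \<bar>x\<bar>)" "exp (- (2 * pi * x)) \<le> exp (2 * pi * \<bar>x\<bar>)"
          using mult_left_mono[of x "\<bar>x\<bar>" "2 * pi"] mult_left_mono[of "- x" "\<bar>x\<bar>" "2 * pi"] by auto
        moreover have "\<bar>(A - B) / 2\<bar> \<le> E" if "A \<le> E" "B \<le> E" "0 < A" "0 < B" for A B E :: real
          using that by (auto simp: abs_if field_simps)
        ultimately show ?thesis
          by (simp add: sinh_field_def)
      qed
      have "2 * \<bar>x\<bar> / pi \<le> 2 * (1 + \<bar>x\<bar>)"
      proof -
        have "2 * \<bar>x\<bar> / pi \<le> 2 * \<bar>x\<bar> / 1" using pi_gt3 by (intro divide_left_mono) auto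
        then show ?thesis by simp
      qed
      also have "\<dots> \<le> 2 * ((1 + 1 / (pi / 4)) * exp (pi / 4 * \<bar>x\<bar>))"
        by (intro mult_left_mono one_plus_le_exp) auto
      finally have "2 * \<bar>x\<bar> / pi \<le> K * exp (pi / 4 * \<bar>x\<bar>)" by (simp only: K_def mult.assoc)
      then have "2 * \<bar>x\<bar> / pi * \<bar>sinh (2 * pi * x)\<bar> \<le> K * exp (pi / 4 * \<bar>x\<bar>) * exp (2 * pi * \<bar>x\<bar>)"
        using s K by (intro mult_mono) auto
      then show ?thesis by (simp add: abs_mult)
    qed
    then have "norm (cdh_weight a b d x) \<le>
      (C * exp (- (5 * pi / 6) * \<bar>x\<bar>)) * (C * exp (- (5 * pi / 6) * \<bar>x\<bar>)) * (C * exp (- (5 * pi / 6) * \<bar>x\<bar>))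
        * (K * exp (pi / 4 * \<bar>x\<bar>) * exp (2 * pi * \<bar>x\<bar>))"
      unfolding cdh_weight_def norm_mult norm_of_real using that C(1)
      by (intro mult_mono C(2)) auto
    also have "\<dots> = (C * C * C * K) * exp (- (5 * pi / 6) * \<bar>x\<bar> + - (5 * pi / 6) * \<bar>x\<bar> + - (5 * pi / 6) * \<bar>x\<bar>
        + pi / 4 * \<bar>x\<bar> + 2 * pi * \<bar>x\<bar>)"
      by (simp only: exp_add mult_ac)
    also have "- (5 * pi / 6) * \<bar>x\<bar> + - (5 * pi / 6) * \<bar>x\<bar> + - (5 * pi / 6) * \<bar>x\<bar>
        + pi / 4 * \<bar>x\<bar> + 2 * pi * \<bar>x\<bar> = - (pi / 4) * \<bar>x\<bar>"
      by (simp add: field_simps)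
    finally show ?thesis .
  qed
  moreover have "C * C * C * K > 0" using C K by simp
  ultimately show ?thesis by blast
qed

lemma cdh_weight_bound_single:
  assumes "Re a > 0" "Re b > 0" "Re d > 0"
  obtains C where "C > 0" "\<And>x. norm (cdh_weight a b d x) \<le> C * exp (- (pi / 4) * \<bar>x\<bar>)"
proof -
  define s1 where "s1 = min (Re a) (min (Re b) (Re d))"
  define s2 where "s2 = max (Re a) (max (Re b) (Re d))"
  define T where "T = max \<bar>Im a\<bar> (max \<bar>Im b\<bar> \<bar>Im d\<bar>)"
  have "s1 > 0" using assms by (auto simp: s1_def)
  from cdh_weight_bound[OF this, of s2 T] obtain C where C: "C > 0" "\<And>a b d x. s1 \<le> Re a \<Longrightarrow> Re a \<le> s2 \<Longrightarrow> \<bar>Im a\<bar> \<le> T \<Longrightarrow>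
            s1 \<le> Re b \<Longrightarrow> Re b \<le> s2 \<Longrightarrow> \<bar>Im b\<bar> \<le> T \<Longrightarrow> s1 \<le> Re d \<Longrightarrow> Re d \<le> s2 \<Longrightarrow> \<bar>Im d\<bar> \<le> T \<Longrightarrow>
           norm (cdh_weight a b d x) \<le> C * exp (- (pi / 4) * \<bar>x\<bar>)"
    by blast
  show thesis
    by (rule that[OF C(1)], rule C(2)) (simp_all add: s1_def s2_def T_def)
qed

lemma continuous_on_Gamma_pair:
  assumes "Re p > 0"
  shows "continuous_on A (\<lambda>x. Gamma_pair p (\<i> * of_real x))"
proof -
  have *: "continuous_on {z. Re z > 0} (Gamma :: complex \<Rightarrow> complex)"
    by (intro continuous_on_Gamma) (auto dest: pos_Re_notin_nonpos_Ints)
  show ?thesis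
    unfolding Gamma_pair_def using assms
    by (intro continuous_on_mult continuous_on_compose2[OF *] continuous_intros) auto
qed

lemma continuous_on_cdh_weight:
  assumes "Re a > 0" "Re b > 0" "Re d > 0"
  shows "continuous_on A (cdh_weight a b d)"
  unfolding cdh_weight_def
  by (intro continuous_on_mult continuous_on_Gamma_pair continuous_intros assms) auto

lemma borel_measurable_cdh_weight [measurable]:
  assumes "Re a > 0" "Re b > 0" "Re d > 0"
  shows "cdh_weight a b d \<in> borel_measurable borel"
  by (intro borel_measurable_continuous_onI continuous_on_cdh_weight assms)

lemma integrable_polynomial_times_cdh_weight:
  assumes "Re a > 0" "Re b > 0" "Re d > 0"
    and p: "p \<in> borel_measurable borel" "\<And>x. norm (p x) \<le> B * (1 + \<bar>x\<bar>) ^ n"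
  shows "integrable lborel (\<lambda>x. p x * cdh_weight a b d x)"
proof -
  obtain C where C: "C > 0" "\<And>x. norm (cdh_weight a b d x) \<le> C * exp (- (pi / 4) * \<bar>x\<bar>)"
    using cdh_weight_bound_single[OF assms(1-3)] by blast
  have "integrable lborel (\<lambda>x::real. (B * C) * ((1 + \<bar>x\<bar>) ^ n * exp (- (pi / 4) * \<bar>x\<bar>)))"
    by (intro integrable_mult_right integrable_polynomial_times_exp) auto
  then show ?thesis
  proof (rule Bochner_Integration.integrable_bound)
    note [measurable] = p(1) borel_measurable_cdh_weight[OF assms(1-3)]
    show "(\<lambda>x. p x * cdh_weight a b d x) \<in> borel_measurable lborel" by measurable
    have "norm (p x * cdh_weight a b d x) \<le> norm (B * C * ((1 + \<bar>x\<bar>) ^ n * exp (- (pi / 4) * \<bar>x\<bar>)))" for x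
    proof -
      have "norm (p x * cdh_weight a b d x) \<le> (B * (1 + \<bar>x\<bar>) ^ n) * (C * exp (- (pi / 4) * \<bar>x\<bar>))"
        unfolding norm_mult using order_trans[OF norm_ge_zero p(2)[of x]]
        by (rule mult_mono[OF p(2) C(2) _ norm_ge_zero])
      also have "\<dots> = B * C * ((1 + \<bar>x\<bar>) ^ n * exp (- (pi / 4) * \<bar>x\<bar>))" by simp
      finally show ?thesis by (simp only: real_norm_def order.trans[OF _ abs_ge_self])
    qed
    then show "AE x in lborel. norm (p x * cdh_weight a b d x) \<le> norm (B * C * ((1 + \<bar>x\<bar>) ^ n * exp (- (pi / 4) * \<bar>x\<bar>)))"
      by (intro AE_I2)
  qed
qed

lemma integrable_cdh_weight:
  assumes "Re a > 0" "Re b > 0" "Re d > 0"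
  shows "integrable lborel (cdh_weight a b d)"
  using integrable_polynomial_times_cdh_weight[OF assms, of "\<lambda>_. 1" 1 0] by simp

lemma Gamma_pair_plus1:
  assumes "Re a > 0"
  shows "Gamma_pair (a + 1) (\<i> * of_real x) = (a\<^sup>2 + (of_real x)\<^sup>2) * Gamma_pair a (\<i> * of_real x)"
proof -
  have "Gamma ((a + \<i> * of_real x) + 1) = (a + \<i> * of_real x) * Gamma (a + \<i> * of_real x)"
       "Gamma ((a - \<i> * of_real x) + 1) = (a - \<i> * of_real x) * Gamma (a - \<i> * of_real x)"
    using assms by (auto intro!: Gamma_plus1 pos_Re_notin_nonpos_Ints)
  moreover have "(a + \<i> * of_real x) * (a - \<i> * of_real x) = a\<^sup>2 + (of_real x)\<^sup>2"
    by (simp add: algebra_simps power2_eq_square)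
  moreover have "a + 1 + \<i> * of_real x = (a + \<i> * of_real x) + 1" "a + 1 - \<i> * of_real x = (a - \<i> * of_real x) + 1"
    by simp_all
  ultimately show ?thesis unfolding Gamma_pair_def by (metis mult.assoc mult.left_commute)
qed

lemma cdh_weight_plus1:
  assumes "Re a > 0"
  shows "cdh_weight (a + 1) b d x = (a\<^sup>2 + (of_real x)\<^sup>2) * cdh_weight a b d x"
  using Gamma_pair_plus1[OF assms] by (simp add: cdh_weight_def)

section \<open>A contour shift for the weight\<close>

lemma holomorphic_on_Gamma_pair:
  assumes "f holomorphic_on A" "g holomorphic_on A" "\<And>z. z \<in> A \<Longrightarrow> \<bar>Re (g z)\<bar> < Re (f z)"
  shows "(\<lambda>z. Gamma_pair (f z) (g z)) holomorphic_on A"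
proof -
  have "f z + g z \<notin> \<int>\<^sub>\<le>\<^sub>0" "f z - g z \<notin> \<int>\<^sub>\<le>\<^sub>0" if "z \<in> A" for z
    using assms(3)[OF that] by (auto intro!: pos_Re_notin_nonpos_Ints)
  then show ?thesis
    unfolding Gamma_pair_def using assms(1,2)
    by (intro holomorphic_intros) auto
qed

lemma sin_i_times_of_real: "sin (\<i> * of_real y) = \<i> * complex_of_real (sinh y)"
proof -
  have "sin (\<i> * of_real y) = \<i> * sinh (complex_of_real y)"
    by (simp add: sinh_conv_sin)
  also have "sinh (complex_of_real y) = of_real (sinh y)"
    by (simp add: sinh_field_def exp_minus flip: exp_of_real)
  finally show ?thesis .
qed

lemma norm_sin_le_exp: "norm (sin z) \<le> exp \<bar>Im z\<bar>"
proof -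
  have "norm (sin z) = norm (exp (\<i> * z) - exp (- (\<i> * z))) / 2"
    by (simp add: sin_exp_eq norm_divide norm_mult)
  also have "\<dots> \<le> (norm (exp (\<i> * z)) + norm (exp (- (\<i> * z)))) / 2"
    by (intro divide_right_mono norm_triangle_ineq4) auto
  also have "\<dots> = (exp (- Im z) + exp (Im z)) / 2" by simp
  also have "\<dots> \<le> (exp \<bar>Im z\<bar> + exp \<bar>Im z\<bar>) / 2"
    by (intro divide_right_mono add_mono) auto
  finally show ?thesis by simp
qed

text \<open>
  Shifting the line of integration of the function \<open>h\<close> below from real part \<open>- 1/2\<close> to \<open>1/2\<close>
  leaves the integral unchanged, and \<open>h (s + 1/2) - h (s - 1/2)\<close> is the weight at \<open>s = \<i> x\<close>
  times a quadratic polynomial.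
\<close>

lemma cdh_weight_second_moment:
  assumes a: "Re a > 0" and b: "Re b > 0" and d: "Re d > 0"
  shows "(LINT x|lborel. (a * b + a * d + b * d - (of_real x)\<^sup>2) * cdh_weight a b d x) = 0"
proof -
  \<comment> \<open>Raising the parameters by 1/2 makes a shift of s by 1/2 or -1/2 increase one
    Gamma argument of each pair by a full unit over \<open>Gamma_pair p s\<close>, which yields the
    linear factor p + s or p - s. The sine changes sign under both shifts.\<close>
  define h where "h = (\<lambda>s. sin (2 * of_real pi * s) * Gamma_pair (a + 1/2) s * Gamma_pair (b + 1/2) s * Gamma_pair (d + 1/2) s)"
  \<comment> \<open>Half the smallest real part: on the strip \<open>S\<close> all Gamma arguments
    in \<open>h\<close> keep real part above \<delta>.\<close>
  define \<delta> where "\<delta> = min (Re a) (min (Re b) (Re d)) / 2"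
  have \<delta>: "\<delta> > 0" "2 * \<delta> \<le> Re a" "2 * \<delta> \<le> Re b" "2 * \<delta> \<le> Re d"
    using a b d by (auto simp: \<delta>_def)
  define S where "S = {z. Re z < 1/2 + \<delta>} \<inter> {z. Re z > - (1/2 + \<delta>)}"
  have S: "open S" "connected S"
    unfolding S_def
    by (intro open_Int open_halfspace_Re_lt open_halfspace_Re_gt)
       (intro convex_connected convex_Int convex_halfspace_Re_lt convex_halfspace_Re_gt)
  have S': "\<bar>Re z\<bar> < 1/2 + \<delta>" if "z \<in> S" for z
    using that by (auto simp: S_def)
  have hol: "(\<lambda>z. h (z + \<i> * of_real x)) holomorphic_on S" for x
    unfolding h_def using \<delta> S'
    by (intro holomorphic_intros holomorphic_on_Gamma_pair) (auto simp: field_simps; smt (verit))+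
  have hbound: "\<exists>C. \<forall>z\<in>S. \<bar>Im z\<bar> \<le> T \<longrightarrow> (\<forall>x. norm (h (z + \<i> * of_real x)) \<le> C * exp (- (pi / 2) * \<bar>x\<bar>))" for T
  proof -
    define s2 where "s2 = max (Re a) (max (Re b) (Re d)) + 1 + \<delta>"
    define T' where "T' = max \<bar>Im a\<bar> (max \<bar>Im b\<bar> \<bar>Im d\<bar>) + T"
    obtain C where C: "C > 0" "\<And>p z x. \<delta> \<le> Re p - \<bar>Re z\<bar> \<Longrightarrow> Re p + \<bar>Re z\<bar> \<le> s2 \<Longrightarrow> \<bar>Im p\<bar> + \<bar>Im z\<bar> \<le> T' \<Longrightarrow>
           norm (Gamma_pair p (z + \<i> * of_real x)) \<le> C * exp (- (5 * pi / 6) * \<bar>x\<bar>)"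
      using Gamma_pair_bound[OF \<delta>(1), of s2 T'] by blast
    have "norm (h (z + \<i> * of_real x)) \<le> (exp (2 * pi * T) * C * C * C) * exp (- (pi / 2) * \<bar>x\<bar>)"
      if z: "z \<in> S" "\<bar>Im z\<bar> \<le> T" for z x
    proof -
      have "norm (sin (2 * of_real pi * (z + \<i> * of_real x))) \<le> exp (2 * pi * T + 2 * pi * \<bar>x\<bar>)"
      proof -
        have "\<bar>Im (2 * of_real pi * (z + \<i> * of_real x))\<bar> = 2 * pi * \<bar>Im z + x\<bar>"
          by (simp add: abs_mult)
        also have "\<dots> \<le> 2 * pi * (T + \<bar>x\<bar>)"
          using z by (intro mult_left_mono) auto
        finally show ?thesis
          using norm_sin_le_exp[of "2 * of_real pi * (z + \<i> * of_real x)"]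
          by (elim order_trans) (simp add: algebra_simps)
      qed
      moreover have "norm (Gamma_pair (p + 1/2) (z + \<i> * of_real x)) \<le> C * exp (- (5 * pi / 6) * \<bar>x\<bar>)"
        if "p \<in> {a, b, d}" for p
        using that z S'[OF z(1)] \<delta> by (intro C(2)) (auto simp: s2_def T'_def)
      ultimately have "norm (h (z + \<i> * of_real x)) \<le> exp (2 * pi * T + 2 * pi * \<bar>x\<bar>)
          * (C * exp (- (5 * pi / 6) * \<bar>x\<bar>)) * (C * exp (- (5 * pi / 6) * \<bar>x\<bar>)) * (C * exp (- (5 * pi / 6) * \<bar>x\<bar>))"
        unfolding h_def norm_mult using C(1) by (intro mult_mono mult_nonneg_nonneg) auto
      also have "\<dots> = (exp (2 * pi * T) * C * C * C) *
          exp (2 * pi * \<bar>x\<bar> + - (5 * pi / 6) * \<bar>x\<bar> + - (5 * pi / 6) * \<bar>x\<bar> + - (5 * pi / 6) * \<bar>x\<bar>)"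
        by (simp only: exp_add mult_ac)
      also have "2 * pi * \<bar>x\<bar> + - (5 * pi / 6) * \<bar>x\<bar> + - (5 * pi / 6) * \<bar>x\<bar> + - (5 * pi / 6) * \<bar>x\<bar> = - (pi / 2) * \<bar>x\<bar>"
        by (simp add: field_simps)
      finally show ?thesis .
    qed
    then show ?thesis by blast
  qed
  have hcont: "continuous_on UNIV (\<lambda>x. h (z + \<i> * of_real x))" if "z \<in> S" for z
  proof -
    have "h holomorphic_on S"
      using hol[of 0] by simp
    then have "continuous_on S h" by (rule holomorphic_on_imp_continuous_on)
    then show ?thesis
      by (rule continuous_on_compose2) (use that in \<open>auto intro!: continuous_intros simp: S_def\<close>)
  qed
  have hmeas: "(\<lambda>x. h (z + \<i> * of_real x)) \<in> borel_measurable lborel" if "z \<in> S" for z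
    using hcont[OF that] by (simp add: borel_measurable_continuous_onI)
  have expint: "integrable lborel (\<lambda>x::real. C * exp (- (pi / 2) * \<bar>x\<bar>))" for C
    using integrable_polynomial_times_exp[of "pi / 2" 0] by (intro integrable_mult_right) simp
  have hint: "integrable lborel (\<lambda>x. h (z + \<i> * of_real x))" if z: "z \<in> S" for z
  proof -
    obtain C where C: "\<And>x. norm (h (z + \<i> * of_real x)) \<le> C * exp (- (pi / 2) * \<bar>x\<bar>)"
      using hbound[of "\<bar>Im z\<bar>"] z by auto
    show ?thesis
      by (rule Bochner_Integration.integrable_bound[OF expint[of C] hmeas[OF z]])
         (intro AE_I2 order_trans[OF C], simp)
  qed
  define H where "H = (\<lambda>z. LINT x|lborel. h (z + \<i> * of_real x))"
  have "H holomorphic_on S"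
    unfolding H_def
  proof (rule holomorphic_on_lebesgue_integral)
    fix z assume z: "z \<in> S"
    obtain C where C: "\<And>w x. w \<in> S \<Longrightarrow> \<bar>Im w\<bar> \<le> \<bar>Im z\<bar> + 1 \<Longrightarrow> norm (h (w + \<i> * of_real x)) \<le> C * exp (- (pi / 2) * \<bar>x\<bar>)"
      using hbound[of "\<bar>Im z\<bar> + 1"] by auto
    have Im: "\<bar>Im w\<bar> \<le> \<bar>Im z\<bar> + 1" if "w \<in> ball z 1" for w
    proof -
      have "\<bar>Im (z - w)\<bar> < 1" using that abs_Im_le_cmod[of "z - w"] by (simp add: dist_norm)
      then show ?thesis by simp
    qed
    show "\<exists>r>0. \<exists>g. integrable lborel g \<and>
        (\<forall>w\<in>ball z r \<inter> S. \<forall>x\<in>space lborel. norm (h (w + \<i> * of_real x)) \<le> g x)"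
      by (rule exI[of _ 1], simp, rule exI[of _ "\<lambda>x. C * exp (- (pi / 2) * \<bar>x\<bar>)"])
         (use expint[of C] C Im in auto)
  qed (use S hol hmeas in auto)
  moreover have vert: "H (\<i> * of_real y) = H 0" for y
  proof -
    have "H 0 = (LINT x|lborel. h (0 + \<i> * of_real (y + 1 * x)))"
      unfolding H_def by (subst lborel_integral_real_affine[of 1 _ y]) auto
    also have "\<dots> = H (\<i> * of_real y)"
      by (simp add: H_def algebra_simps)
    finally show ?thesis by simp
  qed
  ultimately have const: "H z = H 0" if "z \<in> S" for z
  proof -
    have "H z - H 0 = 0"
    proof (rule analytic_continuation[of "\<lambda>z. H z - H 0" S "range (\<lambda>y. \<i> * of_real y)" 0])
      show "(\<lambda>z. H z - H 0) holomorphic_on S"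
        using \<open>H holomorphic_on S\<close> by (intro holomorphic_intros)
      show "0 islimpt range (\<lambda>y. \<i> * complex_of_real y)"
        unfolding islimpt_approachable
      proof (intro allI impI)
        fix e :: real assume "e > 0"
        then show "\<exists>x'\<in>range (\<lambda>y. \<i> * complex_of_real y). x' \<noteq> 0 \<and> dist x' 0 < e"
          by (intro bexI[of _ "\<i> * of_real (e / 2)"] rangeI) (auto simp: norm_mult norm_divide)
      qed
    qed (use that S \<delta> vert in \<open>auto simp: S_def\<close>)
    then show ?thesis by simp
  qed
  have half: "1/2 \<in> S" "-1/2 \<in> S" using \<delta> by (auto simp: S_def)
  have diff: "h (1/2 + \<i> * of_real x) - h (-1/2 + \<i> * of_real x) =
      of_real pi * ((a * b + a * d + b * d - (of_real x)\<^sup>2) * cdh_weight a b d x)" for x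
  proof -
    define s where "s = \<i> * complex_of_real x"
    have plus: "Gamma_pair (p + 1/2) (1/2 + s) = (p + s) * Gamma_pair p s" if "p \<in> {a, b, d}" for p
    proof -
      have "Gamma ((p + s) + 1) = (p + s) * Gamma (p + s)"
        using that a b d by (intro Gamma_plus1 pos_Re_notin_nonpos_Ints) (auto simp: s_def)
      moreover have "p + 1/2 + (1/2 + s) = (p + s) + 1" "p + 1/2 - (1/2 + s) = p - s" by simp_all
      ultimately show ?thesis unfolding Gamma_pair_def by (simp only: mult_ac)
    qed
    have minus: "Gamma_pair (p + 1/2) (-1/2 + s) = (p - s) * Gamma_pair p s" if "p \<in> {a, b, d}" for p
    proof -
      have "Gamma ((p - s) + 1) = (p - s) * Gamma (p - s)"
        using that a b d by (intro Gamma_plus1 pos_Re_notin_nonpos_Ints) (auto simp: s_def)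
      moreover have "p + 1/2 - (-1/2 + s) = (p - s) + 1" "p + 1/2 + (-1/2 + s) = p + s" by simp_all
      ultimately show ?thesis unfolding Gamma_pair_def by (simp only: mult_ac)
    qed
    have sn: "sin (2 * of_real pi * (1/2 + s)) = - sin (2 * of_real pi * s)"
             "sin (2 * of_real pi * (-1/2 + s)) = - sin (2 * of_real pi * s)"
      by (simp_all add: ring_distribs sin_add sin_diff flip: sin_of_real cos_of_real)
    have sh: "sin (2 * of_real pi * s) = \<i> * of_real (sinh (2 * pi * x))"
      using sin_i_times_of_real[of "2 * pi * x"] by (simp add: s_def mult_ac)
    define P where "P = Gamma_pair a s * Gamma_pair b s * Gamma_pair d s"
    have "h (1/2 + s) - h (-1/2 + s) = - sin (2 * of_real pi * s) * P *
       ((a + s) * (b + s) * (d + s) - (a - s) * (b - s) * (d - s))"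
    proof -
      have h1: "h (1/2 + s) = - sin (2 * of_real pi * s) * ((a + s) * Gamma_pair a s) * ((b + s) * Gamma_pair b s) * ((d + s) * Gamma_pair d s)"
        unfolding h_def sn by (subst plus, simp)+ simp
      have h2: "h (-1/2 + s) = - sin (2 * of_real pi * s) * ((a - s) * Gamma_pair a s) * ((b - s) * Gamma_pair b s) * ((d - s) * Gamma_pair d s)"
        unfolding h_def sn by (subst minus, simp)+ simp
      show ?thesis unfolding h1 h2 P_def by (simp add: algebra_simps)
    qed
    \<comment> \<open>Only the odd part of the cubic survives; its factor s combines with the sine
      into x sinh(2 pi x).\<close>
    also have "(a + s) * (b + s) * (d + s) - (a - s) * (b - s) * (d - s) = 2 * s * (a * b + a * d + b * d + s\<^sup>2)"
      by (simp add: algebra_simps power2_eq_square)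
    also have "s\<^sup>2 = - (of_real x)\<^sup>2" by (simp add: s_def power_mult_distrib)
    also have "- sin (2 * of_real pi * s) * P * (2 * s * (a * b + a * d + b * d + - (of_real x)\<^sup>2)) =
       of_real pi * ((a * b + a * d + b * d - (of_real x)\<^sup>2) * (P * of_real (2 * x * sinh (2 * pi * x) / pi)))"
      unfolding sh by (simp add: s_def field_simps)
    finally show ?thesis by (simp add: P_def s_def cdh_weight_def)
  qed
  have "0 = H (1/2) - H (-1/2)" using const half by simp
  also have "\<dots> = (LINT x|lborel. h (1/2 + \<i> * of_real x) - h (-1/2 + \<i> * of_real x))"
    unfolding H_def by (rule Bochner_Integration.integral_diff[symmetric]) (intro hint half)+
  also have "\<dots> = of_real pi * (LINT x|lborel. (a * b + a * d + b * d - (of_real x)\<^sup>2) * cdh_weight a b d x)"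
    unfolding diff by simp
  finally show ?thesis by simp
qed

definition cdh_mass :: "complex \<Rightarrow> complex \<Rightarrow> complex \<Rightarrow> complex" where
  "cdh_mass a b d = (LINT x|lborel. cdh_weight a b d x)"

lemma cdh_mass_commute: "cdh_mass a b d = cdh_mass b a d" "cdh_mass a b d = cdh_mass a d b"
  unfolding cdh_mass_def by (simp_all add: cdh_weight_def[abs_def] mult_ac)

text \<open>(a + b)(a + d) - (a^2 + x^2) = a b + a d + b d - x^2, so the vanishing moment is exactly
  this recurrence.\<close>

lemma cdh_mass_plus1:
  assumes a: "Re a > 0" and b: "Re b > 0" and d: "Re d > 0"
  shows "cdh_mass (a + 1) b d = (a + b) * (a + d) * cdh_mass a b d"
proof -
  have i: "integrable lborel (cdh_weight a b d)" "integrable lborel (cdh_weight (a + 1) b d)"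
    using assms by (intro integrable_cdh_weight; simp)+
  have eq: "(a * b + a * d + b * d - (of_real x)\<^sup>2) * cdh_weight a b d x =
        (a + b) * (a + d) * cdh_weight a b d x - cdh_weight (a + 1) b d x" for x
    using cdh_weight_plus1[OF a] by (simp add: algebra_simps power2_eq_square)
  have "0 = (a + b) * (a + d) * cdh_mass a b d - cdh_mass (a + 1) b d"
    using cdh_weight_second_moment[OF assms] i unfolding eq cdh_mass_def by simp
  then show ?thesis by simp
qed

section \<open>The total mass of the weight\<close>

text \<open>A real-valued copy for positive parameters, so that integrals can be compared by
  order.\<close>

definition cdh_real_weight :: "real \<Rightarrow> real \<Rightarrow> real \<Rightarrow> real \<Rightarrow> real" where
  "cdh_real_weight a b d x = (norm (Gamma (of_real a + \<i> * of_real x)))\<^sup>2 * (norm (Gamma (of_real b + \<i> * of_real x)))\<^sup>2 *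
     (norm (Gamma (of_real d + \<i> * of_real x)))\<^sup>2 * (2 * x * sinh (2 * pi * x) / pi)"

lemma x_sinh_nonneg: "0 \<le> 2 * x * sinh (2 * pi * x) / (pi::real)"
  by (cases "x \<ge> 0") (auto simp: zero_le_mult_iff mult_le_0_iff)

lemma cdh_real_weight_nonneg: "cdh_real_weight a b d x \<ge> 0"
  unfolding cdh_real_weight_def by (intro mult_nonneg_nonneg x_sinh_nonneg) auto

lemma Gamma_pair_of_real:
  "Gamma_pair (of_real a) (\<i> * of_real x) = of_real ((norm (Gamma (of_real a + \<i> * of_real x)))\<^sup>2)"
  by (simp add: Gamma_pair_def cnj_Gamma complex_norm_square del: of_real_power)

lemma cdh_weight_of_real:
  "cdh_weight (of_real a) (of_real b) (of_real d) x = of_real (cdh_real_weight a b d x)"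
  by (simp add: cdh_weight_def Gamma_pair_of_real cdh_real_weight_def)

lemma integrable_cdh_real_weight:
  assumes "a > 0" "b > 0" "d > 0"
  shows "integrable lborel (cdh_real_weight a b d)"
  using integrable_cdh_weight[of "of_real a" "of_real b" "of_real d"] assms
  by (simp add: cdh_weight_of_real[abs_def] complex_of_real_integrable_eq)

lemma cdh_mass_of_real:
  "cdh_mass (of_real a) (of_real b) (of_real d) = of_real (LINT x|lborel. cdh_real_weight a b d x)"
  unfolding cdh_mass_def cdh_weight_of_real by (rule integral_complex_of_real)

definition cdh_ratio :: "real \<Rightarrow> real \<Rightarrow> real \<Rightarrow> real" where
  "cdh_ratio a b d = (LINT x|lborel. cdh_real_weight a b d x) / (Gamma (a + b) * Gamma (a + d) * Gamma (b + d))"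

lemma cdh_ratio_commute: "cdh_ratio a b d = cdh_ratio b a d" "cdh_ratio a b d = cdh_ratio a d b"
  unfolding cdh_ratio_def by (simp_all add: cdh_real_weight_def[abs_def] mult_ac add_ac)

lemma cdh_ratio_plus_nat:
  assumes "a > 0" "b > 0" "d > 0"
  shows "cdh_ratio (a + real n) b d = cdh_ratio a b d"
proof (induction n)
  case (Suc n)
  define a' where "a' = a + real n"
  have a': "a' > 0" using assms by (simp add: a'_def add_pos_nonneg)
  have "complex_of_real (LINT x|lborel. cdh_real_weight (a' + 1) b d x)
      = of_real ((a' + b) * (a' + d) * (LINT x|lborel. cdh_real_weight a' b d x))"
    using cdh_mass_plus1[of "of_real a'" "of_real b" "of_real d"] assms a'
    by (simp flip: cdh_mass_of_real)
  then have I: "(LINT x|lborel. cdh_real_weight (a' + 1) b d x)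
      = (a' + b) * (a' + d) * (LINT x|lborel. cdh_real_weight a' b d x)"
    by (simp only: of_real_eq_iff)
  have G: "Gamma ((a' + c) + 1) = (a' + c) * Gamma (a' + c)" if "c > 0" for c
    using that a' by (intro Gamma_plus1) (auto dest: nonpos_Ints_nonpos)
  have "cdh_ratio (a' + 1) b d = cdh_ratio a' b d"
    unfolding cdh_ratio_def I using G[of b] G[of d] assms a' by (simp add: add_ac)
  then show ?case using Suc.IH by (simp add: a'_def add_ac)
qed auto

text \<open>The limit formula \<open>Gamma_series'\<close> for Gamma, solved for Gamma(z + n), with
  n^z written as exp(z ln n).\<close>

lemma Gamma_plus_nat_asymp:
  fixes z :: real
  assumes "z > 0"
  shows "(\<lambda>n. Gamma (z + real n) / (fact (n - 1) * exp (z * ln (real n)))) \<longlonglongrightarrow> 1"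
proof -
  have z: "z \<notin> \<int>\<^sub>\<le>\<^sub>0" using assms by (auto dest: nonpos_Ints_nonpos)
  have "(\<lambda>n. Gamma z / Gamma_series' z n) \<longlonglongrightarrow> Gamma z / Gamma z"
    using z by (intro tendsto_intros Gamma_series'_LIMSEQ) (auto simp: Gamma_eq_zero_iff)
  moreover have "Gamma z / Gamma_series' z n = Gamma (z + real n) / (fact (n - 1) * exp (z * ln (real n)))" for n
    using pochhammer_Gamma[OF z, of n] z
    by (simp add: Gamma_series'_def Gamma_eq_zero_iff)
  ultimately show ?thesis using z by (simp add: Gamma_eq_zero_iff)
qed

lemma cdh_ratio_mono:
  assumes "0 < a" "a \<le> a'" "b > 0" "d > 0"
  shows "cdh_ratio a b d \<le> cdh_ratio a' b d"
proof -
  define I where "I = (\<lambda>a. LINT x|lborel. cdh_real_weight a b d x)"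
  have mono: "I s / (Gamma s)\<^sup>2 \<le> I t / (Gamma t)\<^sup>2" if "0 < s" "s \<le> t" for s t
  proof -
    have "I s / (Gamma s)\<^sup>2 = (LINT x|lborel. cdh_real_weight s b d x / (Gamma s)\<^sup>2)" by (simp add: I_def)
    also have "\<dots> \<le> (LINT x|lborel. cdh_real_weight t b d x / (Gamma t)\<^sup>2)"
    proof (rule integral_mono)
      fix x
      define r where "r = (norm (Gamma (of_real b + \<i> * of_real x)))\<^sup>2 *
         (norm (Gamma (of_real d + \<i> * of_real x)))\<^sup>2 * (2 * x * sinh (2 * pi * x) / pi)"
      have r: "r \<ge> 0" unfolding r_def by (intro mult_nonneg_nonneg x_sinh_nonneg) auto
      have e: "cdh_real_weight p b d x / (Gamma p)\<^sup>2 = (norm (Gamma (of_real p + \<i> * of_real x)) / Gamma p)\<^sup>2 * r" for p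
        by (simp add: cdh_real_weight_def r_def power_divide mult_ac)
      show "cdh_real_weight s b d x / (Gamma s)\<^sup>2 \<le> cdh_real_weight t b d x / (Gamma t)\<^sup>2"
        unfolding e using r Gamma_norm_ratio_mono[OF that, of x] that(1)
        by (intro mult_right_mono power_mono) auto
    qed (use that assms integrable_cdh_real_weight in auto)
    finally show ?thesis by (simp add: I_def)
  qed
  define u where "u = (\<lambda>z n. Gamma (z + real n) / (fact (n - 1) * exp (z * ln (real n))))"
  have u: "u z \<longlonglongrightarrow> 1" if "z > 0" for z unfolding u_def using Gamma_plus_nat_asymp[OF that] .
  have upos: "u z n > 0" if "z > 0" for z n
    unfolding u_def using that by (simp add: add_pos_nonneg)
  \<comment> \<open>The Gamma quotient at a + n with its growth n^(b+d) divided out. It tends to 1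
    for every a, so the inequality between the masses becomes one between the ratios in the
    limit.\<close>
  define q where "q = (\<lambda>a n. u (a + b) n * u (a + d) n / (u a n)\<^sup>2)"
  have qlim: "q s \<longlonglongrightarrow> 1" if "s > 0" for s
  proof -
    have "q s \<longlonglongrightarrow> 1 * 1 / 1\<^sup>2"
      unfolding q_def using that assms by (intro tendsto_intros u) auto
    then show ?thesis by simp
  qed
  have I: "I (s + real n) / (Gamma (s + real n))\<^sup>2 = cdh_ratio s b d * q s n * (Gamma (b + d) * exp ((b + d) * ln (real n)))"
    if "s > 0" for s n
  proof -
    have g: "Gamma (z + real n) = u z n * (fact (n - 1) * exp (z * ln (real n)))" for z
      by (simp add: u_def)
    have pos: "Gamma (s + real n + b) > 0" "Gamma (s + real n + d) > 0" "Gamma (b + d) > 0"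
      using that assms by (intro Gamma_real_pos; simp add: add_pos_nonneg)+
    have "I (s + real n) = cdh_ratio s b d * (Gamma (s + real n + b) * Gamma (s + real n + d) * Gamma (b + d))"
      by (subst cdh_ratio_plus_nat[OF that assms(3,4), of n, symmetric]) (use pos in \<open>simp add: cdh_ratio_def I_def\<close>)
    also have "s + real n + b = (s + b) + real n" by simp
    also have "s + real n + d = (s + d) + real n" by simp
    finally show ?thesis
      unfolding g q_def using upos[OF that, of n]
      by (simp add: field_simps power2_eq_square exp_add)
  qed
  have "cdh_ratio a b d * q a n \<le> cdh_ratio a' b d * q a' n" for n
  proof -
    have "Gamma (b + d) * exp ((b + d) * ln (real n)) > 0" using assms by simp
    with mono[of "a + real n" "a' + real n"] I[of a n] I[of a' n] assms
    show ?thesis by (simp add: add_pos_nonneg mult_le_cancel_right)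
  qed
  moreover have "(\<lambda>n. cdh_ratio s b d * q s n) \<longlonglongrightarrow> cdh_ratio s b d * 1" if "s > 0" for s
    using qlim[OF that] by (intro tendsto_intros)
  ultimately show ?thesis
    using assms by (intro LIMSEQ_le[of "\<lambda>n. cdh_ratio a b d * q a n" _ "\<lambda>n. cdh_ratio a' b d * q a' n"])
       (force, force, blast)
qed

lemma cdh_ratio_const:
  assumes "0 < a" "0 < a'" "b > 0" "d > 0"
  shows "cdh_ratio a b d = cdh_ratio a' b d"
proof -
  have le: "cdh_ratio s b d \<le> cdh_ratio t b d" if st: "s > 0" "t > 0" for s t
  proof -
    obtain n :: nat where "s \<le> t + real n"
      by (metis real_arch_simple add_increasing less_imp_le st(2))
    then show ?thesis
      using cdh_ratio_mono[OF st(1) _ assms(3,4), of "t + real n"] cdh_ratio_plus_nat[OF st(2) assms(3,4), of n]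
      by simp
  qed
  show ?thesis using le[of a a'] le[of a' a] assms by simp
qed

lemma integral_sech:
  shows "integrable lborel (\<lambda>x::real. inverse (cosh (pi * x)))"
    and "(LINT x|lborel. inverse (cosh (pi * x))) = 1"
proof -
  define F where "F = (\<lambda>x::real. 2 / pi * arctan (exp (pi * x)))"
  have D: "(F has_real_derivative inverse (cosh (pi * x))) (at x)" for x
  proof -
    have 0: "exp (pi * x) > 0" by simp
    have "(F has_real_derivative 2 / pi * (inverse (1 + (exp (pi * x))\<^sup>2) * (exp (pi * x) * pi))) (at x)"
      unfolding F_def by (auto intro!: derivative_eq_intros)
    also have "2 / pi * (inverse (1 + (exp (pi * x))\<^sup>2) * (exp (pi * x) * pi)) = inverse (cosh (pi * x))"
    proof -
      have "1 + (exp (pi * x))\<^sup>2 > 0" "exp (pi * x) + inverse (exp (pi * x)) > 0" by (auto intro: add_pos_pos)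
      then show ?thesis
        unfolding cosh_field_def exp_minus by (simp add: divide_simps power2_eq_square)
    qed
    finally show ?thesis .
  qed
  have A: "((F \<circ> real_of_ereal) \<longlongrightarrow> 0) (at_right (-\<infinity>))"
  proof -
    have "(F \<longlongrightarrow> 2 / pi * arctan 0) at_bot"
      unfolding F_def
      by (intro tendsto_intros filterlim_compose[OF exp_at_bot] filterlim_tendsto_pos_mult_at_bot[OF tendsto_const] filterlim_ident) auto
    then show ?thesis by (simp add: ereal_tendsto_simps)
  qed
  have B: "((F \<circ> real_of_ereal) \<longlongrightarrow> 1) (at_left \<infinity>)"
  proof -
    have "(F \<longlongrightarrow> 2 / pi * (pi / 2)) at_top"
      unfolding F_def
      by (intro tendsto_intros filterlim_compose[OF tendsto_arctan_at_top] filterlim_compose[OF exp_at_top]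
            filterlim_tendsto_pos_mult_at_top[OF tendsto_const] filterlim_ident) auto
    then show ?thesis by (simp add: ereal_tendsto_simps)
  qed
  have "isCont (\<lambda>x. inverse (cosh (pi * x))) x" for x :: real
    by (intro continuous_intros) auto
  from interval_integral_FTC_nonneg[of "-\<infinity>" "\<infinity>" F, OF _ D this _ A B]
  have "set_integrable lborel (einterval (-\<infinity>) \<infinity>) (\<lambda>x. inverse (cosh (pi * x)))"
       "(LBINT x=-\<infinity>..\<infinity>. inverse (cosh (pi * x))) = 1"
    by auto
  then show "integrable lborel (\<lambda>x::real. inverse (cosh (pi * x)))"
    and "(LINT x|lborel. inverse (cosh (pi * x))) = 1"
    by (simp_all add: set_integrable_def interval_lebesgue_integral_def set_lebesgue_integral_def)
qed


text \<open>At y = pi x it gives x sinh(pi x) / cosh(pi x) <= pi x^2, which compensates the factor 1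
  / (a^2 + x^2) and keeps the domination uniform as a tends to 0.\<close>

lemma times_sinh_le: "y * sinh y \<le> y\<^sup>2 * cosh (y::real)"
proof -
  have pos: "sinh y \<le> y * cosh y" if "y \<ge> 0" for y :: real
  proof -
    have "0 * cosh 0 - sinh 0 \<le> y * cosh y - sinh y"
    proof (rule DERIV_nonneg_imp_nondecreasing[OF that])
      fix x :: real assume "0 \<le> x" "x \<le> y"
      then show "\<exists>z. ((\<lambda>y. y * cosh y - sinh y) has_real_derivative z) (at x) \<and> 0 \<le> z"
        by (intro exI[of _ "x * sinh x"] conjI) (auto intro!: derivative_eq_intros)
    qed
    then show ?thesis by simp
  qed
  show ?thesis
  proof (cases "y \<ge> 0")
    case True
    then show ?thesis using mult_left_mono[OF pos[OF True] True] by (simp add: power2_eq_square mult_ac)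
  next
    case False
    then show ?thesis using mult_left_mono[OF pos[of "-y"], of "-y"] by (simp add: power2_eq_square mult_ac)
  qed
qed

text \<open>The reflection formula at ix. At x = 0 the right side would be 0 by the convention for
  division, while the left side is 1.\<close>

lemma Gamma_norm_one:
  assumes "x \<noteq> 0"
  shows "(norm (Gamma (1 + \<i> * of_real x)))\<^sup>2 = pi * x / sinh (pi * x)"
proof -
  have sh: "sin (of_real pi * (\<i> * of_real x)) = \<i> * of_real (sinh (pi * x))"
    using sin_i_times_of_real[of "pi * x"] by (simp add: mult_ac)
  have ne: "\<i> * of_real x \<notin> \<int>\<^sub>\<le>\<^sub>0"
    using assms by (auto elim!: nonpos_Ints_cases simp: complex_eq_iff)
  have "complex_of_real ((norm (Gamma (1 + \<i> * of_real x)))\<^sup>2) = Gamma (1 + \<i> * of_real x) * Gamma (1 - \<i> * of_real x)"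
    by (simp add: cnj_Gamma complex_norm_square del: of_real_power)
  also have "\<dots> = \<i> * of_real x * (Gamma (\<i> * of_real x) * Gamma (1 - \<i> * of_real x))"
    using Gamma_plus1[OF ne] by (simp add: add_ac)
  also have "\<dots> = \<i> * of_real x * (of_real pi / sin (of_real pi * (\<i> * of_real x)))"
    by (simp only: Gamma_reflection_complex)
  also have "\<dots> = of_real (pi * x / sinh (pi * x))"
    unfolding sh by (simp add: field_simps)
  finally show ?thesis by (simp only: of_real_eq_iff)
qed

text \<open>As \<open>a\<close> tends to 0, the weight with parameters \<open>a, 1/2, 1/2\<close> tends to \<open>4 \<pi>\<^sup>2 / cosh (\<pi> x)\<close>.\<close>

lemma cdh_ratio_half: "cdh_ratio (1/2) (1/2) (1/2) = 4 * pi"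
proof -
  define \<alpha> where "\<alpha> = (\<lambda>n. 1 / real (Suc n))"
  have \<alpha>: "\<alpha> n > 0" "\<alpha> n \<le> 1" for n by (auto simp: \<alpha>_def)
  have \<alpha>_lim: "\<alpha> \<longlonglongrightarrow> 0" unfolding \<alpha>_def by (rule LIMSEQ_Suc[OF lim_1_over_n])
  \<comment> \<open>Raising the vanishing parameter by 1 moves Gamma away from its pole at 0 and
    isolates the singular factor 1 / (a^2 + x^2).\<close>
  define g where "g = (\<lambda>a x. (norm (Gamma (1 + of_real a + \<i> * of_real x)))\<^sup>2)"
  have w: "cdh_real_weight a (1/2) (1/2) x = g a x / (a\<^sup>2 + x\<^sup>2) * (4 * pi * x * sinh (pi * x) / cosh (pi * x))"
    if "a > 0" for a x
  proof -
    have "Gamma ((of_real a + \<i> * of_real x) + 1) = (of_real a + \<i> * of_real x) * Gamma (of_real a + \<i> * of_real x)"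
      using that by (intro Gamma_plus1 pos_Re_notin_nonpos_Ints) auto
    then have "g a x = (norm (of_real a + \<i> * of_real x))\<^sup>2 * (norm (Gamma (of_real a + \<i> * of_real x)))\<^sup>2"
      by (simp add: g_def add_ac norm_mult power_mult_distrib)
    also have "(norm (of_real a + \<i> * of_real x))\<^sup>2 = a\<^sup>2 + x\<^sup>2"
      by (simp add: cmod_power2)
    finally have 1: "(norm (Gamma (of_real a + \<i> * of_real x)))\<^sup>2 = g a x / (a\<^sup>2 + x\<^sup>2)"
      using that by (simp add: field_simps add_pos_nonneg sum_power2_eq_zero_iff)
    have 2: "sinh (2 * pi * x) = 2 * sinh (pi * x) * cosh (pi * x)"
      using sinh_double[of "pi * x"] by (simp only: mult.assoc)
    have 3: "(norm (Gamma (of_real (1/2) + \<i> * of_real x)))\<^sup>2 = pi / cosh (pi * x)"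
      using Gamma_norm_half[of x] by (simp add: divide_nonneg_pos)
    show ?thesis
      unfolding cdh_real_weight_def 1 2 3 by (simp add: divide_simps)
  qed
  obtain C where C: "C > 0" "\<And>p x. 1 \<le> Re p \<Longrightarrow> Re p \<le> 2 \<Longrightarrow> \<bar>Im p\<bar> \<le> 0 \<Longrightarrow>
           norm (Gamma (p + \<i> * of_real x)) \<le> C * exp (- (5 * pi / 12) * \<bar>x\<bar>)"
    using Gamma_box_bound[of 1 2 0] by auto
  have lim: "(\<lambda>n. LINT x|lborel. cdh_real_weight (\<alpha> n) (1/2) (1/2) x) \<longlonglongrightarrow> (LINT x|lborel. 4 * pi\<^sup>2 * inverse (cosh (pi * x)))"
  proof (rule integral_dominated_convergence[where w="\<lambda>x. 4 * pi\<^sup>2 * C\<^sup>2 * exp (- (5 * pi / 6) * \<bar>x\<bar>)"])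
    show "cdh_real_weight (\<alpha> n) (1/2) (1/2) \<in> borel_measurable lborel" for n
      using integrable_cdh_real_weight[OF \<alpha>(1), of "1/2" "1/2" n] by (intro borel_measurable_integrable) auto
    show "(\<lambda>x. 4 * pi\<^sup>2 * inverse (cosh (pi * x))) \<in> borel_measurable lborel"
      using integral_sech(1) by (intro borel_measurable_times borel_measurable_const borel_measurable_integrable)
    show "integrable lborel (\<lambda>x. 4 * pi\<^sup>2 * C\<^sup>2 * exp (- (5 * pi / 6) * \<bar>x\<bar>))"
      using integrable_polynomial_times_exp[of "5 * pi / 6" 0] by (intro integrable_mult_right) simp
    \<comment> \<open>At x = 0 every weight vanishes although the limit function is 4 pi^2 there, so
      convergence holds only almost everywhere.\<close>
    have "AE x in lborel. x \<noteq> (0::real)" by (rule AE_lborel_singleton)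
    then show "AE x in lborel. (\<lambda>n. cdh_real_weight (\<alpha> n) (1/2) (1/2) x) \<longlonglongrightarrow> 4 * pi\<^sup>2 * inverse (cosh (pi * x))"
    proof eventually_elim
      fix x :: real assume x: "x \<noteq> 0"
      have "(\<lambda>n. g (\<alpha> n) x / ((\<alpha> n)\<^sup>2 + x\<^sup>2) * (4 * pi * x * sinh (pi * x) / cosh (pi * x)))
         \<longlonglongrightarrow> g 0 x / (0\<^sup>2 + x\<^sup>2) * (4 * pi * x * sinh (pi * x) / cosh (pi * x))"
        unfolding g_def using x \<alpha>_lim
        by (intro tendsto_intros pos_Re_notin_nonpos_Ints) auto
      also have "g 0 x = pi * x / sinh (pi * x)"
        unfolding g_def using Gamma_norm_one[OF x] by simp
      also have "pi * x / sinh (pi * x) / (0\<^sup>2 + x\<^sup>2) * (4 * pi * x * sinh (pi * x) / cosh (pi * x)) = 4 * pi\<^sup>2 * inverse (cosh (pi * x))"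
        using x by (simp add: field_simps power2_eq_square)
      finally show "(\<lambda>n. cdh_real_weight (\<alpha> n) (1/2) (1/2) x) \<longlonglongrightarrow> 4 * pi\<^sup>2 * inverse (cosh (pi * x))"
        by (simp only: w[OF \<alpha>(1)])
    qed
    fix n
    from \<open>AE x in lborel. x \<noteq> (0::real)\<close>
    show "AE x in lborel. norm (cdh_real_weight (\<alpha> n) (1/2) (1/2) x) \<le> 4 * pi\<^sup>2 * C\<^sup>2 * exp (- (5 * pi / 6) * \<bar>x\<bar>)"
    proof eventually_elim
      fix x :: real assume x: "x \<noteq> 0"
      have "norm (Gamma (1 + of_real (\<alpha> n) + \<i> * of_real x)) \<le> C * exp (- (5 * pi / 12) * \<bar>x\<bar>)"
        using \<alpha>[of n] by (intro C) auto
      then have "g (\<alpha> n) x \<le> (C * exp (- (5 * pi / 12) * \<bar>x\<bar>))\<^sup>2"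
        unfolding g_def by (intro power_mono) auto
      also have "\<dots> = C\<^sup>2 * exp (- (5 * pi / 6) * \<bar>x\<bar>)"
        by (simp add: power_mult_distrib flip: exp_double)
      finally have g: "g (\<alpha> n) x \<le> C\<^sup>2 * exp (- (5 * pi / 6) * \<bar>x\<bar>)" .
      have "4 * (pi * x * sinh (pi * x)) \<le> 4 * ((pi * x)\<^sup>2 * cosh (pi * x))"
        by (intro mult_left_mono times_sinh_le) auto
      then have h: "4 * pi * x * sinh (pi * x) / cosh (pi * x) \<le> 4 * pi\<^sup>2 * x\<^sup>2"
        by (simp add: field_simps power_mult_distrib)
      have "0 \<le> pi * x * sinh (pi * x)" by (cases "x \<ge> 0") (auto simp: zero_le_mult_iff mult_le_0_iff)
      then have h0: "0 \<le> 4 * pi * x * sinh (pi * x) / cosh (pi * x)"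
        by (simp add: mult.assoc)
      have "g (\<alpha> n) x / ((\<alpha> n)\<^sup>2 + x\<^sup>2) \<le> (C\<^sup>2 * exp (- (5 * pi / 6) * \<bar>x\<bar>)) / x\<^sup>2"
        using x g by (intro frac_le) (auto simp: g_def)
      then have "cdh_real_weight (\<alpha> n) (1/2) (1/2) x \<le> (C\<^sup>2 * exp (- (5 * pi / 6) * \<bar>x\<bar>)) / x\<^sup>2 * (4 * pi\<^sup>2 * x\<^sup>2)"
        unfolding w[OF \<alpha>(1)] using h h0 by (intro mult_mono) auto
      also have "\<dots> = 4 * pi\<^sup>2 * C\<^sup>2 * exp (- (5 * pi / 6) * \<bar>x\<bar>)" using x by simp
      finally show "norm (cdh_real_weight (\<alpha> n) (1/2) (1/2) x) \<le> 4 * pi\<^sup>2 * C\<^sup>2 * exp (- (5 * pi / 6) * \<bar>x\<bar>)"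
        using cdh_real_weight_nonneg by simp
    qed
  qed
  have "(LINT x|lborel. 4 * pi\<^sup>2 * inverse (cosh (pi * x))) = 4 * pi\<^sup>2"
    using integral_sech by simp
  moreover have "(LINT x|lborel. cdh_real_weight (\<alpha> n) (1/2) (1/2) x) = cdh_ratio (1/2) (1/2) (1/2) * (Gamma (\<alpha> n + 1/2))\<^sup>2" for n
  proof -
    have "Gamma (\<alpha> n + 1/2) > 0" using \<alpha>[of n] by (simp add: add_pos_pos)
    moreover have "cdh_ratio (1/2) (1/2) (1/2) = cdh_ratio (\<alpha> n) (1/2) (1/2)"
      using \<alpha>[of n] by (intro cdh_ratio_const) auto
    ultimately show ?thesis
      by (simp add: cdh_ratio_def power2_eq_square)
  qed
  moreover have "(\<lambda>n. cdh_ratio (1/2) (1/2) (1/2) * (Gamma (\<alpha> n + 1/2))\<^sup>2) \<longlonglongrightarrow> cdh_ratio (1/2) (1/2) (1/2) * (Gamma (0 + 1/2))\<^sup>2"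
    using \<alpha>_lim by (intro tendsto_intros) (auto dest: nonpos_Ints_nonpos)
  \<comment> \<open>Gamma(1/2)^2 = pi reduces 4 pi^2 to 4 pi; the third Gamma factor is Gamma(1/2 +
    1/2) = 1.\<close>
  ultimately have "cdh_ratio (1/2) (1/2) (1/2) * (Gamma (0 + 1/2))\<^sup>2 = 4 * pi\<^sup>2"
    using lim by (simp only:) (rule LIMSEQ_unique)
  then show ?thesis
    by (simp add: Gamma_one_half_real power2_eq_square)
qed

lemma cdh_ratio_eq:
  assumes "a > 0" "b > 0" "d > 0"
  shows "cdh_ratio a b d = 4 * pi"
proof -
  have "cdh_ratio a b d = cdh_ratio (1/2) b d" using assms by (intro cdh_ratio_const) auto
  also have "\<dots> = cdh_ratio b (1/2) d" by (rule cdh_ratio_commute)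
  also have "\<dots> = cdh_ratio (1/2) (1/2) d" using assms by (intro cdh_ratio_const) auto
  also have "\<dots> = cdh_ratio (1/2) d (1/2)" by (rule cdh_ratio_commute)
  also have "\<dots> = cdh_ratio d (1/2) (1/2)" by (rule cdh_ratio_commute)
  also have "\<dots> = cdh_ratio (1/2) (1/2) (1/2)" using assms by (intro cdh_ratio_const) auto
  finally show ?thesis by (simp only: cdh_ratio_half)
qed

lemma holomorphic_on_cdh_mass:
  assumes "Re b > 0" "Re d > 0"
  shows "(\<lambda>a. cdh_mass a b d) holomorphic_on {a. Re a > 0}"
  unfolding cdh_mass_def
proof (rule holomorphic_on_lebesgue_integral)
  show "open {a. 0 < Re a}" by (rule open_halfspace_Re_gt)
  show "(\<lambda>a. cdh_weight a b d x) holomorphic_on {a. 0 < Re a}" for x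
    unfolding cdh_weight_def by (intro holomorphic_intros holomorphic_on_Gamma_pair) (use assms in auto)
  show "cdh_weight a b d \<in> borel_measurable lborel" if "a \<in> {a. 0 < Re a}" for a
    using borel_measurable_cdh_weight[of a b d] that assms by simp
  fix a assume a: "a \<in> {a. 0 < Re a}"
  define s1 where "s1 = min (Re a / 2) (min (Re b) (Re d))"
  define s2 where "s2 = max (Re a + Re a / 2) (max (Re b) (Re d))"
  define T where "T = max (\<bar>Im a\<bar> + Re a / 2) (max \<bar>Im b\<bar> \<bar>Im d\<bar>)"
  have "s1 > 0" using assms a by (auto simp: s1_def)
  from cdh_weight_bound[OF this, of s2 T] obtain C where C: "C > 0" "\<And>a b d x. s1 \<le> Re a \<Longrightarrow> Re a \<le> s2 \<Longrightarrow> \<bar>Im a\<bar> \<le> T \<Longrightarrow>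
            s1 \<le> Re b \<Longrightarrow> Re b \<le> s2 \<Longrightarrow> \<bar>Im b\<bar> \<le> T \<Longrightarrow> s1 \<le> Re d \<Longrightarrow> Re d \<le> s2 \<Longrightarrow> \<bar>Im d\<bar> \<le> T \<Longrightarrow>
           norm (cdh_weight a b d x) \<le> C * exp (- (pi / 4) * \<bar>x\<bar>)"
    by blast
  have "norm (cdh_weight w b d x) \<le> C * exp (- (pi / 4) * \<bar>x\<bar>)" if "w \<in> ball a (Re a / 2)" for w x
  proof (rule C)
    have "\<bar>Re a - Re w\<bar> < Re a / 2" "\<bar>Im a - Im w\<bar> < Re a / 2"
      using that abs_Re_le_cmod[of "a - w"] abs_Im_le_cmod[of "a - w"] by (auto simp: dist_norm)
    then have "Re a / 2 \<le> Re w" "Re w \<le> Re a + Re a / 2" "\<bar>Im w\<bar> \<le> \<bar>Im a\<bar> + Re a / 2"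
      by linarith+
    then show "s1 \<le> Re w" "Re w \<le> s2" "\<bar>Im w\<bar> \<le> T"
      unfolding s1_def s2_def T_def by linarith+
  qed (auto simp: s1_def s2_def T_def)
  moreover have "integrable lborel (\<lambda>x::real. C * exp (- (pi / 4) * \<bar>x\<bar>))"
    using integrable_polynomial_times_exp[of "pi / 4" 0] by (intro integrable_mult_right) simp
  ultimately show "\<exists>r>0. \<exists>g. integrable lborel g \<and>
      (\<forall>w\<in>ball a r \<inter> {a. 0 < Re a}. \<forall>x\<in>space lborel. norm (cdh_weight w b d x) \<le> g x)"
    using a by (intro exI[of _ "Re a / 2"] conjI exI[of _ "\<lambda>x. C * exp (- (pi / 4) * \<bar>x\<bar>)"]) auto
qed

text \<open>Continuation in the first parameter alone. With the symmetry of the mass, three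
  applications in \<open>cdh_mass_eq\<close> free the parameters one after another.\<close>

lemma cdh_mass_extend:
  assumes bd: "Re b > 0" "Re d > 0" and a: "Re a > 0"
    and eq: "\<And>r. r > 0 \<Longrightarrow> cdh_mass (of_real r) b d = 4 * of_real pi * (Gamma (of_real r + b) * Gamma (of_real r + d) * Gamma (b + d))"
  shows "cdh_mass a b d = 4 * of_real pi * (Gamma (a + b) * Gamma (a + d) * Gamma (b + d))"
proof (rule eq_on_right_halfplane[OF holomorphic_on_cdh_mass[OF bd] _ eq a])
  show "(\<lambda>a. 4 * of_real pi * (Gamma (a + b) * Gamma (a + d) * Gamma (b + d))) holomorphic_on {a. Re a > 0}"
    by (intro holomorphic_intros pos_Re_notin_nonpos_Ints) (use bd in auto)
qed

lemma cdh_mass_eq: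
  assumes "Re a > 0" "Re b > 0" "Re d > 0"
  shows "cdh_mass a b d = 4 * of_real pi * (Gamma (a + b) * Gamma (a + d) * Gamma (b + d))"
proof -
  have 1: "cdh_mass (of_real r) (of_real s) (of_real t) =
      4 * of_real pi * (Gamma (of_real r + of_real s) * Gamma (of_real r + of_real t) * Gamma (of_real s + of_real t))"
    if "r > 0" "s > 0" "t > 0" for r s t
  proof -
    have "Gamma (r + s) > 0" "Gamma (r + t) > 0" "Gamma (s + t) > 0" using that by simp_all
    then have "(LINT x|lborel. cdh_real_weight r s t x) = 4 * pi * (Gamma (r + s) * Gamma (r + t) * Gamma (s + t))"
      using cdh_ratio_eq[OF that] by (simp add: cdh_ratio_def field_simps)
    then show ?thesis
      by (simp only: cdh_mass_of_real of_real_mult of_real_numeral of_real_add Gamma_complex_of_real[symmetric])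
  qed
  have 2: "cdh_mass z (of_real s) (of_real t) =
      4 * of_real pi * (Gamma (z + of_real s) * Gamma (z + of_real t) * Gamma (of_real s + of_real t))"
    if "Re z > 0" "s > 0" "t > 0" for z s t
    by (rule cdh_mass_extend[OF _ _ _ 1]) (use that in simp_all)
  have 3: "cdh_mass z w (of_real t) =
      4 * of_real pi * (Gamma (z + w) * Gamma (z + of_real t) * Gamma (w + of_real t))"
    if "Re z > 0" "Re w > 0" "t > 0" for z w t
  proof -
    have "cdh_mass w z (of_real t) =
        4 * of_real pi * (Gamma (w + z) * Gamma (w + of_real t) * Gamma (z + of_real t))"
    proof (rule cdh_mass_extend)
      fix r :: real assume "r > 0"
      have "cdh_mass (of_real r) z (of_real t) = cdh_mass z (of_real r) (of_real t)"
        by (rule cdh_mass_commute)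
      then show "cdh_mass (of_real r) z (of_real t) =
          4 * of_real pi * (Gamma (of_real r + z) * Gamma (of_real r + of_real t) * Gamma (z + of_real t))"
        using 2[OF that(1) \<open>r > 0\<close> that(3)] by (simp only: add_ac mult_ac)
    qed (use that in auto)
    moreover have "cdh_mass w z (of_real t) = cdh_mass z w (of_real t)"
      by (rule cdh_mass_commute)
    ultimately show ?thesis by (simp only: add_ac mult_ac)
  qed
  have "cdh_mass d b a = 4 * of_real pi * (Gamma (d + b) * Gamma (d + a) * Gamma (b + a))"
  proof (rule cdh_mass_extend)
    fix t :: real assume "t > 0"
    have "cdh_mass (of_real t) b a = cdh_mass a b (of_real t)"
      by (metis cdh_mass_commute)
    then show "cdh_mass (of_real t) b a = 4 * of_real pi * (Gamma (of_real t + b) * Gamma (of_real t + a) * Gamma (b + a))"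
      using 3[OF assms(1,2) \<open>t > 0\<close>] by (simp only: add_ac mult_ac)
  qed (use assms in auto)
  moreover have "cdh_mass d b a = cdh_mass a b d"
    by (metis cdh_mass_commute)
  ultimately show ?thesis by (simp only: add_ac mult_ac)
qed

section \<open>Symmetry of the continuous dual Hahn polynomials\<close>

abbreviation pos_lborel :: "real measure" where
  "pos_lborel \<equiv> restrict_space lborel {0<..}"

lemma integrable_pos_lborel:
  fixes f :: "real \<Rightarrow> 'b::{banach,second_countable_topology}"
  assumes "integrable lborel f"
  shows "integrable pos_lborel f"
  using integrable_mult_indicator[OF _ assms, of "{0<..}"] by (simp add: integrable_restrict_space)

lemma integral_even:
  fixes f :: "real \<Rightarrow> complex"
  assumes f: "integrable lborel f" and even: "\<And>x. f (- x) = f x"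
  shows "(LINT x|lborel. f x) = 2 * (LINT x|pos_lborel. f x)"
proof -
  have i: "integrable lborel (\<lambda>x. indicator S x *\<^sub>R f x)" if "S \<in> sets borel" for S
    using integrable_mult_indicator[OF _ f] that by simp
  have "AE x in lborel. x \<noteq> (0::real)" by (rule AE_lborel_singleton)
  then have "AE x in lborel. f x = indicator {0<..} x *\<^sub>R f x + indicator {..<0} x *\<^sub>R f x"
    by eventually_elim (auto simp: indicator_def)
  then have "(LINT x|lborel. f x) = (LINT x|lborel. indicator {0<..} x *\<^sub>R f x + indicator {..<0} x *\<^sub>R f x)"
    using f i by (intro integral_cong_AE borel_measurable_add borel_measurable_integrable) auto
  also have "\<dots> = (LINT x|lborel. indicator {0<..} x *\<^sub>R f x) + (LINT x|lborel. indicator {..<0} x *\<^sub>R f x)"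
    by (intro Bochner_Integration.integral_add i) auto
  also have "(LINT x|lborel. indicator {..<0} x *\<^sub>R f x) = (LINT x|lborel. indicator {0<..} x *\<^sub>R f x)"
    by (subst lborel_integral_real_affine[of "-1" _ 0]) (auto simp: even indicator_def intro!: Bochner_Integration.integral_cong)
  finally show ?thesis by (simp add: integral_restrict_space)
qed

lemma cdh_weight_even: "cdh_weight a b d (- x) = cdh_weight a b d x"
  by (simp add: cdh_weight_def Gamma_pair_def mult_ac)

lemma integral_cdh_weight:
  assumes "Re a > 0" "Re b > 0" "Re d > 0"
  shows "(LINT x|pos_lborel. cdh_weight a b d x) = 2 * of_real pi * (Gamma (a + b) * Gamma (a + d) * Gamma (b + d))"
  using cdh_mass_eq[OF assms] integral_even[OF integrable_cdh_weight[OF assms] cdh_weight_even]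
  by (simp add: cdh_mass_def)

lemma Gamma_plus_of_nat:
  fixes z :: complex
  assumes "Re z > 0"
  shows "Gamma (z + of_nat n) = pochhammer z n * Gamma z"
  using pochhammer_Gamma[OF pos_Re_notin_nonpos_Ints[OF assms], of n]
    pos_Re_notin_nonpos_Ints[OF assms] by (simp add: Gamma_eq_zero_iff)

lemma pochhammer_nonzero:
  fixes z :: complex
  assumes "Re z > 0"
  shows "pochhammer z n \<noteq> 0"
  using assms by (auto simp: pochhammer_eq_0_iff)

text \<open>Each Gamma factor absorbs a rising factorial. Two parameters are shifted independently
  because one polynomial will be expanded at \<open>a\<close> and the other at
  \<open>b\<close>.\<close>

lemma cdh_weight_pochhammer:
  assumes "Re a > 0" "Re b > 0"
  shows "pochhammer (a + \<i> * of_real x) j * pochhammer (a - \<i> * of_real x) j *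
         (pochhammer (b + \<i> * of_real x) m * pochhammer (b - \<i> * of_real x) m) * cdh_weight a b d x
       = cdh_weight (a + of_nat j) (b + of_nat m) d x"
proof -
  have "Gamma_pair (p + of_nat i) (\<i> * of_real x) =
      pochhammer (p + \<i> * of_real x) i * pochhammer (p - \<i> * of_real x) i * Gamma_pair p (\<i> * of_real x)"
    if "Re p > 0" for p i
  proof -
    have "p + of_nat i + \<i> * of_real x = (p + \<i> * of_real x) + of_nat i"
         "p + of_nat i - \<i> * of_real x = (p - \<i> * of_real x) + of_nat i" by simp_all
    then show ?thesis
      unfolding Gamma_pair_def using that by (simp only: Gamma_plus_of_nat) (simp add: Gamma_plus_of_nat)
  qed
  from this[OF assms(1)] this[OF assms(2)] show ?thesis by (simp add: cdh_weight_def)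
qed

section \<open>Finite sums of Chu-Vandermonde type\<close>

lemma pochhammer_neg_of_nat:
  "pochhammer (- of_nat n :: complex) k = (-1) ^ k * fact k * of_nat (n choose k)"
proof -
  have "(-1) ^ k * fact k * of_nat (n choose k) = ((-1) ^ k * (-1) ^ k) * pochhammer (- of_nat n :: complex) k"
    by (simp add: binomial_gbinomial gbinomial_pochhammer)
  also have "(-1) ^ k * (-1) ^ k = (1 :: complex)"
    by (simp flip: power_mult_distrib)
  finally show ?thesis by simp
qed

text \<open>Chu-Vandermonde with (-n)_l / l! as a signed binomial coefficient, the shape in which
  the terminating sums below arise.\<close>

lemma Vandermonde_alternating:
  fixes a c :: complex
  assumes "Re c > 0"
  shows "(\<Sum>l\<le>n. (-1) ^ l * of_nat (n choose l) * (pochhammer a l / pochhammer c l)) =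
         pochhammer (c - a) n / pochhammer c n"
proof -
  have "\<forall>i\<in>{0..<n}. c \<noteq> - of_nat i" using assms by auto
  from Vandermonde_pochhammer[OF this, of a]
  show ?thesis
    by (simp add: pochhammer_neg_of_nat atLeast0AtMost mult_ac)
qed

text \<open>The product of binomials (n over m)(m over k) equals (n over k)(n-k over m-k); put m = k
  + l. After an exchange of sums this prepares the inner one for a second Chu-Vandermonde. For k > n
  both sides vanish.\<close>

lemma alternating_choose_swap:
  fixes f :: "nat \<Rightarrow> complex"
  shows "(\<Sum>m\<le>n. (-1) ^ m * of_nat (n choose m) * of_nat (m choose k) * f m) =
         (-1) ^ k * of_nat (n choose k) * (\<Sum>l\<le>n - k. (-1) ^ l * of_nat ((n - k) choose l) * f (k + l))"
proof (cases "k \<le> n")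
  case True
  have "(\<Sum>m\<le>n. (-1) ^ m * of_nat (n choose m) * of_nat (m choose k) * f m) =
        (\<Sum>m\<in>{k..n}. (-1) ^ m * of_nat (n choose m) * of_nat (m choose k) * f m)"
    by (rule sum.mono_neutral_right) (auto simp: binomial_eq_0)
  also have "\<dots> = (\<Sum>l\<le>n - k. (-1) ^ (k + l) * (of_nat (n choose (k + l)) * of_nat ((k + l) choose k)) * f (k + l))"
    by (rule sum.reindex_bij_witness[of _ "\<lambda>l. k + l" "\<lambda>m. m - k"]) (use True in auto)
  also have "\<dots> = (\<Sum>l\<le>n - k. (-1) ^ k * of_nat (n choose k) * ((-1) ^ l * of_nat ((n - k) choose l) * f (k + l)))"
  proof (rule sum.cong[OF refl])
    fix l assume "l \<in> {..n - k}"
    then have "(n choose (k + l)) * ((k + l) choose k) = (n choose k) * ((n - k) choose l)"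
      using choose_mult[of k "k + l" n] True by auto
    then have "of_nat (n choose (k + l)) * of_nat ((k + l) choose k) =
        (of_nat (n choose k) * of_nat ((n - k) choose l) :: complex)"
      by (metis of_nat_mult)
    then show "(-1) ^ (k + l) * (of_nat (n choose (k + l)) * of_nat ((k + l) choose k)) * f (k + l) =
        (-1) ^ k * of_nat (n choose k) * ((-1) ^ l * of_nat ((n - k) choose l) * f (k + l))"
      by (simp add: power_add)
  qed
  finally show ?thesis by (simp add: sum_distrib_left)
next
  case False
  then show ?thesis by (auto simp: binomial_eq_0 intro!: sum.neutral)
qed

text \<open>The point 1 lies on the cut, so \<open>hypF\<close> returns the series value there, and
  (-n)_m vanishes for m > n.\<close>

lemma cdual_hahn_altdef:
  "cdual_hahn n x a b c = pochhammer (a + b) n * pochhammer (a + c) n *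
     (\<Sum>m\<le>n. (-1) ^ m * of_nat (n choose m) *
       (pochhammer (a + \<i> * of_real x) m * pochhammer (a - \<i> * of_real x) m /
        (pochhammer (a + b) m * pochhammer (a + c) m)))"
proof -
  have "(1::complex) \<notin> hyp_domain" by (auto simp: hyp_domain_def image_iff intro: exI[of _ 1])
  then have "hypF [- of_nat n, a + \<i> * of_real x, a - \<i> * of_real x] [a + b, a + c] 1 =
      (\<Sum>m. pochhammer (- of_nat n) m * (pochhammer (a + \<i> * of_real x) m * pochhammer (a - \<i> * of_real x) m) /
        (pochhammer (a + b) m * pochhammer (a + c) m) * (1 / fact m))"
    by (simp add: hypF_def hyp_series_def)
  also have "\<dots> = (\<Sum>m\<le>n. pochhammer (- of_nat n) m * (pochhammer (a + \<i> * of_real x) m * pochhammer (a - \<i> * of_real x) m) /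
        (pochhammer (a + b) m * pochhammer (a + c) m) * (1 / fact m))"
    by (rule suminf_finite) (auto simp: pochhammer_neg_of_nat binomial_eq_0)
  also have "\<dots> = (\<Sum>m\<le>n. (-1) ^ m * of_nat (n choose m) *
       (pochhammer (a + \<i> * of_real x) m * pochhammer (a - \<i> * of_real x) m /
        (pochhammer (a + b) m * pochhammer (a + c) m)))"
    by (intro sum.cong refl) (simp add: pochhammer_neg_of_nat field_simps)
  finally show ?thesis by (simp add: cdual_hahn_def)
qed

lemma cdual_hahn_commute_right: "cdual_hahn n x a b c = cdual_hahn n x a c b"
  unfolding cdual_hahn_altdef by (simp add: mult_ac)

text \<open>The right-hand side is symmetric in \<open>a\<close> and \<open>b\<close>.\<close>

lemma cdual_hahn_symmetric_sum:
  assumes "Re (a + b) > 0" "Re (a + c) > 0"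
  shows "cdual_hahn n x a b c = pochhammer (a + b) n *
     (\<Sum>k\<le>n. of_nat (n choose k) * (pochhammer (a - \<i> * of_real x) k * pochhammer (b - \<i> * of_real x) k *
        pochhammer (c + \<i> * of_real x) (n - k) / pochhammer (a + b) k))"
proof -
  define A where "A = a + \<i> * of_real x"
  define B where "B = a - \<i> * of_real x"
  define D where "D = a + b"
  define E where "E = a + c"
  have DA: "D - A = b - \<i> * of_real x" and EB: "E - B = c + \<i> * of_real x"
    by (simp_all add: A_def B_def D_def E_def)
  have D: "Re D > 0" and E: "Re E > 0" using assms by (simp_all add: D_def E_def)
  have inner: "(\<Sum>l\<le>n - k. (-1) ^ l * of_nat ((n - k) choose l) * (pochhammer B (k + l) / pochhammer E (k + l)))
      = pochhammer B k * pochhammer (E - B) (n - k) / pochhammer E n" if "k \<le> n" for k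
  proof -
    have "(\<Sum>l\<le>n - k. (-1) ^ l * of_nat ((n - k) choose l) * (pochhammer B (k + l) / pochhammer E (k + l)))
      = (pochhammer B k / pochhammer E k) * (\<Sum>l\<le>n - k. (-1) ^ l * of_nat ((n - k) choose l) *
          (pochhammer (B + of_nat k) l / pochhammer (E + of_nat k) l))"
      unfolding sum_distrib_left by (intro sum.cong refl) (simp add: pochhammer_product')
    also have "\<dots> = (pochhammer B k / pochhammer E k) * (pochhammer (E - B) (n - k) / pochhammer (E + of_nat k) (n - k))"
      using E by (subst Vandermonde_alternating) auto
    also have "\<dots> = pochhammer B k * pochhammer (E - B) (n - k) / pochhammer E n"
      using that by (simp add: pochhammer_product[of k n])
    finally show ?thesis .
  qed
  \<comment> \<open>Termwise only the symmetry in \<open>b\<close> and \<open>c\<close> is visible.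
    Replacing (A)_m / (D)_m by a Chu-Vandermonde sum and exchanging the sums leaves
    \<open>inner\<close>, which is again summable and brings out the symmetry in \<open>a\<close>
    and \<open>b\<close>.\<close>
  have "(\<Sum>m\<le>n. (-1) ^ m * of_nat (n choose m) * (pochhammer A m * pochhammer B m / (pochhammer D m * pochhammer E m)))
      = (\<Sum>m\<le>n. (-1) ^ m * of_nat (n choose m) * (pochhammer B m / pochhammer E m) * (pochhammer (D - (D - A)) m / pochhammer D m))"
    by (intro sum.cong refl) (simp add: mult_ac)
  also have "\<dots> = (\<Sum>m\<le>n. \<Sum>k\<le>m. (-1) ^ m * of_nat (n choose m) * (pochhammer B m / pochhammer E m) *
      ((-1) ^ k * of_nat (m choose k) * (pochhammer (D - A) k / pochhammer D k)))"
    unfolding Vandermonde_alternating[OF D, symmetric] sum_distrib_left ..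
  also have "\<dots> = (\<Sum>m\<le>n. \<Sum>k\<le>n. (-1) ^ m * of_nat (n choose m) * (pochhammer B m / pochhammer E m) *
      ((-1) ^ k * of_nat (m choose k) * (pochhammer (D - A) k / pochhammer D k)))"
    by (intro sum.cong refl sum.mono_neutral_left) (auto simp: binomial_eq_0)
  also have "\<dots> = (\<Sum>k\<le>n. \<Sum>m\<le>n. (-1) ^ m * of_nat (n choose m) * (pochhammer B m / pochhammer E m) *
      ((-1) ^ k * of_nat (m choose k) * (pochhammer (D - A) k / pochhammer D k)))"
    by (rule sum.swap)
  also have "\<dots> = (\<Sum>k\<le>n. ((-1) ^ k * (pochhammer (D - A) k / pochhammer D k)) *
      (\<Sum>m\<le>n. (-1) ^ m * of_nat (n choose m) * of_nat (m choose k) * (pochhammer B m / pochhammer E m)))"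
    by (intro sum.cong refl) (simp add: sum_distrib_left mult_ac)
  also have "\<dots> = (\<Sum>k\<le>n. of_nat (n choose k) * (pochhammer B k * pochhammer (D - A) k * pochhammer (E - B) (n - k) / pochhammer D k)
      / pochhammer E n)"
    unfolding alternating_choose_swap
  proof (intro sum.cong refl)
    fix k assume "k \<in> {..n}"
    then have k: "k \<le> n" by simp
    show "(-1) ^ k * (pochhammer (D - A) k / pochhammer D k) * ((-1) ^ k * of_nat (n choose k) *
        (\<Sum>l\<le>n - k. (-1) ^ l * of_nat ((n - k) choose l) * (pochhammer B (k + l) / pochhammer E (k + l)))) =
      of_nat (n choose k) * (pochhammer B k * pochhammer (D - A) k * pochhammer (E - B) (n - k) / pochhammer D k)
        / pochhammer E n"
      unfolding inner[OF k] by (cases "even k") (simp_all add: mult_ac)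
  qed
  also have "\<dots> = (\<Sum>k\<le>n. of_nat (n choose k) * (pochhammer B k * pochhammer (D - A) k * pochhammer (E - B) (n - k) / pochhammer D k))
      / pochhammer E n"
    by (rule sum_divide_distrib[symmetric])
  finally show ?thesis
    unfolding cdual_hahn_altdef DA EB A_def[symmetric] B_def[symmetric] D_def[symmetric] E_def[symmetric]
    using pochhammer_nonzero[OF E, of n] by (simp add: DA EB)
qed

lemma cdual_hahn_commute_left:
  assumes "Re a > 0" "Re b > 0" "Re c > 0"
  shows "cdual_hahn n x a b c = cdual_hahn n x b a c"
  using assms by (simp add: cdual_hahn_symmetric_sum add.commute mult_ac)

section \<open>Conjugation and reality of the polynomials\<close>

lemma cnj_pochhammer: "cnj (pochhammer z n) = pochhammer (cnj z) n"
  by (simp add: pochhammer_prod)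

lemma cnj_cdual_hahn: "cnj (cdual_hahn n x a b c) = cdual_hahn n x (cnj a) (cnj b) (cnj c)"
  unfolding cdual_hahn_altdef by (simp add: cnj_pochhammer mult_ac)

lemma dual_hahn_params_Re:
  assumes "dual_hahn_params a b c"
  shows "Re a > 0" "Re b > 0" "Re c > 0"
  using assms by (auto simp: dual_hahn_params_def pos_param_def conj_params_def)

lemma pos_param_cnj: "pos_param a \<Longrightarrow> cnj a = a"
  by (simp add: pos_param_def complex_is_Real_iff complex_eq_iff)

lemma dual_hahn_params_cnj_cases [consumes 1]:
  assumes "dual_hahn_params a b c"
  obtains "cnj a = a" "cnj b = b" "cnj c = c" | "cnj a = b" "cnj b = a" "cnj c = c"
    | "cnj a = c" "cnj c = a" "cnj b = b" | "cnj b = c" "cnj c = b" "cnj a = a"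
proof -
  have "cnj z = w \<and> cnj w = z" if "conj_params z w" for z w
    using that by (simp add: conj_params_def)
  then show thesis
    using assms that pos_param_cnj unfolding dual_hahn_params_def by blast
qed

text \<open>Conjugation permutes the three parameters, and the polynomial is symmetric in
  them.\<close>

lemma cnj_cdual_hahn_real:
  assumes "dual_hahn_params a b c"
  shows "cnj (cdual_hahn n x a b c) = cdual_hahn n x a b c"
proof -
  note Re = dual_hahn_params_Re[OF assms]
  have s: "cdual_hahn n x b a c = cdual_hahn n x a b c" "cdual_hahn n x a c b = cdual_hahn n x a b c"
      "cdual_hahn n x c b a = cdual_hahn n x a b c"
    using Re by (metis cdual_hahn_commute_left cdual_hahn_commute_right)+
  from assms show ?thesis
    unfolding cnj_cdual_hahn by (cases rule: dual_hahn_params_cnj_cases) (simp_all only: s)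
qed

lemma pochhammer_times_bound:
  "\<exists>B\<ge>0. \<forall>x. norm (pochhammer (a + \<i> * of_real x) m * pochhammer (a - \<i> * of_real x) m) \<le> B * (1 + \<bar>x\<bar>) ^ (2 * m)"
proof (induction m)
  case (Suc m)
  then obtain B where B: "B \<ge> 0"
    "\<And>x. norm (pochhammer (a + \<i> * of_real x) m * pochhammer (a - \<i> * of_real x) m) \<le> B * (1 + \<bar>x\<bar>) ^ (2 * m)"
    by blast
  define K where "K = norm a + real m + 1"
  have K: "K \<ge> 1" by (simp add: K_def)
  have lin: "norm (a + s * \<i> * of_real x + of_nat m) \<le> K * (1 + \<bar>x\<bar>)" if "s = 1 \<or> s = -1" for x s
  proof -
    have "norm (a + s * \<i> * of_real x + of_nat m) \<le> norm a + norm (s * \<i> * of_real x) + norm (of_nat m :: complex)"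
      by (meson add_right_mono norm_triangle_ineq norm_triangle_le order_trans)
    also have "\<dots> = norm a + \<bar>x\<bar> + real m" using that by (auto simp: norm_mult)
    also have "\<dots> \<le> K + K * \<bar>x\<bar>"
      using mult_right_mono[OF K, of "\<bar>x\<bar>"] by (simp add: K_def)
    finally show ?thesis by (simp add: algebra_simps)
  qed
  have "norm (pochhammer (a + \<i> * of_real x) (Suc m) * pochhammer (a - \<i> * of_real x) (Suc m)) \<le>
      (B * K * K) * (1 + \<bar>x\<bar>) ^ (2 * Suc m)" for x
  proof -
    have "norm (pochhammer (a + \<i> * of_real x) (Suc m) * pochhammer (a - \<i> * of_real x) (Suc m)) =
        norm (pochhammer (a + \<i> * of_real x) m * pochhammer (a - \<i> * of_real x) m) *
        norm (a + 1 * \<i> * of_real x + of_nat m) * norm (a + (-1) * \<i> * of_real x + of_nat m)"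
      by (simp add: pochhammer_Suc norm_mult)
    also have "\<dots> \<le> (B * (1 + \<bar>x\<bar>) ^ (2 * m)) * (K * (1 + \<bar>x\<bar>)) * (K * (1 + \<bar>x\<bar>))"
      using B K by (intro mult_mono lin mult_nonneg_nonneg) auto
    finally show ?thesis by (simp add: mult_ac)
  qed
  moreover have "B * K * K \<ge> 0" using B K by simp
  ultimately show ?case by blast
qed (auto intro: exI[of _ 1])

section \<open>Moments and orthogonality\<close>

lemma cdual_hahn_bound:
  "\<exists>B\<ge>0. \<forall>x. norm (cdual_hahn n x a b c) \<le> B * (1 + \<bar>x\<bar>) ^ (2 * n)"
proof -
  define P where "P = (\<lambda>m x. pochhammer (a + \<i> * complex_of_real x) m * pochhammer (a - \<i> * complex_of_real x) m)"
  define K where "K = (\<lambda>m. (-1) ^ m * of_nat (n choose m) / (pochhammer (a + b) m * pochhammer (a + c) m))"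
  have "\<exists>B. \<forall>m. 0 \<le> B m \<and> (\<forall>x. norm (P m x) \<le> B m * (1 + \<bar>x\<bar>) ^ (2 * m))"
    unfolding P_def using pochhammer_times_bound[of a] by (intro choice allI) auto
  then obtain B where B: "\<And>m. 0 \<le> B m" "\<And>m x. norm (P m x) \<le> B m * (1 + \<bar>x\<bar>) ^ (2 * m)"
    by blast
  define C where "C = norm (pochhammer (a + b) n * pochhammer (a + c) n)"
  have "norm (cdual_hahn n x a b c) \<le> (C * (\<Sum>m\<le>n. norm (K m) * B m)) * (1 + \<bar>x\<bar>) ^ (2 * n)" for x
  proof -
    have "cdual_hahn n x a b c = pochhammer (a + b) n * pochhammer (a + c) n * (\<Sum>m\<le>n. K m * P m x)"
      unfolding cdual_hahn_altdef K_def P_def by (simp add: mult_ac)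
    then have "norm (cdual_hahn n x a b c) = C * norm (\<Sum>m\<le>n. K m * P m x)"
      by (simp add: C_def norm_mult)
    also have "\<dots> \<le> C * (\<Sum>m\<le>n. norm (K m) * B m * (1 + \<bar>x\<bar>) ^ (2 * n))"
    proof (intro mult_left_mono sum_norm_le)
      fix m assume m: "m \<in> {..n}"
      have "norm (P m x) \<le> B m * (1 + \<bar>x\<bar>) ^ (2 * n)"
        using m B(1)[of m] by (intro order_trans[OF B(2)] mult_left_mono power_increasing) auto
      then show "norm (K m * P m x) \<le> norm (K m) * B m * (1 + \<bar>x\<bar>) ^ (2 * n)"
        using mult_left_mono[of _ _ "norm (K m)"] by (simp add: norm_mult mult.assoc)
    qed (simp add: C_def)
    finally show ?thesis by (simp add: sum_distrib_right mult.assoc)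
  qed
  moreover have "C * (\<Sum>m\<le>n. norm (K m) * B m) \<ge> 0"
    using B(1) by (auto simp: C_def intro!: mult_nonneg_nonneg sum_nonneg)
  ultimately show ?thesis by blast
qed

lemma borel_measurable_cdual_hahn [measurable]:
  "(\<lambda>x. cdual_hahn n x a b c) \<in> borel_measurable borel"
  unfolding cdual_hahn_altdef pochhammer_prod by measurable

text \<open>Expanding the polynomial at \<open>b\<close> instead of \<open>a\<close> makes every
  term a weight with parameters a + j, b + m, d, whose mass is known. Chu-Vandermonde then yields
  (-j)_k, which vanishes for j < k: this is the orthogonality.\<close>

lemma integral_pochhammer_cdual_hahn:
  assumes Re: "Re a > 0" "Re b > 0" "Re d > 0"
  shows "(LINT x|pos_lborel. pochhammer (a + \<i> * of_real x) j * pochhammer (a - \<i> * of_real x) j *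
            (cdual_hahn k x a b d * cdh_weight a b d x)) =
         2 * of_real pi * (Gamma (b + d + of_nat k) * Gamma (a + d + of_nat j) * Gamma (a + b + of_nat j))
           * pochhammer (- of_nat j) k" (is ?eq)
    and "integrable pos_lborel (\<lambda>x. pochhammer (a + \<i> * of_real x) j * pochhammer (a - \<i> * of_real x) j *
            (cdual_hahn k x a b d * cdh_weight a b d x))" (is ?int)
proof -
  define K where "K = (\<lambda>m. pochhammer (b + a) k * pochhammer (b + d) k * ((-1) ^ m * of_nat (k choose m) /
      (pochhammer (b + a) m * pochhammer (b + d) m)))"
  have eq: "pochhammer (a + \<i> * of_real x) j * pochhammer (a - \<i> * of_real x) j * (cdual_hahn k x a b d * cdh_weight a b d x)
      = (\<Sum>m\<le>k. K m * cdh_weight (a + of_nat j) (b + of_nat m) d x)" for x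
    by (subst cdual_hahn_commute_left[OF Re],
        unfold cdual_hahn_altdef cdh_weight_pochhammer[OF Re(1,2), symmetric] K_def)
      (simp add: sum_distrib_left sum_distrib_right mult_ac)
  have i: "integrable pos_lborel (cdh_weight (a + of_nat j) (b + of_nat m) d)" for m
    using Re by (intro integrable_pos_lborel integrable_cdh_weight) (auto simp: add_pos_nonneg)
  show ?int unfolding eq using i by simp
  have Re': "Re (a + b + of_nat j) > 0" "Re (b + d) > 0" "Re (a + b) > 0" using Re by (auto simp: add_pos_nonneg)
  have "(LINT x|pos_lborel. (\<Sum>m\<le>k. K m * cdh_weight (a + of_nat j) (b + of_nat m) d x)) =
      (\<Sum>m\<le>k. K m * (LINT x|pos_lborel. cdh_weight (a + of_nat j) (b + of_nat m) d x))"
    using i by simp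
  also have "\<dots> = (\<Sum>m\<le>k. K m * (2 * of_real pi * (pochhammer (a + b + of_nat j) m * Gamma (a + b + of_nat j) *
      Gamma (a + d + of_nat j) * (pochhammer (b + d) m * Gamma (b + d)))))"
  proof (intro sum.cong refl arg_cong2[where f="(*)"])
    fix m
    have "(LINT x|pos_lborel. cdh_weight (a + of_nat j) (b + of_nat m) d x) =
       2 * of_real pi * (Gamma (a + of_nat j + (b + of_nat m)) * Gamma (a + of_nat j + d) * Gamma (b + of_nat m + d))"
      using Re by (intro integral_cdh_weight) (auto simp: add_pos_nonneg)
    also have "a + of_nat j + (b + of_nat m) = (a + b + of_nat j) + of_nat m" by simp
    also have "a + of_nat j + d = a + d + of_nat j" by simp
    also have "b + of_nat m + d = (b + d) + of_nat m" by simp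
    finally show "(LINT x|pos_lborel. cdh_weight (a + of_nat j) (b + of_nat m) d x) = 2 * of_real pi *
        (pochhammer (a + b + of_nat j) m * Gamma (a + b + of_nat j) *
      Gamma (a + d + of_nat j) * (pochhammer (b + d) m * Gamma (b + d)))"
      unfolding Gamma_plus_of_nat[OF Re'(1)] Gamma_plus_of_nat[OF Re'(2)] by simp
  qed
  also have "\<dots> = 2 * of_real pi * (pochhammer (b + d) k * Gamma (b + d)) * Gamma (a + d + of_nat j) * Gamma (a + b + of_nat j) *
      pochhammer (a + b) k * (\<Sum>m\<le>k. (-1) ^ m * of_nat (k choose m) * (pochhammer (a + b + of_nat j) m / pochhammer (a + b) m))"
    unfolding sum_distrib_left
  proof (intro sum.cong refl)
    fix m
    have "pochhammer (b + d) m \<noteq> 0" by (rule pochhammer_nonzero[OF Re'(2)])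
    then show "K m * (2 * of_real pi * (pochhammer (a + b + of_nat j) m * Gamma (a + b + of_nat j) *
        Gamma (a + d + of_nat j) * (pochhammer (b + d) m * Gamma (b + d)))) =
      2 * of_real pi * (pochhammer (b + d) k * Gamma (b + d)) * Gamma (a + d + of_nat j) * Gamma (a + b + of_nat j) *
      pochhammer (a + b) k * ((-1) ^ m * of_nat (k choose m) * (pochhammer (a + b + of_nat j) m / pochhammer (a + b) m))"
      unfolding K_def add.commute[of b a] by simp
  qed
  also have "\<dots> = 2 * of_real pi * (Gamma (b + d + of_nat k) * Gamma (a + d + of_nat j) * Gamma (a + b + of_nat j))
           * pochhammer (- of_nat j) k"
    unfolding Vandermonde_alternating[OF Re'(3)] Gamma_plus_of_nat[OF Re'(2)]
    using pochhammer_nonzero[OF Re'(3), of k] by simp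
  finally show ?eq unfolding eq .
qed

text \<open>Expansion of the first polynomial at \<open>a\<close> leaves a sum over j against
  (-j)_k, and Chu-Vandermonde turns it into (c-d)_(n-k). For c = d this is the orthogonality
  relation with its norm; otherwise it carries the connection coefficients of the two families. For
  n < k the binomial coefficient is 0, so the truncated \<open>n - k\<close> is harmless.\<close>

lemma integral_cdual_hahn_product:
  assumes Re: "Re a > 0" "Re b > 0" "Re c > 0" "Re d > 0"
  shows "(LINT x|pos_lborel. cdual_hahn n x a b c * (cdual_hahn k x a b d * cdh_weight a b d x)) =
         2 * of_real pi * fact k * of_nat (n choose k) * pochhammer (a + b) n * pochhammer (c - d) (n - k) *
           (Gamma (a + b) * Gamma (a + d + of_nat k) * Gamma (b + d + of_nat k))" (is ?eq)
    and "integrable pos_lborel (\<lambda>x. cdual_hahn n x a b c * (cdual_hahn k x a b d * cdh_weight a b d x))" (is ?int)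
proof -
  have Re': "Re (a + b) > 0" "Re (a + d) > 0" "Re (a + c) > 0" using Re by simp_all
  define P where "P = (\<lambda>j x. pochhammer (a + \<i> * complex_of_real x) j * pochhammer (a - \<i> * complex_of_real x) j *
            (cdual_hahn k x a b d * cdh_weight a b d x))"
  define K where "K = (\<lambda>j. pochhammer (a + b) n * pochhammer (a + c) n * ((-1) ^ j * of_nat (n choose j) /
      (pochhammer (a + b) j * pochhammer (a + c) j)))"
  have eq: "cdual_hahn n x a b c * (cdual_hahn k x a b d * cdh_weight a b d x) = (\<Sum>j\<le>n. K j * P j x)" for x
    unfolding cdual_hahn_altdef[of n] K_def P_def
    by (simp add: sum_distrib_left sum_distrib_right mult_ac)
  have i: "integrable pos_lborel (P j)" for j
    unfolding P_def using integral_pochhammer_cdual_hahn(2)[OF Re(1,2,4)] .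
  show ?int unfolding eq using i by simp
  define M where "M = 2 * of_real pi * Gamma (b + d + of_nat k) * Gamma (a + d) * Gamma (a + b) *
      pochhammer (a + b) n * pochhammer (a + c) n * (-1) ^ k * fact k"
  have "(LINT x|pos_lborel. (\<Sum>j\<le>n. K j * P j x)) = (\<Sum>j\<le>n. K j * (LINT x|pos_lborel. P j x))"
    using i by simp
  also have "\<dots> = (\<Sum>j\<le>n. M * ((-1) ^ j * of_nat (n choose j) * of_nat (j choose k) * (pochhammer (a + d) j / pochhammer (a + c) j)))"
    unfolding P_def integral_pochhammer_cdual_hahn(1)[OF Re(1,2,4)] Gamma_plus_of_nat[OF Re'(1)] Gamma_plus_of_nat[OF Re'(2)]
      pochhammer_neg_of_nat
    using pochhammer_nonzero[OF Re'(1)]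
    by (intro sum.cong refl) (simp add: K_def M_def)
  also have "\<dots> = M * ((-1) ^ k * of_nat (n choose k) * (\<Sum>l\<le>n - k. (-1) ^ l * of_nat ((n - k) choose l) *
      (pochhammer (a + d) (k + l) / pochhammer (a + c) (k + l))))"
    unfolding sum_distrib_left[symmetric] alternating_choose_swap ..
  also have "(\<Sum>l\<le>n - k. (-1) ^ l * of_nat ((n - k) choose l) * (pochhammer (a + d) (k + l) / pochhammer (a + c) (k + l))) =
      (pochhammer (a + d) k / pochhammer (a + c) k) * (\<Sum>l\<le>n - k. (-1) ^ l * of_nat ((n - k) choose l) *
          (pochhammer (a + d + of_nat k) l / pochhammer (a + c + of_nat k) l))"
    unfolding sum_distrib_left by (intro sum.cong refl) (simp add: pochhammer_product')
  also have "\<dots> = (pochhammer (a + d) k / pochhammer (a + c) k) *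
      (pochhammer (c - d) (n - k) / pochhammer (a + c + of_nat k) (n - k))"
    using Re'(3) by (subst Vandermonde_alternating) (auto simp: add_pos_nonneg)
  also have "M * ((-1) ^ k * of_nat (n choose k) * \<dots>) =
      2 * of_real pi * fact k * of_nat (n choose k) * pochhammer (a + b) n * pochhammer (c - d) (n - k) *
           (Gamma (a + b) * Gamma (a + d + of_nat k) * Gamma (b + d + of_nat k))"
  proof (cases "k \<le> n")
    case True
    have "pochhammer (a + c) n \<noteq> 0" by (rule pochhammer_nonzero[OF Re'(3)])
    moreover have "pochhammer (a + c) n = pochhammer (a + c) k * pochhammer (a + c + of_nat k) (n - k)"
      by (rule pochhammer_product[OF True])
    ultimately have 1: "pochhammer (a + c) n * (pochhammer (a + d) k / pochhammer (a + c) k *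
        (pochhammer (c - d) (n - k) / pochhammer (a + c + of_nat k) (n - k))) = pochhammer (a + d) k * pochhammer (c - d) (n - k)"
      (is "_ * ?Z = _") by simp
    have 2: "(-1) ^ k * (-1) ^ k = (1::complex)" by (simp flip: power_mult_distrib)
    have "M * ((-1) ^ k * of_nat (n choose k) * ?Z) = 2 * of_real pi * Gamma (b + d + of_nat k) * Gamma (a + d) * Gamma (a + b) *
      pochhammer (a + b) n * fact k * of_nat (n choose k) * ((-1) ^ k * (-1) ^ k) * (pochhammer (a + c) n * ?Z)"
      unfolding M_def by (simp only: mult_ac)
    then show ?thesis
      unfolding 1 2 Gamma_plus_of_nat[OF Re'(2)] by (simp only: mult_ac mult_1)
  qed (simp add: binomial_eq_0)
  finally show ?eq unfolding eq .
qed

text \<open>Conjugation permutes the parameters, so the Gamma product at -ix is the conjugate of the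
  one at ix. The modulus of Gamma(2ix) comes from \<open>Gamma_norm_one\<close> at 2x and the
  functional equation.\<close>

lemma cdh_weight_eq_norm:
  assumes p: "dual_hahn_params a b d" and x: "x > 0"
  shows "cdh_weight a b d x = of_real ((norm (Gamma (a + \<i> * of_real x) * Gamma (b + \<i> * of_real x)
                        * Gamma (d + \<i> * of_real x) / Gamma (2 * \<i> * of_real x)))\<^sup>2)"
proof -
  let ?y = "\<i> * complex_of_real x"
  from p have conj: "Gamma (cnj a - ?y) * Gamma (cnj b - ?y) * Gamma (cnj d - ?y) = Gamma (a - ?y) * Gamma (b - ?y) * Gamma (d - ?y)"
    by (cases rule: dual_hahn_params_cnj_cases) (simp_all only: mult_ac)
  have ne: "2 * ?y \<notin> \<int>\<^sub>\<le>\<^sub>0"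
    using x by (auto elim!: nonpos_Ints_cases simp: complex_eq_iff)
  have "(norm (Gamma (1 + \<i> * of_real (2 * x))))\<^sup>2 = pi * (2 * x) / sinh (pi * (2 * x))"
    using x by (intro Gamma_norm_one) auto
  moreover have "Gamma (1 + \<i> * of_real (2 * x)) = 2 * ?y * Gamma (2 * ?y)"
    using Gamma_plus1[OF ne] by (simp add: add_ac mult_ac)
  ultimately have "(2 * x)\<^sup>2 * (norm (Gamma (2 * ?y)))\<^sup>2 = pi * (2 * x) / sinh (2 * pi * x)"
    using x by (simp add: norm_mult power_mult_distrib mult_ac)
  then have "(norm (Gamma (2 * ?y)))\<^sup>2 = pi * (2 * x) / sinh (2 * pi * x) / (2 * x)\<^sup>2"
    using x by (metis nonzero_mult_div_cancel_left power_not_zero less_numeral_extra(3) mult_eq_0_iff zero_neq_numeral)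
  then have N: "1 / (norm (Gamma (2 * ?y)))\<^sup>2 = 2 * x * sinh (2 * pi * x) / pi"
    using x by (simp add: power2_eq_square)
  have "complex_of_real ((norm (Gamma (a + ?y) * Gamma (b + ?y) * Gamma (d + ?y) / Gamma (2 * \<i> * of_real x)))\<^sup>2)
     = of_real ((norm (Gamma (a + ?y) * Gamma (b + ?y) * Gamma (d + ?y)))\<^sup>2) * of_real (1 / (norm (Gamma (2 * ?y)))\<^sup>2)"
    by (simp add: norm_divide power_divide mult_ac)
  also have "\<dots> = (Gamma (a + ?y) * Gamma (b + ?y) * Gamma (d + ?y)) * (Gamma (cnj a - ?y) * Gamma (cnj b - ?y) * Gamma (cnj d - ?y))
      * of_real (2 * x * sinh (2 * pi * x) / pi)"
    unfolding N complex_norm_square by (simp add: cnj_Gamma)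
  finally show ?thesis
    unfolding conj by (simp add: cdh_weight_def Gamma_pair_def mult_ac)
qed

section \<open>Euler integrals on the slit plane\<close>

abbreviation unit_lborel :: "real measure" where
  "unit_lborel \<equiv> restrict_space lborel {0<..<1}"

text \<open>On (0,1) this is t^(\<alpha>-1) (1-t)^(\<beta>-1); with real logarithms it is visibly
  entire in \<alpha> and \<beta>.\<close>

definition beta_kernel :: "complex \<Rightarrow> complex \<Rightarrow> real \<Rightarrow> complex" where
  "beta_kernel \<alpha> \<beta> t = exp ((\<alpha> - 1) * of_real (ln t)) * exp ((\<beta> - 1) * of_real (ln (1 - t)))"

lemma borel_measurable_beta_kernel [measurable]: "beta_kernel \<alpha> \<beta> \<in> borel_measurable borel"
  unfolding beta_kernel_def by measurable

lemma beta_kernel_of_real: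
  assumes "t \<in> {0<..<1}"
  shows "beta_kernel (of_real a) (of_real b) t = of_real (t powr (a - 1) * (1 - t) powr (b - 1))"
  using assms by (simp add: beta_kernel_def powr_def flip: exp_of_real)

lemma norm_beta_kernel: "norm (beta_kernel \<alpha> \<beta> t) = norm (beta_kernel (of_real (Re \<alpha>)) (of_real (Re \<beta>)) t)"
  by (simp add: beta_kernel_def norm_mult)

text \<open>Both logarithms are at most 0 on (0,1), so smaller real parts give a larger kernel. This
  supplies the locally uniform dominating function.\<close>

lemma norm_beta_kernel_antimono:
  assumes "t \<in> {0<..<1}" "a \<le> Re \<alpha>" "b \<le> Re \<beta>"
  shows "norm (beta_kernel \<alpha> \<beta> t) \<le> norm (beta_kernel (of_real a) (of_real b) t)"
proof -
  have "ln t \<le> 0" "ln (1 - t) \<le> 0" using assms by auto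
  then show ?thesis
    using assms by (auto simp: beta_kernel_def norm_mult intro!: mult_mono mult_right_mono_neg)
qed

lemma beta_kernel_real_integral:
  assumes "a > 0" "b > 0"
  shows "integrable unit_lborel (\<lambda>t. t powr (a - 1) * (1 - t) powr (b - 1))"
    and "(LINT t|unit_lborel. t powr (a - 1) * (1 - t) powr (b - 1)) = Beta a b"
proof -
  have eq: "indicator {0<..<1} t *\<^sub>R (t powr (a - 1) * (1 - t) powr (b - 1)) =
      indicator {0..1} t *\<^sub>R (t powr (a - 1) * (1 - t) powr (b - 1))" for t :: real
    by (auto simp: indicator_def)
  show "integrable unit_lborel (\<lambda>t. t powr (a - 1) * (1 - t) powr (b - 1))"
    using integrable_Beta[OF assms] unfolding set_integrable_def eq[symmetric]
    by (simp add: integrable_restrict_space)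
  have "(LINT t|unit_lborel. t powr (a - 1) * (1 - t) powr (b - 1)) =
      (LINT t:{0..1}|lborel. t powr (a - 1) * (1 - t) powr (b - 1))"
    unfolding set_lebesgue_integral_def eq[symmetric] by (simp add: integral_restrict_space)
  also have "\<dots> = Beta a b"
    using set_borel_integral_eq_integral(2)[OF integrable_Beta[OF assms]] has_integral_Beta_real[OF assms]
    by (simp add: integral_unique)
  finally show "(LINT t|unit_lborel. t powr (a - 1) * (1 - t) powr (b - 1)) = Beta a b" .
qed

lemma borel_measurable_unit_lborel:
  "f \<in> borel_measurable borel \<Longrightarrow> f \<in> borel_measurable unit_lborel"
  by (rule measurable_restrict_space1) simp

lemma integrable_norm_beta_kernel:
  assumes "Re \<alpha> > 0" "Re \<beta> > 0"
  shows "integrable unit_lborel (\<lambda>t. norm (beta_kernel \<alpha> \<beta> t))"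
proof -
  have "integrable unit_lborel (\<lambda>t. norm (beta_kernel \<alpha> \<beta> t)) \<longleftrightarrow>
     integrable unit_lborel (\<lambda>t. t powr (Re \<alpha> - 1) * (1 - t) powr (Re \<beta> - 1))"
    by (rule Bochner_Integration.integrable_cong)
       (auto simp: space_restrict_space norm_beta_kernel[of \<alpha>] beta_kernel_of_real abs_mult simp del: of_real_mult)
  then show ?thesis using beta_kernel_real_integral(1)[OF assms] by blast
qed

lemma holomorphic_on_beta_kernel_integral:
  assumes S: "open S" and f: "f holomorphic_on S" "\<And>z. z \<in> S \<Longrightarrow> Re (f z) > 0"
    and g: "g holomorphic_on S" "\<And>z. z \<in> S \<Longrightarrow> Re (g z) > 0"
  shows "(\<lambda>z. LINT t|unit_lborel. beta_kernel (f z) (g z) t) holomorphic_on S"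
proof (rule holomorphic_on_lebesgue_integral[OF S])
  show "(\<lambda>z. beta_kernel (f z) (g z) t) holomorphic_on S" for t
    unfolding beta_kernel_def by (intro holomorphic_intros f g)
  show "beta_kernel (f z) (g z) \<in> borel_measurable unit_lborel" for z
    by (intro borel_measurable_unit_lborel borel_measurable_beta_kernel)
  fix z assume z: "z \<in> S"
  have "continuous_on S f" "continuous_on S g"
    using f g by (auto intro: holomorphic_on_imp_continuous_on)
  then have "((\<lambda>w. Re (f w)) \<longlongrightarrow> Re (f z)) (at z)" "((\<lambda>w. Re (g w)) \<longlongrightarrow> Re (g z)) (at z)"
    using z S by (auto intro!: tendsto_Re simp: continuous_on_eq_continuous_at isCont_def)
  then have lim: "((\<lambda>w. Re (f w)) \<longlongrightarrow> Re (f z)) (nhds z)" "((\<lambda>w. Re (g w)) \<longlongrightarrow> Re (g z)) (nhds z)"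
    by (simp_all add: tendsto_nhds_iff)
  have "eventually (\<lambda>w. Re (f w) > Re (f z) / 2) (nhds z)" "eventually (\<lambda>w. Re (g w) > Re (g z) / 2) (nhds z)"
    using order_tendstoD(1)[OF lim(1), of "Re (f z) / 2"] order_tendstoD(1)[OF lim(2), of "Re (g z) / 2"]
      f(2)[OF z] g(2)[OF z] by simp_all
  then have "eventually (\<lambda>w. Re (f w) > Re (f z) / 2 \<and> Re (g w) > Re (g z) / 2) (nhds z)"
    by (rule eventually_conj)
  then obtain r where r: "r > 0" "\<And>w. dist w z < r \<Longrightarrow> Re (f w) > Re (f z) / 2 \<and> Re (g w) > Re (g z) / 2"
    unfolding eventually_nhds_metric by blast
  show "\<exists>r>0. \<exists>h. integrable unit_lborel h \<and>
      (\<forall>w\<in>ball z r \<inter> S. \<forall>t\<in>space unit_lborel. norm (beta_kernel (f w) (g w) t) \<le> h t)"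
  proof (intro exI[of _ r] conjI r(1) exI[of _ "\<lambda>t. norm (beta_kernel (of_real (Re (f z) / 2)) (of_real (Re (g z) / 2)) t)"] ballI)
    show "integrable unit_lborel (\<lambda>t. norm (beta_kernel (of_real (Re (f z) / 2)) (of_real (Re (g z) / 2)) t))"
      using f(2)[OF z] g(2)[OF z] by (intro integrable_norm_beta_kernel) auto
    fix w t assume "w \<in> ball z r \<inter> S" "t \<in> space unit_lborel"
    then show "norm (beta_kernel (f w) (g w) t) \<le> norm (beta_kernel (of_real (Re (f z) / 2)) (of_real (Re (g z) / 2)) t)"
      using r(2)[of w] by (intro norm_beta_kernel_antimono) (auto simp: space_restrict_space dist_commute)
  qed
qed

text \<open>The real Beta integral continued in one parameter at a time. \<open>rGamma\<close> is
  entire, so the right side is holomorphic without inspecting \<alpha> + \<beta>.\<close>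

lemma beta_kernel_integral:
  assumes "Re \<alpha> > 0" "Re \<beta> > 0"
  shows "(LINT t|unit_lborel. beta_kernel \<alpha> \<beta> t) = Gamma \<alpha> * Gamma \<beta> * rGamma (\<alpha> + \<beta>)"
proof -
  have real: "(LINT t|unit_lborel. beta_kernel (of_real a) (of_real b) t) =
       Gamma (of_real a) * Gamma (of_real b) * rGamma (of_real a + of_real b)" if "a > 0" "b > 0" for a b :: real
  proof -
    have "(LINT t|unit_lborel. beta_kernel (of_real a) (of_real b) t) =
       (LINT t|unit_lborel. of_real (t powr (a - 1) * (1 - t) powr (b - 1)))"
      by (intro Bochner_Integration.integral_cong refl beta_kernel_of_real) (simp add: space_restrict_space)
    also have "\<dots> = of_real (Beta a b)"
      unfolding integral_complex_of_real beta_kernel_real_integral(2)[OF that] ..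
    finally show ?thesis
      by (simp add: Beta_altdef Gamma_complex_of_real rGamma_complex_of_real flip: of_real_add)
  qed
  have 1: "(LINT t|unit_lborel. beta_kernel z (of_real b) t) =
       Gamma z * Gamma (of_real b) * rGamma (z + of_real b)" if "Re z > 0" "b > 0" for z b
    using that(1)
    by (rule eq_on_right_halfplane[rotated 3])
       (use that real in \<open>auto intro!: holomorphic_on_beta_kernel_integral open_halfspace_Re_gt holomorphic_intros dest: pos_Re_notin_nonpos_Ints\<close>)
  show ?thesis
    using assms(2)
    by (rule eq_on_right_halfplane[rotated 3])
       (use assms 1 in \<open>auto intro!: holomorphic_on_beta_kernel_integral open_halfspace_Re_gt holomorphic_intros dest: pos_Re_notin_nonpos_Ints\<close>)
qed

lemma beta_kernel_power:
  assumes "t \<in> {0<..<1}"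
  shows "beta_kernel \<alpha> \<beta> t * of_real t ^ n = beta_kernel (\<alpha> + of_nat n) \<beta> t"
proof -
  have "complex_of_real t ^ n = exp (of_nat n * of_real (ln t))"
    using assms by (simp add: exp_of_nat_mult exp_of_real)
  then show ?thesis by (simp add: beta_kernel_def algebra_simps exp_add exp_diff)
qed

lemma beta_kernel_moment:
  assumes "Re \<alpha> > 0" "Re \<beta> > 0"
  shows "(LINT t|unit_lborel. beta_kernel \<alpha> \<beta> t * of_real t ^ n) =
           Gamma \<alpha> * Gamma \<beta> * rGamma (\<alpha> + \<beta>) * (pochhammer \<alpha> n / pochhammer (\<alpha> + \<beta>) n)"
    and "Gamma \<alpha> * Gamma \<beta> * rGamma (\<alpha> + \<beta>) \<noteq> 0"
proof -
  have p: "Re (\<alpha> + \<beta>) > 0" "Re (\<alpha> + of_nat n) > 0" using assms by (auto simp: add_pos_nonneg)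
  have "(LINT t|unit_lborel. beta_kernel \<alpha> \<beta> t * of_real t ^ n) = (LINT t|unit_lborel. beta_kernel (\<alpha> + of_nat n) \<beta> t)"
    by (intro Bochner_Integration.integral_cong refl beta_kernel_power) (simp add: space_restrict_space)
  also have "\<dots> = Gamma (\<alpha> + of_nat n) * Gamma \<beta> * rGamma ((\<alpha> + \<beta>) + of_nat n)"
    using beta_kernel_integral[OF p(2) assms(2)] by (simp add: add_ac)
  also have "\<dots> = pochhammer \<alpha> n * Gamma \<alpha> * Gamma \<beta> * (rGamma (\<alpha> + \<beta>) / pochhammer (\<alpha> + \<beta>) n)"
    unfolding Gamma_plus_of_nat[OF assms(1)]
    using pochhammer_rGamma[of "\<alpha> + \<beta>" n] pochhammer_nonzero[OF p(1), of n] by simp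
  finally show "(LINT t|unit_lborel. beta_kernel \<alpha> \<beta> t * of_real t ^ n) =
           Gamma \<alpha> * Gamma \<beta> * rGamma (\<alpha> + \<beta>) * (pochhammer \<alpha> n / pochhammer (\<alpha> + \<beta>) n)"
    by simp
  show "Gamma \<alpha> * Gamma \<beta> * rGamma (\<alpha> + \<beta>) \<noteq> 0"
    using pos_Re_notin_nonpos_Ints[OF assms(1)] pos_Re_notin_nonpos_Ints[OF assms(2)] pos_Re_notin_nonpos_Ints[OF p(1)]
    by (simp add: Gamma_eq_zero_iff rGamma_eq_zero_iff)
qed

lemma hyp_domain_scale:
  assumes "z \<in> hyp_domain" "0 \<le> t" "t \<le> 1"
  shows "of_real t * z \<in> hyp_domain"
proof (rule ccontr)
  assume "of_real t * z \<notin> hyp_domain"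
  then obtain r :: real where r: "1 \<le> r" "of_real t * z = of_real r"
    by (auto simp: hyp_domain_def)
  then have "t > 0" using assms(2) by (cases "t = 0") auto
  then have "z = of_real (r / t)" using r by (simp add: field_simps)
  moreover have "1 \<le> r / t" using r assms(3) \<open>t > 0\<close> by (simp add: field_simps)
  ultimately show False using assms(1) unfolding hyp_domain_def by blast
qed

text \<open>Euler's integral raises the number of numerator and denominator parameters by one.\<close>

lemma Euler_transform:
  assumes g: "g holomorphic_on hyp_domain" "\<And>z. norm z < 1 \<Longrightarrow> (\<lambda>n. c n * z ^ n) sums g z"
    and Re: "Re \<alpha> > 0" "Re \<beta> > 0"
  obtains G where "G holomorphic_on hyp_domain"
    "\<And>z. norm z < 1 \<Longrightarrow> (\<lambda>n. c n * (pochhammer \<alpha> n / pochhammer (\<alpha> + \<beta>) n) * z ^ n) sums G z"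
proof -
  define H where "H = (\<lambda>z. LINT t|unit_lborel. beta_kernel \<alpha> \<beta> t * g (of_real t * z))"
  define N where "N = Gamma \<alpha> * Gamma \<beta> * rGamma (\<alpha> + \<beta>)"
  have N: "N \<noteq> 0" unfolding N_def by (rule beta_kernel_moment(2)[OF Re])
  have contg: "continuous_on hyp_domain g" using g(1) by (rule holomorphic_on_imp_continuous_on)
  have meas: "(\<lambda>t. beta_kernel \<alpha> \<beta> t * g (of_real t * z)) \<in> borel_measurable unit_lborel" if "z \<in> hyp_domain" for z
  proof -
    have "continuous_on {0<..<1} (\<lambda>t. g (of_real t * z))"
      by (rule continuous_on_compose2[OF contg]) (use that in \<open>auto intro!: continuous_intros hyp_domain_scale\<close>)
    then have "(\<lambda>t. g (of_real t * z)) \<in> borel_measurable (restrict_space borel {0<..<1})"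
      by (rule borel_measurable_continuous_on_restrict)
    then have "(\<lambda>t. g (of_real t * z)) \<in> borel_measurable unit_lborel"
      by (simp only: measurable_cong_sets[OF sets_restrict_space_cong[OF sets_lborel] refl])
    then show ?thesis
      by (rule borel_measurable_times[OF borel_measurable_unit_lborel[OF borel_measurable_beta_kernel]])
  qed
  have "H holomorphic_on hyp_domain"
    unfolding H_def
  proof (rule holomorphic_on_lebesgue_integral[OF open_hyp_domain _ meas])
    fix t assume "t \<in> space unit_lborel"
    then have t: "t \<in> {0<..<1}" by (simp add: space_restrict_space)
    then have "(g \<circ> (\<lambda>z. of_real t * z)) holomorphic_on hyp_domain"
      by (intro holomorphic_on_compose_gen[OF _ g(1)] holomorphic_intros) (auto intro!: hyp_domain_scale)
    then show "(\<lambda>z. beta_kernel \<alpha> \<beta> t * g (of_real t * z)) holomorphic_on hyp_domain"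
      by (intro holomorphic_intros) (simp add: o_def)
  next
    fix z assume "z \<in> hyp_domain"
    then obtain r where r: "r > 0" "cball z r \<subseteq> hyp_domain"
      using open_hyp_domain open_contains_cball by blast
    \<comment> \<open>All points t w with t in [0,1]: a compact subset of the slit plane, which is
      starlike about 0. One constant therefore bounds \<open>g\<close> for all t and w at
      once.\<close>
    define K where "K = (\<lambda>(t, w). of_real t * w) ` ({0..1::real} \<times> cball z r)"
    have "compact K"
      unfolding K_def case_prod_unfold
      by (intro compact_continuous_image continuous_intros compact_Times compact_Icc compact_cball)
    moreover have K: "K \<subseteq> hyp_domain"
      using r(2) by (auto simp: K_def intro!: hyp_domain_scale)
    ultimately have "bounded (g ` K)"
      by (intro compact_imp_bounded compact_continuous_image continuous_on_subset[OF contg])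
    then obtain B where B: "\<And>w. w \<in> K \<Longrightarrow> norm (g w) \<le> B"
      unfolding bounded_iff by blast
    show "\<exists>r>0. \<exists>h. integrable unit_lborel h \<and>
        (\<forall>w\<in>ball z r \<inter> hyp_domain. \<forall>t\<in>space unit_lborel. norm (beta_kernel \<alpha> \<beta> t * g (of_real t * w)) \<le> h t)"
    proof (intro exI[of _ r] conjI r(1) exI[of _ "\<lambda>t. norm (beta_kernel \<alpha> \<beta> t) * B"] ballI)
      show "integrable unit_lborel (\<lambda>t. norm (beta_kernel \<alpha> \<beta> t) * B)"
        by (intro integrable_mult_left integrable_norm_beta_kernel Re)
      fix w t assume "w \<in> ball z r \<inter> hyp_domain" "t \<in> space unit_lborel"
      then have "of_real t * w \<in> K"
        by (auto simp: K_def space_restrict_space intro!: image_eqI[of _ _ "(t, w)"])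
      then show "norm (beta_kernel \<alpha> \<beta> t * g (of_real t * w)) \<le> norm (beta_kernel \<alpha> \<beta> t) * B"
        unfolding norm_mult by (intro mult_left_mono B) auto
    qed
  qed
  moreover have "(\<lambda>n. c n * (pochhammer \<alpha> n / pochhammer (\<alpha> + \<beta>) n) * z ^ n) sums (H z / N)" if z: "norm z < 1" for z
  proof -
    define f where "f = (\<lambda>n t. beta_kernel \<alpha> \<beta> t * (c n * (of_real t * z) ^ n))"
    \<comment> \<open>A radius between |z| and 1 upgrades convergence at \<open>s\<close> to
      absolute convergence at \<open>z\<close>.\<close>
    obtain s where s: "norm z < s" "s < 1" using dense[OF z] by blast
    have "norm (complex_of_real s) < 1"
      using s le_less_trans[OF norm_ge_zero s(1)] by simp
    from sums_summable[OF g(2)[OF this]] have "summable (\<lambda>n. c n * of_real s ^ n)" .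
    then have sum: "summable (\<lambda>n. norm (c n * z ^ n))"
      by (rule powser_insidea) (use s in auto)
    have le: "norm (f n t) \<le> norm (c n * z ^ n) * norm (beta_kernel \<alpha> \<beta> t)" if "t \<in> {0<..<1}" for n t
    proof -
      have "\<bar>t\<bar> ^ n \<le> 1" using that by (intro power_le_one) auto
      then have "\<bar>t\<bar> ^ n * (norm (c n * z ^ n) * norm (beta_kernel \<alpha> \<beta> t)) \<le>
          1 * (norm (c n * z ^ n) * norm (beta_kernel \<alpha> \<beta> t))"
        by (intro mult_right_mono) auto
      then show ?thesis
        by (simp add: f_def norm_mult norm_power power_mult_distrib mult_ac)
    qed
    have ik: "integrable unit_lborel (\<lambda>t. norm (c n * z ^ n) * norm (beta_kernel \<alpha> \<beta> t))" for n
      by (intro integrable_mult_right integrable_norm_beta_kernel Re)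
    have fm: "f n \<in> borel_measurable unit_lborel" for n
      unfolding f_def by (intro borel_measurable_unit_lborel) measurable
    have fi: "integrable unit_lborel (f n)" for n
      by (rule Bochner_Integration.integrable_bound[OF ik[of n] fm])
         (use le[of _ n] in \<open>auto simp: space_restrict_space intro!: AE_I2\<close>)
    have "(\<lambda>n. LINT t|unit_lborel. f n t) sums (LINT t|unit_lborel. (\<Sum>n. f n t))"
    proof (rule sums_integral[OF fi])
      show "AE t in unit_lborel. summable (\<lambda>n. norm (f n t))"
      proof (rule AE_I2)
        fix t assume "t \<in> space unit_lborel"
        then show "summable (\<lambda>n. norm (f n t))"
          using le by (intro summable_comparison_test[OF _ summable_mult2[OF sum]]) (auto simp: space_restrict_space)
      qed
      show "summable (\<lambda>n. LINT t|unit_lborel. norm (f n t))"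
      proof (rule summable_comparison_test)
        show "summable (\<lambda>n. norm (c n * z ^ n) * (LINT t|unit_lborel. norm (beta_kernel \<alpha> \<beta> t)))"
          using sum by (rule summable_mult2)
        have "(LINT t|unit_lborel. norm (f n t)) \<le> norm (c n * z ^ n) * (LINT t|unit_lborel. norm (beta_kernel \<alpha> \<beta> t))" for n
          unfolding integral_mult_right_zero[symmetric]
          by (intro integral_mono integrable_norm fi ik) (use le in \<open>auto simp: space_restrict_space\<close>)
        then show "\<exists>N. \<forall>n\<ge>N. norm (LINT t|unit_lborel. norm (f n t)) \<le> norm (c n * z ^ n) * (LINT t|unit_lborel. norm (beta_kernel \<alpha> \<beta> t))"
          by auto
      qed
    qed
    also have "(LINT t|unit_lborel. (\<Sum>n. f n t)) = H z"
      unfolding H_def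
    proof (intro Bochner_Integration.integral_cong refl)
      fix t assume "t \<in> space unit_lborel"
      then have t: "t \<in> {0<..<1}" by (simp add: space_restrict_space)
      then have "norm (of_real t * z) \<le> 1 * norm z"
        unfolding norm_mult by (intro mult_right_mono) auto
      then have "norm (of_real t * z) < 1" using z by simp
      from sums_mult[OF g(2)[OF this]] show "(\<Sum>n. f n t) = beta_kernel \<alpha> \<beta> t * g (of_real t * z)"
        unfolding f_def by (rule sums_unique[symmetric])
    qed
    also have "(\<lambda>n. LINT t|unit_lborel. f n t) = (\<lambda>n. N * (c n * (pochhammer \<alpha> n / pochhammer (\<alpha> + \<beta>) n) * z ^ n))"
    proof
      fix n
      have "(LINT t|unit_lborel. f n t) = (LINT t|unit_lborel. (c n * z ^ n) * (beta_kernel \<alpha> \<beta> t * of_real t ^ n))"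
        by (simp add: f_def power_mult_distrib mult_ac)
      also have "\<dots> = (c n * z ^ n) * (N * (pochhammer \<alpha> n / pochhammer (\<alpha> + \<beta>) n))"
        unfolding integral_mult_right_zero beta_kernel_moment(1)[OF Re] N_def ..
      finally show "(LINT t|unit_lborel. f n t) = N * (c n * (pochhammer \<alpha> n / pochhammer (\<alpha> + \<beta>) n) * z ^ n)"
        by (simp add: mult_ac)
    qed
    finally have "(\<lambda>n. N * (c n * (pochhammer \<alpha> n / pochhammer (\<alpha> + \<beta>) n) * z ^ n) / N) sums (H z / N)"
      by (rule sums_divide)
    then show ?thesis using N by simp
  qed
  ultimately show thesis
    using N by (intro that[of "\<lambda>z. H z / N"]) (auto intro!: holomorphic_intros)
qed

section \<open>The generating function\<close>

text \<open>The binomial series: a 1F0, from which two Euler integrals will build the 3F2.\<close>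

lemma powr_minus_sums:
  fixes z s :: complex
  assumes "norm z < 1"
  shows "(\<lambda>n. pochhammer s n / fact n * z ^ n) sums ((1 - z) powr (- s))"
proof -
  have "(\<lambda>n. ((- s) gchoose n) * (- z) ^ n) sums (1 + (- z)) powr (- s)"
    using assms by (intro gen_binomial_complex) simp
  moreover have "((- s) gchoose n) * (- z) ^ n = pochhammer s n / fact n * z ^ n" for n
  proof -
    have "(-1) ^ n * (- z) ^ n = z ^ n" by (simp flip: power_mult_distrib)
    then show ?thesis by (simp add: gbinomial_pochhammer mult_ac)
  qed
  ultimately show ?thesis by simp
qed

text \<open>The Euler integrals pair a + ix with b - ix and a - ix with c + ix: x cancels in the
  sums a + b and a + c, and all four real parts are positive.\<close>

lemma hypF_3F2_continuation:
  fixes a b c \<gamma> :: complex and x :: real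
  assumes Re: "Re a > 0" "Re b > 0" "Re c > 0"
  obtains f where "f holomorphic_on hyp_domain"
    "\<And>z. norm z < 1 \<Longrightarrow> (\<lambda>n. pochhammer \<gamma> n / fact n * (pochhammer (a + \<i> * of_real x) n * pochhammer (a - \<i> * of_real x) n /
        (pochhammer (a + b) n * pochhammer (a + c) n)) * z ^ n) sums f z"
    "\<And>z. z \<in> hyp_domain \<Longrightarrow> hypF [\<gamma>, a + \<i> * of_real x, a - \<i> * of_real x] [a + b, a + c] z = f z"
proof -
  have 0: "(\<lambda>z. (1 - z) powr (- \<gamma>)) holomorphic_on hyp_domain"
  proof (intro holomorphic_intros)
    fix z assume z: "z \<in> hyp_domain"
    show "1 - z \<notin> \<real>\<^sub>\<le>\<^sub>0"
    proof
      assume "1 - z \<in> \<real>\<^sub>\<le>\<^sub>0"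
      then obtain r where r: "r \<le> 0" "1 - z = of_real r" by (auto simp: nonpos_Reals_def)
      then have "z = of_real (1 - r)" by (simp add: algebra_simps)
      moreover have "1 - r \<in> {1..}" using r(1) by simp
      ultimately show False using z unfolding hyp_domain_def by blast
    qed
  qed
  obtain g where g: "g holomorphic_on hyp_domain"
    "\<And>z. norm z < 1 \<Longrightarrow> (\<lambda>n. pochhammer \<gamma> n / fact n * (pochhammer (a + \<i> * of_real x) n /
       pochhammer ((a + \<i> * of_real x) + (b - \<i> * of_real x)) n) * z ^ n) sums g z"
    using Euler_transform[OF 0 powr_minus_sums, of "a + \<i> * of_real x" "b - \<i> * of_real x"] Re by auto
  obtain f where f: "f holomorphic_on hyp_domain"
    "\<And>z. norm z < 1 \<Longrightarrow> (\<lambda>n. pochhammer \<gamma> n / fact n * (pochhammer (a + \<i> * of_real x) n /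
       pochhammer ((a + \<i> * of_real x) + (b - \<i> * of_real x)) n) * (pochhammer (a - \<i> * of_real x) n /
       pochhammer ((a - \<i> * of_real x) + (c + \<i> * of_real x)) n) * z ^ n) sums f z"
    using Euler_transform[OF g, of "a - \<i> * of_real x" "c + \<i> * of_real x"] Re by auto
  have sums: "(\<lambda>n. pochhammer \<gamma> n / fact n * (pochhammer (a + \<i> * of_real x) n * pochhammer (a - \<i> * of_real x) n /
        (pochhammer (a + b) n * pochhammer (a + c) n)) * z ^ n) sums f z" if "norm z < 1" for z
    using f(2)[OF that] by (simp add: mult_ac)
  show thesis
  proof (rule that[OF f(1) sums])
    show "hypF [\<gamma>, a + \<i> * of_real x, a - \<i> * of_real x] [a + b, a + c] z = f z" if "z \<in> hyp_domain" for z
    proof (rule hypF_eqI[OF f(1) _ _ that])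
      fix u :: complex assume "u \<in> ball 0 1"
      then have "norm u < 1" by simp
      from sums[OF this] show "f u = hyp_series [\<gamma>, a + \<i> * of_real x, a - \<i> * of_real x] [a + b, a + c] u"
        by (simp add: hyp_series_def sums_iff mult_ac)
    qed simp
  qed
qed

text \<open>The Taylor series of (1 - z)^(-s) at 0, kept formal so that coefficients of products and
  powers are obtained algebraically.\<close>

definition pochhammer_fps :: "complex \<Rightarrow> complex fps" where
  "pochhammer_fps s = Abs_fps (\<lambda>n. pochhammer s n / fact n)"

lemma has_fps_expansion_powr_minus: "(\<lambda>z. (1 - z) powr (- s)) has_fps_expansion pochhammer_fps s"
proof (rule has_fps_expansionI)
  have "eventually (\<lambda>z::complex. z \<in> ball 0 1) (nhds 0)"
    by (intro eventually_nhds_in_open) auto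
  then show "eventually (\<lambda>z. (\<lambda>n. fps_nth (pochhammer_fps s) n * z ^ n) sums ((1 - z) powr (- s))) (nhds 0)"
    by eventually_elim (unfold pochhammer_fps_def fps_nth_Abs_fps, rule powr_minus_sums, simp)
qed

text \<open>The exponent law for (1 - z)^(-s) amounts to the binomial theorem for rising
  factorials.\<close>

lemma pochhammer_fps_mult: "pochhammer_fps s * pochhammer_fps t = pochhammer_fps (s + t)"
proof (rule fps_ext)
  fix n
  have "fps_nth (pochhammer_fps s * pochhammer_fps t) n =
      (\<Sum>i\<le>n. of_nat (n choose i) * pochhammer s i * pochhammer t (n - i) / fact n)"
    unfolding fps_mult_nth atLeast0AtMost
    by (intro sum.cong refl) (simp add: pochhammer_fps_def binomial_fact)
  also have "\<dots> = fps_nth (pochhammer_fps (s + t)) n"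
    by (simp add: pochhammer_fps_def pochhammer_binomial_sum sum_divide_distrib)
  finally show "fps_nth (pochhammer_fps s * pochhammer_fps t) n = fps_nth (pochhammer_fps (s + t)) n" .
qed

lemma pochhammer_fps_power: "pochhammer_fps 1 ^ n = pochhammer_fps (of_nat n)"
proof (induction n)
  case 0
  show ?case by (rule fps_ext) (auto simp: pochhammer_fps_def pochhammer_0_left)
next
  case (Suc n)
  then show ?case by (simp add: pochhammer_fps_mult add_ac)
qed

text \<open>Since z/(z-1) = -z (1-z)^(-1), the j-th term of the 3F2 contributes (-z)^j
  (1-z)^(-\<gamma>-j). In its n-th coefficient (\<gamma>)_j (\<gamma>+j)_(n-j) collapses to
  (\<gamma>)_n, which leaves the terminating sum for S_n.\<close>

lemma cdual_hahn_generating_function: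
  fixes a b c \<gamma> \<rho> :: complex and x :: real
  assumes Re: "Re a > 0" "Re b > 0" "Re c > 0" and \<rho>: "norm \<rho> < 1"
  shows "(\<lambda>n. pochhammer \<gamma> n / (fact n * pochhammer (a + b) n * pochhammer (a + c) n) * cdual_hahn n x a b c * \<rho> ^ n) sums
     ((1 - \<rho>) powr (- \<gamma>) * hypF [\<gamma>, a + \<i> * of_real x, a - \<i> * of_real x] [a + b, a + c] (\<rho> / (\<rho> - 1)))"
proof -
  define P where "P = (\<lambda>n. pochhammer (a + \<i> * of_real x) n * pochhammer (a - \<i> * of_real x) n /
        (pochhammer (a + b) n * pochhammer (a + c) n))"
  obtain f where f: "f holomorphic_on hyp_domain"
    "\<And>z. norm z < 1 \<Longrightarrow> (\<lambda>n. pochhammer \<gamma> n / fact n * P n * z ^ n) sums f z"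
    "\<And>z. z \<in> hyp_domain \<Longrightarrow> hypF [\<gamma>, a + \<i> * of_real x, a - \<i> * of_real x] [a + b, a + c] z = f z"
    unfolding P_def using hypF_3F2_continuation[OF Re] by blast
  define F where "F = Abs_fps (\<lambda>n. pochhammer \<gamma> n / fact n * P n)"
  define Z where "Z = fps_const (-1) * (fps_X * pochhammer_fps 1)"
  \<comment> \<open>z / (z - 1) = r would give z = r / (r - 1), of modulus above 1 for r > 1 and
    impossible for r = 1.\<close>
  have dom: "z / (z - 1) \<in> hyp_domain" if z: "norm z < 1" for z
  proof (rule ccontr)
    assume "z / (z - 1) \<notin> hyp_domain"
    then obtain r :: real where r: "r \<ge> 1" "z / (z - 1) = of_real r" by (auto simp: hyp_domain_def)
    have "z \<noteq> 1" using z by auto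
    with r have "z = of_real r * (z - 1)" by (simp add: field_simps)
    then have eq: "z * of_real (r - 1) = of_real r" by (simp add: algebra_simps)
    have "norm (z * of_real (r - 1)) \<le> 1 * norm (complex_of_real (r - 1))"
      unfolding norm_mult using z by (intro mult_right_mono) auto
    then have "\<bar>r\<bar> \<le> \<bar>r - 1\<bar>" unfolding eq norm_of_real by simp
    with r show False by simp
  qed
  define h where "h = (\<lambda>z. (1 - z) powr (- \<gamma>) * (f \<circ> (\<lambda>z. z / (z - 1))) z)"
  have Z: "(\<lambda>z. z / (z - 1)) has_fps_expansion Z"
  proof -
    have "(\<lambda>z. -1 * (z * (1 - z) powr (- 1))) has_fps_expansion Z"
      unfolding Z_def by (intro fps_expansion_intros has_fps_expansion_powr_minus)
    moreover have "eventually (\<lambda>z::complex. z \<in> ball 0 1) (nhds 0)"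
      by (intro eventually_nhds_in_open) auto
    then have ev: "eventually (\<lambda>z::complex. -1 * (z * (1 - z) powr (- 1)) = z / (z - 1)) (nhds 0)"
    proof eventually_elim
      fix z :: complex assume "z \<in> ball 0 1"
      then have "1 - z \<noteq> 0" by auto
      then show "-1 * (z * (1 - z) powr (- 1)) = z / (z - 1)"
        by (simp add: powr_minus field_simps)
    qed
    ultimately show ?thesis
      using has_fps_expansion_cong[OF ev refl] by blast
  qed
  have F: "f has_fps_expansion F"
  proof (rule has_fps_expansionI)
    have "eventually (\<lambda>z::complex. z \<in> ball 0 1) (nhds 0)"
      by (intro eventually_nhds_in_open) auto
    then show "eventually (\<lambda>z. (\<lambda>n. fps_nth F n * z ^ n) sums f z) (nhds 0)"
      by eventually_elim (unfold F_def fps_nth_Abs_fps, rule f(2), simp)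
  qed
  have Z0: "fps_nth Z 0 = 0" by (simp add: Z_def)
  have h: "h has_fps_expansion pochhammer_fps \<gamma> * (F oo Z)"
    unfolding h_def by (intro fps_expansion_intros has_fps_expansion_powr_minus F Z Z0)
  have hol: "h holomorphic_on eball 0 1"
  proof -
    have "(f \<circ> (\<lambda>z. z / (z - 1))) holomorphic_on ball 0 1"
      by (intro holomorphic_on_compose_gen[OF _ f(1)] holomorphic_intros) (auto intro: dom)
    moreover have "(\<lambda>z::complex. (1 - z) powr (- \<gamma>)) holomorphic_on ball 0 1"
    proof (intro holomorphic_intros)
      fix z :: complex assume "z \<in> ball 0 1"
      then have "Re z < 1" using complex_Re_le_cmod[of z] by simp
      then show "1 - z \<notin> \<real>\<^sub>\<le>\<^sub>0" by (auto simp: complex_nonpos_Reals_iff)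
    qed
    ultimately have "h holomorphic_on ball 0 1" unfolding h_def by (intro holomorphic_on_mult)
    moreover have "eball (0::complex) 1 = ball 0 1" by (auto simp: eball_def one_ereal_def)
    ultimately show ?thesis by simp
  qed
  have coeff: "fps_nth (pochhammer_fps \<gamma> * (F oo Z)) n =
      pochhammer \<gamma> n / (fact n * pochhammer (a + b) n * pochhammer (a + c) n) * cdual_hahn n x a b c" for n
  proof -
    have "fps_nth (pochhammer_fps \<gamma> * (F oo Z)) n = (\<Sum>i\<le>n. fps_nth (pochhammer_fps \<gamma>) i * (\<Sum>j\<le>n - i. fps_nth F j * fps_nth (Z ^ j) (n - i)))"
      by (simp add: fps_mult_nth fps_compose_nth atLeast0AtMost)
    \<comment> \<open>\<open>Z\<close> has no constant term, so \<open>Z ^ j\<close> has no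
      coefficient below degree j and the inner range may be extended to n.\<close>
    also have "\<dots> = (\<Sum>i\<le>n. fps_nth (pochhammer_fps \<gamma>) i * (\<Sum>j\<le>n. fps_nth F j * fps_nth (Z ^ j) (n - i)))"
      using startsby_zero_power_prefix[OF Z0]
      by (intro sum.cong refl arg_cong2[where f="(*)"] sum.mono_neutral_left) auto
    also have "\<dots> = (\<Sum>j\<le>n. fps_nth F j * fps_nth (pochhammer_fps \<gamma> * Z ^ j) n)"
      unfolding fps_mult_nth atLeast0AtMost sum_distrib_left
      by (subst sum.swap) (simp add: mult_ac)
    also have "\<dots> = (\<Sum>j\<le>n. pochhammer \<gamma> n / fact n * ((-1) ^ j * of_nat (n choose j) * P j))"
    proof (intro sum.cong refl)
      fix j assume "j \<in> {..n}"
      then have j: "j \<le> n" by simp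
      have "pochhammer_fps \<gamma> * Z ^ j = fps_const ((-1) ^ j) * (fps_X ^ j * pochhammer_fps (\<gamma> + of_nat j))"
        unfolding Z_def power_mult_distrib fps_const_power pochhammer_fps_power pochhammer_fps_mult[symmetric]
        by (simp only: mult_ac)
      then have "fps_nth (pochhammer_fps \<gamma> * Z ^ j) n = (-1) ^ j * (pochhammer (\<gamma> + of_nat j) (n - j) / fact (n - j))"
        using j by (simp add: fps_X_power_mult_nth pochhammer_fps_def)
      moreover have "pochhammer \<gamma> n = pochhammer \<gamma> j * pochhammer (\<gamma> + of_nat j) (n - j)"
        using j by (rule pochhammer_product)
      ultimately show "fps_nth F j * fps_nth (pochhammer_fps \<gamma> * Z ^ j) n =
          pochhammer \<gamma> n / fact n * ((-1) ^ j * of_nat (n choose j) * P j)"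
        using j by (simp add: F_def binomial_fact)
    qed
    also have "\<dots> = pochhammer \<gamma> n / fact n * (\<Sum>j\<le>n. (-1) ^ j * of_nat (n choose j) * P j)"
      by (rule sum_distrib_left[symmetric])
    also have "\<dots> = pochhammer \<gamma> n / (fact n * pochhammer (a + b) n * pochhammer (a + c) n) * cdual_hahn n x a b c"
      unfolding cdual_hahn_altdef P_def
      using pochhammer_nonzero[of "a + b" n] pochhammer_nonzero[of "a + c" n] Re by simp
    finally show ?thesis .
  qed
  have "(\<lambda>n. fps_nth (pochhammer_fps \<gamma> * (F oo Z)) n * \<rho> ^ n) sums h \<rho>"
    by (rule has_fps_expansion_imp_sums_complex[OF h hol]) (use \<rho> in \<open>simp add: one_ereal_def\<close>)
  then show ?thesis
    unfolding coeff h_def using f(3)[OF dom[OF \<rho>]] by simp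
qed

section \<open>Interchanging summation and integration\<close>

text \<open>If \<open>a\<close> or \<open>b\<close> is non-real and the two are not conjugate,
  \<open>c\<close> and \<open>d\<close> must both be its conjugate; in all other cases both are real
  and positive. The comparison of weights is thus trivial or between positive parameters.\<close>

lemma dual_hahn_params_last:
  assumes "dual_hahn_params a b c" "dual_hahn_params a b d"
  shows "c = d \<or> pos_param c \<and> pos_param d"
proof -
  have c: "cnj z = w \<and> cnj w = z" if "conj_params z w" for z w
    using that by (simp add: conj_params_def)
  have p: "pos_param z \<Longrightarrow> cnj z = z" for z by (rule pos_param_cnj)
  show ?thesis
    using assms unfolding dual_hahn_params_def by (elim disjE conjE; metis c p)
qed

text \<open>For positive \<open>c\<close> and \<open>d\<close>, monotonicity of the Gamma ratio
  compares \<open>d\<close> with c + m for large m, and the shift by m costs only the polynomial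
  (c+ix)_m (c-ix)_m.\<close>

lemma cdh_weight_ratio_bound:
  assumes p: "dual_hahn_params a b c" "dual_hahn_params a b d"
  obtains B N where "B \<ge> 0" "\<And>x. norm (cdh_weight a b d x) \<le> B * (1 + \<bar>x\<bar>) ^ N * norm (cdh_weight a b c x)"
proof (cases "c = d")
  case True
  then show ?thesis using that[of 1 0] by simp
next
  case False
  then have "pos_param c" "pos_param d" using dual_hahn_params_last[OF p] by auto
  then obtain c' d' where cd: "c = of_real c'" "d = of_real d'" "c' > 0" "d' > 0"
    by (auto simp: pos_param_def elim!: Reals_cases)
  obtain m :: nat where m: "d' \<le> c' + real m"
    by (metis real_arch_simple add_increasing less_imp_le cd(3))
  define L where "L = Gamma d' / Gamma (c' + real m)"
  have L: "L \<ge> 0" unfolding L_def using cd by (intro divide_nonneg_nonneg) (auto simp: add_pos_nonneg)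
  obtain B where B: "B \<ge> 0" "\<And>x. norm (pochhammer (c + \<i> * of_real x) m * pochhammer (c - \<i> * of_real x) m) \<le> B * (1 + \<bar>x\<bar>) ^ (2 * m)"
    using pochhammer_times_bound[of c m] by blast
  have "norm (cdh_weight a b d x) \<le> (L\<^sup>2 * B) * (1 + \<bar>x\<bar>) ^ (2 * m) * norm (cdh_weight a b c x)" for x
  proof -
    have G: "Gamma (c' + real m) > 0" using cd by (simp add: add_pos_nonneg)
    have "norm (Gamma (of_real d' + \<i> * of_real x)) \<le> L * norm (Gamma (of_real (c' + real m) + \<i> * of_real x))"
      using Gamma_norm_ratio_mono[OF cd(4) m, of x] Gamma_real_pos[OF cd(4)] G
      by (simp add: L_def field_simps)
    then have "(norm (Gamma (of_real d' + \<i> * of_real x)))\<^sup>2 \<le> (L * norm (Gamma (of_real (c' + real m) + \<i> * of_real x)))\<^sup>2"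
      by (intro power_mono) auto
    then have "norm (Gamma_pair d (\<i> * of_real x)) \<le> L\<^sup>2 * norm (Gamma_pair (of_real (c' + real m)) (\<i> * of_real x))"
      unfolding cd Gamma_pair_of_real norm_of_real by (simp add: power_mult_distrib)
    moreover have "complex_of_real (c' + real m) = c + of_nat m" by (simp add: cd)
    ultimately have "norm (Gamma_pair d (\<i> * of_real x)) \<le> L\<^sup>2 * norm (Gamma_pair (c + of_nat m) (\<i> * of_real x))"
      by simp
    then have "norm (Gamma_pair a (\<i> * of_real x) * Gamma_pair b (\<i> * of_real x)) * norm (Gamma_pair d (\<i> * of_real x))
       * norm (complex_of_real (2 * x * sinh (2 * pi * x) / pi)) \<le>
       norm (Gamma_pair a (\<i> * of_real x) * Gamma_pair b (\<i> * of_real x)) * (L\<^sup>2 * norm (Gamma_pair (c + of_nat m) (\<i> * of_real x)))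
       * norm (complex_of_real (2 * x * sinh (2 * pi * x) / pi))"
      by (intro mult_right_mono mult_left_mono) auto
    then have "norm (cdh_weight a b d x) \<le> L\<^sup>2 * norm (cdh_weight a b (c + of_nat m) x)"
      unfolding cdh_weight_def norm_mult by (simp only: mult_ac)
    also have "cdh_weight a b (c + of_nat m) x = cdh_weight (c + of_nat m) (a + of_nat 0) b x"
      by (simp add: cdh_weight_def mult_ac)
    also have "\<dots> = pochhammer (c + \<i> * of_real x) m * pochhammer (c - \<i> * of_real x) m *
        (pochhammer (a + \<i> * of_real x) 0 * pochhammer (a - \<i> * of_real x) 0) * cdh_weight c a b x"
      by (rule cdh_weight_pochhammer[symmetric]) (use dual_hahn_params_Re[OF p(1)] in auto)
    also have "\<dots> = pochhammer (c + \<i> * of_real x) m * pochhammer (c - \<i> * of_real x) m * cdh_weight a b c x"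
      by (simp add: cdh_weight_def mult_ac)
    also have "L\<^sup>2 * norm \<dots> \<le> L\<^sup>2 * ((B * (1 + \<bar>x\<bar>) ^ (2 * m)) * norm (cdh_weight a b c x))"
      unfolding norm_mult[of _ "cdh_weight a b c x"] by (intro mult_left_mono mult_right_mono B) auto
    finally show ?thesis by (simp only: mult_ac)
  qed
  then show ?thesis using that[of "L\<^sup>2 * B" "2 * m"] B(1) by simp
qed

text \<open>The product integral with d = c and k = n; moduli may be inserted because the polynomial
  is real and the weight nonnegative. The norm in \<open>\<nu>\<close> spares a separate proof that
  the Gamma product is positive.\<close>

lemma integral_norm_cdual_hahn:
  assumes p: "dual_hahn_params a b c"
  defines "\<nu> \<equiv> \<lambda>n. norm (2 * of_real pi * fact n * pochhammer (a + b) n *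
           (Gamma (a + b) * Gamma (a + c + of_nat n) * Gamma (b + c + of_nat n)))"
  shows "integrable pos_lborel (\<lambda>x. (norm (cdual_hahn n x a b c))\<^sup>2 * norm (cdh_weight a b c x))"
    and "(LINT x|pos_lborel. (norm (cdual_hahn n x a b c))\<^sup>2 * norm (cdh_weight a b c x)) = \<nu> n"
proof -
  note Re = dual_hahn_params_Re[OF p]
  have eq: "cdual_hahn n x a b c * (cdual_hahn n x a b c * cdh_weight a b c x) =
      of_real ((norm (cdual_hahn n x a b c))\<^sup>2 * norm (cdh_weight a b c x))" if "x \<in> space pos_lborel" for x
  proof -
    have "x > 0" using that by (simp add: space_restrict_space)
    from cdh_weight_eq_norm[OF p this] have "cdh_weight a b c x = of_real (norm (cdh_weight a b c x))"
      by (metis abs_of_nonneg norm_of_real zero_le_power2)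
    moreover have "cdual_hahn n x a b c * cdual_hahn n x a b c = of_real ((norm (cdual_hahn n x a b c))\<^sup>2)"
      using complex_norm_square[of "cdual_hahn n x a b c"] cnj_cdual_hahn_real[OF p] by simp
    ultimately show ?thesis by (metis mult.assoc of_real_mult)
  qed
  have "integrable pos_lborel (\<lambda>x. complex_of_real ((norm (cdual_hahn n x a b c))\<^sup>2 * norm (cdh_weight a b c x)))"
    using integral_cdual_hahn_product(2)[OF Re Re(3), of n n]
    by (subst Bochner_Integration.integrable_cong[OF refl eq[symmetric]])
  then show "integrable pos_lborel (\<lambda>x. (norm (cdual_hahn n x a b c))\<^sup>2 * norm (cdh_weight a b c x))"
    by (simp only: complex_of_real_integrable_eq)
  let ?I = "LINT x|pos_lborel. (norm (cdual_hahn n x a b c))\<^sup>2 * norm (cdh_weight a b c x)"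
  have "complex_of_real ?I = (LINT x|pos_lborel. cdual_hahn n x a b c * (cdual_hahn n x a b c * cdh_weight a b c x))"
    unfolding integral_complex_of_real[symmetric]
    by (rule Bochner_Integration.integral_cong[OF refl eq[symmetric]])
  also have "\<dots> = 2 * of_real pi * fact n * pochhammer (a + b) n *
           (Gamma (a + b) * Gamma (a + c + of_nat n) * Gamma (b + c + of_nat n))"
    unfolding integral_cdual_hahn_product(1)[OF Re Re(3)] by simp
  finally have "norm (complex_of_real ?I) = \<nu> n" unfolding \<nu>_def by (rule arg_cong)
  moreover have "?I \<ge> 0" by (intro Bochner_Integration.integral_nonneg) auto
  ultimately show "?I = \<nu> n" by simp
qed

text \<open>Serves the ratio test: every linear factor z + n is asymptotic in modulus to n +
  1.\<close>

lemma norm_shift_asymp: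
  fixes z :: complex
  shows "(\<lambda>n. norm (z + of_nat n) / real (Suc n)) \<longlonglongrightarrow> 1"
proof -
  have "(\<lambda>n. inverse (complex_of_nat (Suc n))) \<longlonglongrightarrow> 0"
    using LIMSEQ_Suc[OF lim_inverse_n] .
  then have "(\<lambda>n. norm ((z - 1) * inverse (complex_of_nat (Suc n)) + 1)) \<longlonglongrightarrow> norm ((z - 1) * 0 + 1)"
    by (intro tendsto_intros)
  moreover have "norm ((z - 1) * inverse (complex_of_nat (Suc n)) + 1) = norm (z + of_nat n) / real (Suc n)" for n
  proof -
    have "(z - 1) * inverse (complex_of_nat (Suc n)) + 1 = (z + of_nat n) / of_nat (Suc n)"
      by (simp add: field_simps del: of_nat_Suc) (simp add: algebra_simps)
    then show ?thesis by (simp only: norm_divide norm_of_nat)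
  qed
  ultimately show ?thesis by simp
qed

theorem corollary6p5:
  fixes k :: nat and \<rho> \<gamma> a b c d :: complex
  assumes "norm \<rho> < 1"
    and "dual_hahn_params a b c"
    and "dual_hahn_params a b d"
  shows "let f = (\<lambda>x::real.
      (1 - \<rho>) powr (- \<gamma>)
      * hypF [\<gamma>, a + \<i> * of_real x, a - \<i> * of_real x] [a + b, a + c] (\<rho> / (\<rho> - 1))
      * of_real ((norm (Gamma (a + \<i> * of_real x) * Gamma (b + \<i> * of_real x)
                        * Gamma (d + \<i> * of_real x) / Gamma (2 * \<i> * of_real x)))\<^sup>2)
      * cdual_hahn k x a b d)
    in set_integrable lborel {0<..} f \<and>
    (LINT x:{0<..}|lborel. f x) =
      2 * of_real pi
      * (pochhammer \<gamma> k * Gamma (a + b) * Gamma (of_nat k + a + d) * Gamma (of_nat k + b + d)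
         / pochhammer (a + c) k)
      * hypF [c - d, \<gamma> + of_nat k] [of_nat k + a + c] \<rho> * \<rho> ^ k"
proof -
  note \<rho> = assms(1) and p = assms(2,3)
  note Re = dual_hahn_params_Re[OF p(1)] dual_hahn_params_Re(3)[OF p(2)]
  have Re': "Re (a + b) > 0" "Re (a + c) > 0" "Re (b + c) > 0" using Re by simp_all
  define S where "S = (\<lambda>n x. cdual_hahn n x a b c)"
  define T where "T = (\<lambda>x. cdual_hahn k x a b d)"
  define wc where "wc = cdh_weight a b c"
  define wd where "wd = cdh_weight a b d"
  define coef where "coef = (\<lambda>n. pochhammer \<gamma> n / (fact n * pochhammer (a + b) n * pochhammer (a + c) n))"
  define f where "f = (\<lambda>n x. coef n * \<rho> ^ n * (S n x * (T x * wd x)))"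
  define F where "F = (\<lambda>x. (1 - \<rho>) powr (- \<gamma>) * hypF [\<gamma>, a + \<i> * complex_of_real x, a - \<i> * of_real x] [a + b, a + c] (\<rho> / (\<rho> - 1)))"
  define \<nu> where "\<nu> = (\<lambda>n. norm (2 * of_real pi * fact n * pochhammer (a + b) n *
           (Gamma (a + b) * Gamma (a + c + of_nat n) * Gamma (b + c + of_nat n))))"
  \<comment> \<open>\<open>sqrt (\<nu> n)\<close> is the L^2 norm of \<open>S n\<close>; up to a
    factor independent of \<open>n\<close>, \<open>e n\<close> will bound the L^1 norm of
    \<open>f n\<close>.\<close>
  define e where "e = (\<lambda>n. norm (coef n * \<rho> ^ n) * sqrt (\<nu> n))"

  have fi: "integrable pos_lborel (f n)" for n
    unfolding f_def S_def T_def wd_def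
    by (intro integrable_mult_right integral_cdual_hahn_product(2) Re)
  have f_integral: "(LINT x|pos_lborel. f n x) = coef n * \<rho> ^ n *
      (2 * of_real pi * fact k * of_nat (n choose k) * pochhammer (a + b) n * pochhammer (c - d) (n - k) *
           (Gamma (a + b) * Gamma (a + d + of_nat k) * Gamma (b + d + of_nat k)))" for n
    unfolding f_def S_def T_def wd_def integral_mult_right_zero integral_cdual_hahn_product(1)[OF Re] ..
  have f_sums: "(\<lambda>n. f n x) sums (F x * (T x * wd x))" for x
  proof -
    have "(\<lambda>n. coef n * S n x * \<rho> ^ n * (T x * wd x)) sums (F x * (T x * wd x))"
      unfolding coef_def S_def F_def by (intro sums_mult2 cdual_hahn_generating_function Re \<rho>)
    then show ?thesis by (simp add: f_def mult_ac)
  qed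
  have f_abs_summable: "summable (\<lambda>n. norm (f n x))" for x
  proof -
    obtain s where s: "norm \<rho> < s" "s < 1" using dense[OF \<rho>] by blast
    have "norm (complex_of_real s) < 1" using s le_less_trans[OF norm_ge_zero s(1)] by simp
    from sums_summable[OF cdual_hahn_generating_function[OF Re(1-3) this]]
    have "summable (\<lambda>n. coef n * S n x * of_real s ^ n)" unfolding coef_def S_def .
    then have "summable (\<lambda>n. norm (coef n * S n x * \<rho> ^ n))"
      by (rule powser_insidea) (use s in auto)
    then have "summable (\<lambda>n. norm (coef n * S n x * \<rho> ^ n) * norm (T x * wd x))"
      by (rule summable_mult2)
    then show ?thesis by (simp add: f_def norm_mult mult_ac)
  qed

  have \<nu>_pos: "\<nu> n > 0" for n
  proof -
    have "Gamma (a + b) \<noteq> 0" "Gamma (a + c + of_nat n) \<noteq> 0" "Gamma (b + c + of_nat n) \<noteq> 0"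
      using Re' by (auto simp: Gamma_eq_zero_iff intro!: pos_Re_notin_nonpos_Ints add_pos_nonneg)
    then show ?thesis unfolding \<nu>_def using pochhammer_nonzero[OF Re'(1), of n] by simp
  qed
  have "summable e"
  proof -
    \<comment> \<open>The exact quotient of consecutive \<open>e n\<close>: \<open>\<nu>\<close>
      gains (n+1) |a+b+n| |a+c+n| |b+c+n| under the root. Dividing each modulus by n + 1 exhibits
      the limit |\<rho>|.\<close>
    define r where "r = (\<lambda>n. norm \<rho> * (norm (\<gamma> + of_nat n) / real (Suc n)) * sqrt ((norm (b + c + of_nat n) / real (Suc n)) /
        ((norm (a + b + of_nat n) / real (Suc n)) * (norm (a + c + of_nat n) / real (Suc n)))))"
    have "r \<longlonglongrightarrow> norm \<rho> * 1 * sqrt (1 / (1 * 1))"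
      unfolding r_def by (intro tendsto_intros norm_shift_asymp) auto
    then have rlim: "r \<longlonglongrightarrow> norm \<rho>" by simp
    have estep: "e (Suc n) = r n * e n" for n
    proof -
      define A where "A = norm (a + b + of_nat n)"
      define B where "B = norm (a + c + of_nat n)"
      define C where "C = norm (b + c + of_nat n)"
      define N where "N = real (Suc n)"
      have "a + b + of_nat n \<noteq> 0" "a + c + of_nat n \<noteq> 0"
        using Re by (auto simp: complex_eq_iff)
      then have AB: "A > 0" "B > 0" and N: "N > 0" by (auto simp: A_def B_def N_def)
      have G: "Gamma (z + of_nat (Suc n)) = (z + of_nat n) * Gamma (z + of_nat n)" if "Re z > 0" for z
      proof -
        have "z + of_nat n \<notin> \<int>\<^sub>\<le>\<^sub>0"
          using that by (intro pos_Re_notin_nonpos_Ints) (simp add: add_pos_nonneg)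
        from Gamma_plus1[OF this] show ?thesis by (simp add: add_ac)
      qed
      have f: "norm (fact (Suc n) :: complex) = N * norm (fact n :: complex)"
        by (simp add: N_def norm_mult del: of_nat_Suc)
      have "\<nu> (Suc n) = N * A * B * C * \<nu> n"
        unfolding \<nu>_def G[OF Re'(2)] G[OF Re'(3)] norm_mult pochhammer_Suc f A_def B_def C_def by simp
      moreover have "norm (coef (Suc n) * \<rho> ^ Suc n) = norm \<rho> * norm (\<gamma> + of_nat n) / (N * A * B) * norm (coef n * \<rho> ^ n)"
        unfolding coef_def norm_mult norm_divide pochhammer_Suc f A_def B_def power_Suc by (simp add: mult_ac)
      ultimately have "e (Suc n) = (norm \<rho> * norm (\<gamma> + of_nat n) / (N * A * B) * sqrt (N * A * B * C)) * e n"
        unfolding e_def by (simp only: real_sqrt_mult mult_ac)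
      also have "norm \<rho> * norm (\<gamma> + of_nat n) / (N * A * B) * sqrt (N * A * B * C) = r n"
      proof -
        have "sqrt ((C / N) / ((A / N) * (B / N))) = sqrt (N * A * B * C / (A * B)\<^sup>2)"
          using AB N by (simp add: field_simps power2_eq_square)
        also have "\<dots> = sqrt (N * A * B * C) / (A * B)"
          using AB by (simp add: real_sqrt_divide)
        finally show ?thesis
          unfolding r_def A_def[symmetric] B_def[symmetric] C_def[symmetric] N_def[symmetric] by simp
      qed
      finally show ?thesis .
    qed
    obtain s where s: "norm \<rho> < s" "s < 1" using dense[OF \<rho>] by blast
    obtain N where N: "\<And>n. n \<ge> N \<Longrightarrow> r n < s"
      using order_tendstoD(2)[OF rlim s(1)] by (auto simp: eventually_sequentially)
    have epos: "e n \<ge> 0" for n using less_imp_le[OF \<nu>_pos[of n]] by (simp add: e_def)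
    show ?thesis
    proof (rule summable_ratio_test[OF s(2), of N])
      fix n assume "n \<ge> N"
      then have "r n * e n \<le> s * e n"
        using less_imp_le[OF N] epos by (intro mult_right_mono)
      then show "norm (e (Suc n)) \<le> s * norm (e n)"
        using epos[of n] epos[of "Suc n"] estep[of n] by simp
    qed
  qed

  obtain B M where B: "B \<ge> 0" "\<And>x. norm (wd x) \<le> B * (1 + \<bar>x\<bar>) ^ M * norm (wc x)"
    unfolding wc_def wd_def using cdh_weight_ratio_bound[OF p] by blast
  define Q where "Q = (\<lambda>x. B * (1 + \<bar>x\<bar>) ^ M)"
  have Q: "Q x \<ge> 0" for x using B(1) by (simp add: Q_def)
  have Tint: "integrable pos_lborel (\<lambda>x. (norm (T x))\<^sup>2 * Q x * norm (wd x))"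
  proof -
    obtain D where D: "D \<ge> 0" "\<And>x. norm (T x) \<le> D * (1 + \<bar>x\<bar>) ^ (2 * k)"
      unfolding T_def using cdual_hahn_bound by blast
    have "integrable lborel (\<lambda>x. of_real ((norm (T x))\<^sup>2 * Q x) * wd x)"
      unfolding wd_def
    proof (rule integrable_polynomial_times_cdh_weight[OF Re(1,2,4)])
      show "(\<lambda>x. complex_of_real ((norm (T x))\<^sup>2 * Q x)) \<in> borel_measurable borel"
        unfolding T_def Q_def by measurable
      fix x
      have "(norm (T x))\<^sup>2 \<le> (D * (1 + \<bar>x\<bar>) ^ (2 * k))\<^sup>2" by (intro power_mono D) auto
      then have "(norm (T x))\<^sup>2 * Q x \<le> (D * (1 + \<bar>x\<bar>) ^ (2 * k))\<^sup>2 * Q x"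
        using Q by (intro mult_right_mono)
      also have "\<dots> = (D\<^sup>2 * B) * (1 + \<bar>x\<bar>) ^ (2 * k + 2 * k + M)"
        unfolding Q_def power_add power2_eq_square by (simp only: mult_ac)
      finally show "norm (complex_of_real ((norm (T x))\<^sup>2 * Q x)) \<le> (D\<^sup>2 * B) * (1 + \<bar>x\<bar>) ^ (2 * k + 2 * k + M)"
        unfolding norm_of_real using Q[of x] by (subst abs_of_nonneg) auto
    qed
    from integrable_norm[OF integrable_pos_lborel[OF this]] show ?thesis
      unfolding norm_mult norm_of_real using Q by (simp add: abs_mult)
  qed
  define K where "K = (LINT x|pos_lborel. (norm (T x))\<^sup>2 * Q x * norm (wd x))"

  have f_bound: "(LINT x|pos_lborel. norm (f n x)) \<le> e n * ((1 + K) / 2)" for n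
  proof -
    \<comment> \<open>Cauchy-Schwarz appears as the inequality of arithmetic and geometric means,
      scaled by the norm \<open>l\<close> of \<open>S n\<close>: both halves then integrate to
      multiples of \<open>l\<close>.\<close>
    define l where "l = sqrt (\<nu> n)"
    have l: "l > 0" "l\<^sup>2 = \<nu> n" using \<nu>_pos[of n] by (simp_all add: l_def)
    have "norm (S n x * (T x * wd x)) \<le> (1 / (2 * l)) * ((norm (S n x))\<^sup>2 * norm (wc x)) + (l / 2) * ((norm (T x))\<^sup>2 * Q x * norm (wd x))" for x
    proof -
      define X where "X = (norm (S n x))\<^sup>2 * norm (wc x) / l"
      define Y where "Y = l * ((norm (T x))\<^sup>2 * Q x * norm (wd x))"
      have XY: "X \<ge> 0" "Y \<ge> 0" using l Q by (auto simp: X_def Y_def)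
      have "(norm (S n x * (T x * wd x)))\<^sup>2 = ((norm (S n x))\<^sup>2 * (norm (T x))\<^sup>2 * norm (wd x)) * norm (wd x)"
        by (simp add: norm_mult power_mult_distrib power2_eq_square mult_ac)
      \<comment> \<open>Only one of the two factors \<open>norm (wd x)\<close> is traded for the
        weight with \<open>c\<close>; the other stays with \<open>T\<close>.\<close>
      also have "\<dots> \<le> ((norm (S n x))\<^sup>2 * (norm (T x))\<^sup>2 * norm (wd x)) * (Q x * norm (wc x))"
        unfolding Q_def by (intro mult_left_mono B) auto
      also have "\<dots> = X * Y" using l(1) by (simp add: X_def Y_def)
      also have "\<dots> \<le> ((X + Y) / 2)\<^sup>2"
      proof -
        have "(X + Y)\<^sup>2 = (X - Y)\<^sup>2 + 4 * (X * Y)" by (simp add: power2_eq_square algebra_simps)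
        then have "4 * (X * Y) \<le> (X + Y)\<^sup>2" by simp
        then show ?thesis by (simp add: power_divide)
      qed
      finally have "norm (S n x * (T x * wd x)) \<le> (X + Y) / 2"
        by (rule power2_le_imp_le) (use XY in auto)
      then show ?thesis by (simp add: X_def Y_def add_divide_distrib)
    qed
    note le = this
    have Sint: "integrable pos_lborel (\<lambda>x. (norm (S n x))\<^sup>2 * norm (wc x))"
      "(LINT x|pos_lborel. (norm (S n x))\<^sup>2 * norm (wc x)) = \<nu> n"
      unfolding S_def wc_def \<nu>_def by (rule integral_norm_cdual_hahn[OF p(1)])+
    have "(LINT x|pos_lborel. norm (S n x * (T x * wd x))) \<le>
        (LINT x|pos_lborel. (1 / (2 * l)) * ((norm (S n x))\<^sup>2 * norm (wc x)) + (l / 2) * ((norm (T x))\<^sup>2 * Q x * norm (wd x)))"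
    proof (rule integral_mono)
      show "integrable pos_lborel (\<lambda>x. norm (S n x * (T x * wd x)))"
        unfolding S_def T_def wd_def by (intro integrable_norm integral_cdual_hahn_product(2) Re)
      show "integrable pos_lborel (\<lambda>x. (1 / (2 * l)) * ((norm (S n x))\<^sup>2 * norm (wc x)) + (l / 2) * ((norm (T x))\<^sup>2 * Q x * norm (wd x)))"
        by (intro Bochner_Integration.integrable_add integrable_mult_right Sint Tint)
    qed (rule le)
    also have "\<dots> = (1 / (2 * l)) * \<nu> n + (l / 2) * K"
      unfolding K_def Sint(2)[symmetric]
      by (subst Bochner_Integration.integral_add) (auto intro!: integrable_mult_right Sint Tint simp only: integral_mult_right_zero)
    also have "\<dots> = l * ((1 + K) / 2)"
      unfolding l(2)[symmetric] using l(1) by (simp add: field_simps power2_eq_square)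
    finally have "norm (coef n * \<rho> ^ n) * (LINT x|pos_lborel. norm (S n x * (T x * wd x))) \<le> norm (coef n * \<rho> ^ n) * (l * ((1 + K) / 2))"
      by (rule mult_left_mono) auto
    then show ?thesis
      unfolding f_def norm_mult[of "coef n * \<rho> ^ n"] integral_mult_right_zero e_def l_def by (simp only: mult_ac)
  qed
  have f_L1: "summable (\<lambda>n. LINT x|pos_lborel. norm (f n x))"
    by (rule summable_comparison_test[OF _ summable_mult2[OF \<open>summable e\<close>, of "(1 + K) / 2"]])
       (use f_bound in auto)
  have AEs: "AE x in pos_lborel. summable (\<lambda>n. norm (f n x))"
    using f_abs_summable by (intro AE_I2)
  have suminf: "(\<Sum>n. f n x) = F x * (T x * wd x)" for x using f_sums by (rule sums_unique[symmetric])
  have int: "integrable pos_lborel (\<lambda>x. F x * (T x * wd x))"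
    using integrable_suminf[OF fi AEs f_L1] unfolding suminf .
  have sums: "(\<lambda>n. LINT x|pos_lborel. f n x) sums (LINT x|pos_lborel. F x * (T x * wd x))"
    using sums_integral[OF fi AEs f_L1] unfolding suminf .

  define C where "C = 2 * of_real pi * (pochhammer \<gamma> k * Gamma (a + b) * Gamma (of_nat k + a + d) * Gamma (of_nat k + b + d)
         / pochhammer (a + c) k) * \<rho> ^ k"
  \<comment> \<open>The terms of the 2F1, indexed by i = n - k.\<close>
  define t where "t = (\<lambda>i. pochhammer (c - d) i * pochhammer (\<gamma> + of_nat k) i / pochhammer (of_nat k + a + c) i * (\<rho> ^ i / fact i))"
  have shift: "(LINT x|pos_lborel. f (i + k) x) = C * t i" for i
  proof -
    have *: "fact k * of_nat ((i + k) choose k) / fact (i + k) = (1 / fact i :: complex)"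
      by (simp add: binomial_fact)
    have "(LINT x|pos_lborel. f (i + k) x) = 2 * of_real pi * pochhammer \<gamma> (i + k) / pochhammer (a + c) (i + k) * \<rho> ^ (i + k)
        * pochhammer (c - d) i * (fact k * of_nat ((i + k) choose k) / fact (i + k))
        * (Gamma (a + b) * Gamma (a + d + of_nat k) * Gamma (b + d + of_nat k))"
      unfolding f_integral coef_def using pochhammer_nonzero[OF Re'(1), of "i + k"] by (simp add: field_simps)
    also have "\<dots> = C * t i"
    proof -
      have PP: "pochhammer z (i + k) = pochhammer z k * pochhammer (z + of_nat k) i" for z :: complex
        using pochhammer_product'[of z k i] by (simp add: add.commute)
      show ?thesis unfolding * PP C_def t_def by (simp add: power_add add_ac mult_ac)
    qed
    finally show ?thesis .
  qed
  \<comment> \<open>The binomial coefficient in \<open>f_integral\<close> removes the terms with n <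
    k; this is where the factor \<rho>^k in \<open>C\<close> originates.\<close>
  have "(\<Sum>n<k. LINT x|pos_lborel. f n x) = 0"
    unfolding f_integral by (intro sum.neutral) (auto simp: binomial_eq_0)
  then have Csums: "(\<lambda>i. C * t i) sums (LINT x|pos_lborel. F x * (T x * wd x))"
    using sums sums_iff_shift'[of "\<lambda>n. LINT x|pos_lborel. f n x" k] unfolding shift by simp
  \<comment> \<open>Summability of \<open>t\<close> is inherited from \<open>Csums\<close> by
    division. If \<open>C\<close> is 0, for instance when \<rho> = 0 and k > 0, both sides are
    0.\<close>
  have val: "(LINT x|pos_lborel. F x * (T x * wd x)) = C * (\<Sum>i. t i)"
  proof (cases "C = 0")
    case True
    then show ?thesis using Csums by (simp add: sums_iff)
  next
    case False
    have "(\<lambda>i. inverse C * (C * t i)) = t"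
      using False by (simp add: fun_eq_iff)
    with sums_mult[OF Csums, of "inverse C"] have "t sums (inverse C * (LINT x|pos_lborel. F x * (T x * wd x)))"
      by (simp only:)
    then show ?thesis using False by (simp add: sums_iff)
  qed
  have hyp: "hypF [c - d, \<gamma> + of_nat k] [of_nat k + a + c] \<rho> = (\<Sum>i. t i)"
    using \<rho> by (simp add: hypF_def hyp_series_def t_def)

  define g where "g = (\<lambda>x::real.
      (1 - \<rho>) powr (- \<gamma>)
      * hypF [\<gamma>, a + \<i> * of_real x, a - \<i> * of_real x] [a + b, a + c] (\<rho> / (\<rho> - 1))
      * of_real ((norm (Gamma (a + \<i> * of_real x) * Gamma (b + \<i> * of_real x)
                        * Gamma (d + \<i> * of_real x) / Gamma (2 * \<i> * of_real x)))\<^sup>2)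
      * cdual_hahn k x a b d)"
  have g: "g x = F x * (T x * wd x)" if "x \<in> space pos_lborel" for x
  proof -
    have "x > 0" using that by (simp add: space_restrict_space)
    from cdh_weight_eq_norm[OF p(2) this, symmetric] show ?thesis
      unfolding g_def F_def T_def wd_def by (simp only: mult_ac)
  qed
  have "integrable pos_lborel g"
    using int by (subst Bochner_Integration.integrable_cong[OF refl g])
  then have 1: "set_integrable lborel {0<..} g"
    unfolding set_integrable_def by (simp add: integrable_restrict_space)
  have "(LINT x:{0<..}|lborel. g x) = (LINT x|pos_lborel. g x)"
    unfolding set_lebesgue_integral_def by (simp add: integral_restrict_space)
  also have "\<dots> = (LINT x|pos_lborel. F x * (T x * wd x))"
    by (rule Bochner_Integration.integral_cong[OF refl g])
  also have "\<dots> = 2 * of_real pi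
      * (pochhammer \<gamma> k * Gamma (a + b) * Gamma (of_nat k + a + d) * Gamma (of_nat k + b + d)
         / pochhammer (a + c) k)
      * hypF [c - d, \<gamma> + of_nat k] [of_nat k + a + c] \<rho> * \<rho> ^ k"
    unfolding val hyp C_def by (simp only: mult_ac)
  finally show ?thesis
    using 1 unfolding Let_def g_def by blast
qed

end
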